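(* Let $G\subseteq U(2)$ be a finite unitary reflection group and let $E\subseteq\mathbb C^2$ be a good bounded $G$-invariant domain containing the origin, with Bergman kernel $K(z,w)$. Assume: (i) the holomorphic function $(z,\zeta)\mapsto K(z,\overline{\zeta})$ on $\widetilde{E}=\{(z,\overline{w})\colon z,w\in E\}\subseteq\mathbb{C}^2\times\mathbb{C}^2$ can be analytically continued past every boundary point $(z,\overline{w})\in b\widetilde E$ with $z\neq w$; (ii) there are two $G$-invariant sets $\mathcal S_1,\mathcal S_2\subseteq\mathcal R_G$ such that (a) $\mathcal R_G=\mathcal S_1\cup\mathcal S_2$; (b) $\mathcal S_1\cap\mathcal S_2=\emptyset$; (c) $\mathcal S_j=\mathcal R_{G_j}$ for $j=1,2$, where $G_j=G_{\mathcal S_j}$ is the subgroup of $G$ generated by all reflections of $G$ whose reflecting hyperplane lies in $\mathcal S_j$. For $p\in(1,+\infty)$ and $H\in\{G,G_1,G_2\}$ set $$K_{H,p}(z,w)=|J_H(z)|^{\frac{2}{p}-1}K_H(z,w)|J_H(w)|^{1-\frac{2}{p}},\qquad K_H(z,w)=\frac{1}{|H|}\sum_{h\in H}K(z,h.w)\overline{\det(h)}.$$ Then for every $p\in(1,+\infty)$ there exists a positive constant $C$ such that for all $z,w\in E$, $$|K_{G,p}(z,w)|\leq C\frac{1}{|G|}\sum_{g\in G}\left(|K_{G_1,p}(g.z,w)|+|K_{G_2,p}(g.z,w)|+1\right).$$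
   Context: A (unitary) reflection is an element of $U(n)$ of finite order whose fixed point set is a (complex) hyperplane, its reflecting hyperplane $Y_r=\{v: r.v=v\}$. A finite unitary reflection group (f.u.r.g.) is a finite subgroup of $U(n)$ generated by reflections. For a f.u.r.g. $H$, $\mathcal R_H$ denotes the set of reflecting hyperplanes of reflections in $H$; $H$ acts on $\mathcal R_H$ by $g.Y=\{g.v: v\in Y\}$. For $Y\in\mathcal R_H$, $H_Y=\{g\in H: g.v=v\ \forall v\in Y\}$ is cyclic, of order $m_Y$ (the multiplicity of $Y$ in $H$). A root $e_Y$ of $Y$ is a unit vector orthogonal to $Y$. The Jacobian polynomial of $H$ is $J_H(z)=\prod_{Y\in\mathcal R_H}\langle z,e_Y\rangle^{m_Y-1}$ ($\langle\cdot,\cdot\rangle$ the standard Hermitian product); it depends on the choice of roots only up to a unimodular constant, so $|J_H|$ is well defined. A bounded $G$-invariant domain $E$ is good if for every $Y\in\mathcal R_G$, $Y\cap E$ is connected and $Y\cap bE=b_Y(Y\cap E)$, where $b_Y$ is the topological boundary relative to $Y$. The Bergman kernel $K(z,w)$ of $E$ is the integral kernel of the orthogonal projection $L^2(E)\to L^2(E)\cap\mathcal O(E)$; $(z,\zeta)\mapsto K(z,\overline\zeta)$ is holomorphic on $\widetilde E$. A holomorphic function on a domain $\Omega$ can be analytically continued past $q\in b\Omega$ if there is an open ball $B$ centered at $q$ such that it extends holomorphically to $\Omega\cup B$. *)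

theory Defs
  imports "HOL-Analysis.Analysis"
begin

type_synonym cvec = "complex ^ 2"
type_synonym cmat = "complex ^ 2 ^ 2"

text \<open>Standard Hermitian product on C^2: <z,w> = sum z_i conj(w_i).\<close>
definition herm :: "cvec \<Rightarrow> cvec \<Rightarrow> complex" where
  "herm z w = (\<Sum>i\<in>UNIV. z $ i * cnj (w $ i))"

definition vcnj :: "cvec \<Rightarrow> cvec" where
  "vcnj w = (\<chi> i. cnj (w $ i))"

definition adjoint_mat :: "cmat \<Rightarrow> cmat" where
  "adjoint_mat A = (\<chi> i j. cnj (A $ j $ i))"

definition unitary :: "cmat \<Rightarrow> bool" where
  "unitary A \<longleftrightarrow> A ** adjoint_mat A = mat 1 \<and> adjoint_mat A ** A = mat 1"

definition mpow :: "cmat \<Rightarrow> nat \<Rightarrow> cmat" where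
  "mpow A n = (((**) A) ^^ n) (mat 1)"

text \<open>Fixed point set of a matrix acting on C^2.\<close>
definition fixset :: "cmat \<Rightarrow> cvec set" where
  "fixset A = {v. A *v v = v}"

text \<open>Complex hyperplane (through the origin) in C^2.\<close>
definition chyperplane :: "cvec set \<Rightarrow> bool" where
  "chyperplane Y \<longleftrightarrow> (\<exists>c. c \<noteq> 0 \<and> Y = {v. (\<Sum>i\<in>UNIV. c $ i * v $ i) = 0})"

text \<open>Unitary reflection: unitary element of finite order whose fixed point set
  is a complex hyperplane.\<close>
definition reflection :: "cmat \<Rightarrow> bool" where
  "reflection r \<longleftrightarrow> unitary r \<and> (\<exists>n>0. mpow r n = mat 1) \<and> chyperplane (fixset r)"

text \<open>Subgroup (of GL) generated by a set of matrices.\<close>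
inductive_set gen_grp :: "cmat set \<Rightarrow> cmat set" for S where
  gen_one: "mat 1 \<in> gen_grp S"
| gen_base: "s \<in> S \<Longrightarrow> s \<in> gen_grp S"
| gen_mult: "a \<in> gen_grp S \<Longrightarrow> b \<in> gen_grp S \<Longrightarrow> a ** b \<in> gen_grp S"
| gen_inv: "a \<in> gen_grp S \<Longrightarrow> matrix_inv a \<in> gen_grp S"

text \<open>Finite unitary reflection group in U(2).\<close>
definition furg :: "cmat set \<Rightarrow> bool" where
  "furg G \<longleftrightarrow> finite G \<and> (\<forall>g\<in>G. unitary g) \<and> G = gen_grp {r\<in>G. reflection r}"

text \<open>Reflecting hyperplanes R_H.\<close>
definition refl_hyps :: "cmat set \<Rightarrow> cvec set set" where
  "refl_hyps H = {Y. \<exists>r\<in>H. reflection r \<and> Y = fixset r}"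

text \<open>Pointwise stabiliser H_Y and multiplicity m_Y.\<close>
definition stab :: "cmat set \<Rightarrow> cvec set \<Rightarrow> cmat set" where
  "stab H Y = {g\<in>H. \<forall>v\<in>Y. g *v v = v}"

definition mult :: "cmat set \<Rightarrow> cvec set \<Rightarrow> nat" where
  "mult H Y = card (stab H Y)"

text \<open>A (chosen) root of Y: a unit vector orthogonal to Y.\<close>
definition root :: "cvec set \<Rightarrow> cvec" where
  "root Y = (SOME e. norm e = 1 \<and> (\<forall>v\<in>Y. herm v e = 0))"

text \<open>Jacobian polynomial (determined up to a unimodular constant; only its
  modulus is used).\<close>
definition jac :: "cmat set \<Rightarrow> cvec \<Rightarrow> complex" where
  "jac H z = (\<Prod>Y\<in>refl_hyps H. (herm z (root Y)) ^ (mult H Y - 1))"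

text \<open>Subgroup G_S generated by the reflections of G with hyperplane in S.\<close>
definition sub_gen :: "cmat set \<Rightarrow> cvec set set \<Rightarrow> cmat set" where
  "sub_gen G S = gen_grp {r\<in>G. reflection r \<and> fixset r \<in> S}"

definition G_inv_hyps :: "cmat set \<Rightarrow> cvec set set \<Rightarrow> bool" where
  "G_inv_hyps G S \<longleftrightarrow> (\<forall>g\<in>G. \<forall>Y\<in>S. ((*v) g) ` Y \<in> S)"

definition G_inv_set :: "cmat set \<Rightarrow> cvec set \<Rightarrow> bool" where
  "G_inv_set G E \<longleftrightarrow> (\<forall>g\<in>G. ((*v) g) ` E = E)"

text \<open>Good domain.\<close>
definition good :: "cmat set \<Rightarrow> cvec set \<Rightarrow> bool" where
  "good G E \<longleftrightarrow> (\<forall>Y\<in>refl_hyps G. connected (Y \<inter> E) \<and>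
      Y \<inter> frontier E = (top_of_set Y) frontier_of (Y \<inter> E))"

text \<open>Holomorphy in several complex variables: complex-linear Frechet derivative.\<close>
definition holo_on :: "cvec set \<Rightarrow> (cvec \<Rightarrow> complex) \<Rightarrow> bool" where
  "holo_on S f \<longleftrightarrow> (\<forall>x\<in>S. \<exists>c::cvec.
      (f has_derivative (\<lambda>h. \<Sum>i\<in>UNIV. c $ i * h $ i)) (at x))"

definition holo2_on :: "(cvec \<times> cvec) set \<Rightarrow> (cvec \<times> cvec \<Rightarrow> complex) \<Rightarrow> bool" where
  "holo2_on S F \<longleftrightarrow> (\<forall>x\<in>S. \<exists>a b::cvec.
      (F has_derivative (\<lambda>(h,k). (\<Sum>i\<in>UNIV. a $ i * h $ i) + (\<Sum>i\<in>UNIV. b $ i * k $ i))) (at x))"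

definition L2 :: "cvec set \<Rightarrow> (cvec \<Rightarrow> complex) set" where
  "L2 E = {f. set_borel_measurable lebesgue E f \<and>
               set_integrable lebesgue E (\<lambda>z. (cmod (f z))\<^sup>2)}"

definition A2 :: "cvec set \<Rightarrow> (cvec \<Rightarrow> complex) set" where
  "A2 E = {f. f \<in> L2 E \<and> holo_on E f}"

text \<open>K is the Bergman kernel of E: the integral kernel of the orthogonal projection
  L^2(E) \<rightarrow> A^2(E) (Pf \<in> A^2 and f - Pf \<perp> A^2), with the canonical representative
  (w \<mapsto> conj K(z,w) holomorphic and square integrable).\<close>
definition bergman_kernel :: "cvec set \<Rightarrow> (cvec \<Rightarrow> cvec \<Rightarrow> complex) \<Rightarrow> bool" where
  "bergman_kernel E K \<longleftrightarrow>
     (\<forall>z\<in>E. (\<lambda>w. cnj (K z w)) \<in> A2 E) \<and>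
     (\<forall>f\<in>L2 E.
        (\<forall>z\<in>E. set_integrable lebesgue E (\<lambda>w. K z w * f w)) \<and>
        (let Pf = (\<lambda>z. set_lebesgue_integral lebesgue E (\<lambda>w. K z w * f w)) in
          Pf \<in> A2 E \<and>
          (\<forall>g\<in>A2 E. set_lebesgue_integral lebesgue E (\<lambda>w. (f w - Pf w) * cnj (g w)) = 0)))"

definition tilde :: "cvec set \<Rightarrow> (cvec \<times> cvec) set" where
  "tilde E = {(z, vcnj w) | z w. z \<in> E \<and> w \<in> E}"

text \<open>Analytic continuation of (z,\<zeta>) \<mapsto> K(z, conj \<zeta>) past every boundary point
  (z, conj w) of tilde E with z \<noteq> w.\<close>
definition continues_off_diag :: "cvec set \<Rightarrow> (cvec \<Rightarrow> cvec \<Rightarrow> complex) \<Rightarrow> bool" where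
  "continues_off_diag E K \<longleftrightarrow>
     (\<forall>q\<in>frontier (tilde E). fst q \<noteq> vcnj (snd q) \<longrightarrow>
        (\<exists>r>0. \<exists>F. holo2_on (tilde E \<union> ball q r) F \<and>
               (\<forall>p\<in>tilde E. F p = K (fst p) (vcnj (snd p)))))"

definition KH :: "(cvec \<Rightarrow> cvec \<Rightarrow> complex) \<Rightarrow> cmat set \<Rightarrow> cvec \<Rightarrow> cvec \<Rightarrow> complex" where
  "KH K H z w = (1 / of_nat (card H)) * (\<Sum>h\<in>H. K z (h *v w) * cnj (det h))"

definition KHp :: "(cvec \<Rightarrow> cvec \<Rightarrow> complex) \<Rightarrow> cmat set \<Rightarrow> real \<Rightarrow> cvec \<Rightarrow> cvec \<Rightarrow> complex" where
  "KHp K H p z w = of_real (cmod (jac H z) powr (2 / p - 1)) * KH K H z w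
                   * of_real (cmod (jac H w) powr (1 - 2 / p))"

end

theory Submission
  imports Defs "HOL-Complex_Analysis.Conformal_Mappings"
begin

text \<open>
  Write \<open>K\<^sub>H\<close> for the antisymmetrised kernel of a group \<open>H\<close> and \<open>J\<^sub>H\<close> for its Jacobian. By compactness of
  \<open>closure E \<times> closure E\<close> the estimate is local near a pair \<open>(z0, w0)\<close>. Since \<open>K\<close> is Hermitian and
  \<open>G\<close>-invariant, exchanging \<open>z\<close> and \<open>w\<close> exchanges \<open>p\<close> with its conjugate exponent, so one may assume
  \<open>p \<ge> 2\<close>; then only the weight in \<open>z\<close> is singular, and it suffices to divide by Jacobians in the
  variable \<open>z\<close>.

  If \<open>z0\<close> is not in the orbit of \<open>w0\<close> (or lies in \<open>E\<close>), all terms of \<open>K\<^sub>G\<close> extend holomorphically past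
  \<open>(z0, w0)\<close>, and anti-invariance makes the extension divisible by \<open>J\<^sub>G(z)\<close>. Otherwise we may assume
  \<open>z0 = w0\<close>, a nonzero boundary point; it lies on at most one reflecting line, so its stabiliser is
  contained in one of the two subgroups, say \<open>G\<^sub>1\<close>, and \<open>J\<^sub>G\<^sub>2\<close> does not vanish there. The terms of \<open>K\<^sub>G\<close>
  with \<open>h \<in> G\<^sub>1\<close> form a multiple of \<open>K\<^sub>G\<^sub>1\<close>; the sum of the others extends past \<open>(w0, w0)\<close> and is
  anti-invariant under \<open>G\<^sub>1\<close>, hence divisible by \<open>J\<^sub>G\<^sub>1(z)\<close>.
\<close>

section \<open>Lebesgue measure and orthogonal maps\<close>

text \<open>With \<open>s = 1 - 2 / p\<close> the weight is
  \<open>cmod (jac H z) powr (- s) * cmod (jac H w) powr s\<close>; p > 1 means -1 < s < 1, and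
  conjugate exponents have opposite s. For 0 <= s < 1 one factor J(z) suffices: if |L(z,w)| <= C
  |J(z)|, the weighted L is at most C |J(z)|^(1-s) |J(w)|^s, hence bounded, and the summand 1 on the
  right absorbs it. The sum over G on the right comes from moving z0 = h w0 back to w0: the left
  side does not change under z -> k z for k in G, but the kernels of the subgroups may, so every
  shift has to occur. This sum survives the exchange of z and w because G1 and G2 are normal in G.
  The obstacle in the division is uniformity in w: the continuations in z must share one ball and
  one bound, and dividing by a product of linear forms must cost a constant fixed before the
  function is. Hence the estimates are obtained from the maximum principle on circles of fixed
  radius.\<close>

lemma distr_lborel_coordinates:
  fixes \<beta> :: "'a::euclidean_space \<Rightarrow> 'n::finite"
  assumes \<beta>: "bij_betw \<beta> Basis UNIV"
  defines "\<phi> \<equiv> \<lambda>x::real^'n. \<Sum>b\<in>Basis. (x $ \<beta> b) *\<^sub>R b"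
  shows "distr lborel borel \<phi> = lborel"
proof (rule sym, rule lborel_eqI)
  have [measurable]: "\<phi> \<in> borel \<rightarrow>\<^sub>M borel"
    unfolding \<phi>_def by (intro borel_measurable_continuous_onI continuous_intros)
  have inner_\<phi>: "\<phi> x \<bullet> b = x $ \<beta> b" if "b \<in> Basis" for x b
    using that by (simp add: \<phi>_def inner_sum_left inner_Basis if_distrib sum.delta' cong: if_cong)
  define \<gamma> where "\<gamma> = the_inv_into Basis \<beta>"
  have \<gamma>: "bij_betw \<gamma> UNIV Basis" "\<And>b. b \<in> Basis \<Longrightarrow> \<gamma> (\<beta> b) = b" "\<And>i. \<beta> (\<gamma> i) = i"
    using \<beta> bij_betw_the_inv_into[OF \<beta>] unfolding \<gamma>_def
    by (auto simp: bij_betw_def the_inv_into_f_f f_the_inv_into_f)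
  fix l u :: 'a assume lu: "\<And>b. b \<in> Basis \<Longrightarrow> l \<bullet> b \<le> u \<bullet> b"
  have \<gamma>B: "\<gamma> i \<in> Basis" for i using \<gamma>(1) by (auto simp: bij_betw_def)
  \<comment> \<open>The preimage of a box is the box with relabelled sides, and boxes determine
    \<open>lborel\<close>.\<close>
  have 1: "\<phi> x \<in> box l u \<longleftrightarrow> x \<in> box (\<chi> i. l \<bullet> \<gamma> i) (\<chi> i. u \<bullet> \<gamma> i)" for x
    unfolding box_def using \<gamma>(2,3) \<gamma>B
    by (auto simp: inner_\<phi> Basis_vec_def inner_axis) (metis \<gamma>(2))+
  have "emeasure (distr lborel borel \<phi>) (box l u) = emeasure lborel (box (\<chi> i. l \<bullet> \<gamma> i) (\<chi> i. u \<bullet> \<gamma> i))"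
    using 1 by (subst emeasure_distr) (auto intro!: arg_cong[of _ _ "emeasure lborel"])
  also have "\<dots> = (\<Prod>b\<in>Basis. ((\<chi> i. u \<bullet> \<gamma> i) - (\<chi> i. l \<bullet> \<gamma> i)) \<bullet> (b::real^'n))"
    using lu \<gamma>B by (subst emeasure_lborel_box) (auto simp: Basis_vec_def inner_axis)
  also have "(\<Prod>b\<in>Basis. ((\<chi> i. u \<bullet> \<gamma> i) - (\<chi> i. l \<bullet> \<gamma> i)) \<bullet> (b::real^'n)) = (\<Prod>i\<in>UNIV. (u - l) \<bullet> \<gamma> i)"
  proof -
    have "bij_betw (\<lambda>i. axis i (1::real)) (UNIV::'n set) Basis"
      by (auto simp: bij_betw_def inj_on_def axis_eq_axis Basis_vec_def)
    then show ?thesis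
      by (subst prod.reindex_bij_betw[symmetric]) (auto simp: inner_axis inner_diff_left)
  qed
  also have "\<dots> = (\<Prod>b\<in>Basis. (u - l) \<bullet> b)"
    by (rule prod.reindex_bij_betw[OF \<gamma>(1)])
  finally show "emeasure (distr lborel borel \<phi>) (box l u) = (\<Prod>b\<in>Basis. (u - l) \<bullet> b)" .
qed simp

text \<open>The preimage of a box is its image under the inverse map, which is again orthogonal, and
  orthogonal images keep their measure.\<close>

lemma distr_lborel_orthogonal_vec:
  fixes T :: "real^'n::{finite,wellorder} \<Rightarrow> real^'n::_"
  assumes T: "orthogonal_transformation T"
  shows "distr lborel borel T = lborel"
proof (rule sym, rule lborel_eqI)
  have [measurable]: "T \<in> borel \<rightarrow>\<^sub>M borel"
    using T by (intro borel_measurable_continuous_onI linear_continuous_on)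
      (simp add: orthogonal_transformation_linear linear_conv_bounded_linear[symmetric])
  fix l u :: "real^'n::_" assume lu: "\<And>b. b \<in> Basis \<Longrightarrow> l \<bullet> b \<le> u \<bullet> b"
  have b: "bij T" using T by (rule orthogonal_transformation_bij)
  have iT: "orthogonal_transformation (inv T)" using T by (rule orthogonal_transformation_inv)
  have v: "T -` box l u = inv T ` box l u" using b by (rule bij_vimage_eq_inv_image)
  have lm: "box l u \<in> lmeasurable" by simp
  have lm2: "inv T ` box l u \<in> lmeasurable" using iT lm by (rule measurable_orthogonal_image)
  have bo: "T -` box l u \<in> sets borel" using measurable_sets[of T borel borel "box l u"] by simp
  have "emeasure (distr lborel borel T) (box l u) = emeasure lborel (T -` box l u)"
    by (subst emeasure_distr) auto
  also have "\<dots> = emeasure lebesgue (inv T ` box l u)" using bo by (simp add: v)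
  also have "\<dots> = measure lebesgue (inv T ` box l u)" using lm2 by (simp add: emeasure_eq_measure2 fmeasurableD2)
  also have "\<dots> = measure lebesgue (box l u)" using measure_orthogonal_image[OF iT lm] by simp
  also have "\<dots> = (\<Prod>b\<in>Basis. (u - l) \<bullet> b)" using lu by simp
  finally show "emeasure (distr lborel borel T) (box l u) = (\<Prod>b\<in>Basis. (u - l) \<bullet> b)" .
qed simp

text \<open>\<open>T\<close> is conjugated by the coordinate isometry \<open>\<phi>\<close> into an
  orthogonal map of \<open>real ^ 'n\<close>, where the preceding lemma applies;
  \<open>\<phi>\<close> itself preserves Lebesgue measure.\<close>

lemma distr_lborel_orthogonal:
  fixes T :: "'a::euclidean_space \<Rightarrow> 'a" and \<beta> :: "'a \<Rightarrow> 'n::{finite,wellorder}"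
  assumes T: "orthogonal_transformation T" and \<beta>: "bij_betw \<beta> (Basis::'a set) UNIV"
  shows "distr lborel borel T = lborel"
proof -
  define \<phi> where "\<phi> = (\<lambda>x::real^'n::_. \<Sum>b\<in>Basis. (x $ \<beta> b) *\<^sub>R b)"
  define \<gamma> where "\<gamma> = the_inv_into Basis \<beta>"
  define \<psi> :: "'a \<Rightarrow> real^'n::_" where "\<psi> = (\<lambda>y. \<chi> i. y \<bullet> \<gamma> i)"
  have \<gamma>: "bij_betw \<gamma> UNIV Basis" "\<And>b. b \<in> Basis \<Longrightarrow> \<gamma> (\<beta> b) = b" "\<And>i. \<beta> (\<gamma> i) = i"
    using \<beta> bij_betw_the_inv_into[OF \<beta>] unfolding \<gamma>_def
    by (auto simp: bij_betw_def the_inv_into_f_f f_the_inv_into_f)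
  have \<gamma>B: "\<gamma> i \<in> Basis" for i using \<gamma>(1) by (auto simp: bij_betw_def)
  have lin\<phi>: "linear \<phi>" unfolding \<phi>_def
    by (intro linear_compose_sum) (auto simp: linear_iff scaleR_left_distrib)
  have lin\<psi>: "linear \<psi>" unfolding \<psi>_def by (auto simp: linear_iff vec_eq_iff inner_add_left)
  have linT: "linear T" using T by (rule orthogonal_transformation_linear)
  have inner_\<phi>: "\<phi> x \<bullet> b = x $ \<beta> b" if "b \<in> Basis" for x b
    using that by (simp add: \<phi>_def inner_sum_left inner_Basis if_distrib sum.delta' cong: if_cong)
  have \<phi>\<psi>: "\<phi> (\<psi> y) = y" for y
    by (rule euclidean_eqI) (simp add: inner_\<phi> \<psi>_def \<gamma>)
  have inner_\<phi>\<phi>: "\<phi> x \<bullet> \<phi> y = x \<bullet> y" for x y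
    by (subst euclidean_inner) (simp add: inner_\<phi> inner_vec_def sum.reindex_bij_betw[OF \<beta>, of "\<lambda>i. x $ i * y $ i"])
  have inner_\<psi>\<psi>: "\<psi> x \<bullet> \<psi> y = x \<bullet> y" for x y by (metis inner_\<phi>\<phi> \<phi>\<psi>)
  have oT: "orthogonal_transformation (\<psi> \<circ> T \<circ> \<phi>)"
    using T unfolding orthogonal_transformation_def
    by (auto simp: inner_\<psi>\<psi> inner_\<phi>\<phi> intro!: linear_compose lin\<phi> lin\<psi>)
  have meas: "f \<in> borel \<rightarrow>\<^sub>M borel" if "linear f" for f :: "'b::euclidean_space \<Rightarrow> 'c::euclidean_space"
    using that by (intro borel_measurable_continuous_onI linear_continuous_on)
      (simp add: linear_conv_bounded_linear[symmetric])
  note [measurable] = meas[OF lin\<phi>] meas[OF lin\<psi>] meas[OF linT]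
  have L: "distr lborel borel \<phi> = lborel" unfolding \<phi>_def by (rule distr_lborel_coordinates[OF \<beta>])
  have "distr lborel borel T = distr (distr lborel borel \<phi>) borel T" by (simp add: L)
  also have "\<dots> = distr lborel borel (T \<circ> \<phi>)" by (simp add: distr_distr)
  also have "T \<circ> \<phi> = \<phi> \<circ> (\<psi> \<circ> T \<circ> \<phi>)" by (auto simp: \<phi>\<psi>)
  also have "distr lborel borel \<dots> = distr (distr lborel borel (\<psi> \<circ> T \<circ> \<phi>)) borel \<phi>"
    by (rule distr_distr[symmetric]) auto
  also have "\<dots> = lborel" by (simp only: distr_lborel_orthogonal_vec[OF oT] L)
  finally show ?thesis .
qed

text \<open>The index type 4 counts the real dimensions of \<open>cvec\<close>. The definition of
  \<open>L2\<close> uses the completed measure, so invariance of \<open>lborel\<close> has to be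
  carried to the completion.\<close>

lemma
  fixes T :: "cvec \<Rightarrow> cvec"
  assumes T: "orthogonal_transformation T"
  shows orthogonal_measurable_lebesgue: "T \<in> lebesgue \<rightarrow>\<^sub>M lebesgue"
    and distr_lebesgue_orthogonal: "distr lebesgue lebesgue T = lebesgue"
proof -
  obtain \<beta> :: "cvec \<Rightarrow> 4" where "bij_betw \<beta> Basis UNIV"
    using finite_same_card_bij[of "Basis::cvec set" "UNIV::4 set"] by auto
  then have L: "distr lborel borel T = lborel" using T by (intro distr_lborel_orthogonal)
  have [measurable]: "T \<in> borel \<rightarrow>\<^sub>M borel"
    using T by (intro borel_measurable_continuous_onI linear_continuous_on)
      (simp add: orthogonal_transformation_linear linear_conv_bounded_linear[symmetric])
  \<comment> \<open>Completing the source first shows that \<open>T\<close> pulls null sets back to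
    null sets, which is what completing the target needs.\<close>
  have L2: "distr lebesgue lborel T = lborel"
    using L by (simp add: distr_completion cong: distr_cong)
  then have eq: "null_sets lborel = null_sets (distr lebesgue lborel T)" by simp
  show "T \<in> lebesgue \<rightarrow>\<^sub>M lebesgue"
    by (simp add: completion.measurable_completion2 eq measurable_completion)
  show "distr lebesgue lebesgue T = lebesgue"
    by (subst completion.completion_distr_eq[symmetric, where N=lborel])
      (use L2 in \<open>auto simp: measurable_completion\<close>)
qed

section \<open>Hermitian geometry of the plane and the Bergman kernel\<close>

lemma cvec_eq_iff: "v = w \<longleftrightarrow> v $ 1 = w $ 1 \<and> v $ 2 = w $ 2" for v w :: "'a ^ 2"
  by (simp add: vec_eq_iff forall_2)

text \<open>Coordinate computations want this as a simp rule; proofs that treat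
  \<open>A *v v\<close> as one vector delete it.\<close>

lemma matrix_vector_2 [simp]:
  fixes A :: cmat
  shows "(A *v v) $ i = A $ i $ 1 * v $ 1 + A $ i $ 2 * v $ 2"
  by (simp add: matrix_vector_mult_def sum_2)

lemma matrix_vector_scaleC: "(A::cmat) *v (c *s v) = c *s (A *v v)"
  by (simp add: cvec_eq_iff algebra_simps)

lemma herm_2: "herm z w = z $ 1 * cnj (w $ 1) + z $ 2 * cnj (w $ 2)"
  by (simp add: herm_def sum_2)

lemma herm_add_left: "herm (x + y) w = herm x w + herm y w"
  by (simp add: herm_2 algebra_simps)

lemma herm_diff_left: "herm (x - y) w = herm x w - herm y w"
  by (simp add: herm_2 algebra_simps)

lemma herm_scale_left: "herm (c *s x) w = c * herm x w"
  by (simp add: herm_2 algebra_simps)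

lemma herm_scale_right: "herm x (c *s w) = cnj c * herm x w"
  by (simp add: herm_2 algebra_simps)

lemma herm_self: "herm z z = of_real ((norm z)\<^sup>2)"
proof -
  have "(norm z)\<^sup>2 = (cmod (z $ 1))\<^sup>2 + (cmod (z $ 2))\<^sup>2"
    by (simp add: norm_vec_def L2_set_def sum_2)
  then show ?thesis by (simp only: herm_2 of_real_add complex_norm_square)
qed

lemma norm_scaleC: "norm (c *s z) = cmod c * norm z" for z :: cvec
  by (simp add: norm_vec_def L2_set_def sum_2 norm_mult power_mult_distrib
      flip: distrib_left) (simp add: real_sqrt_mult)

lemma inner_eq_Re_herm: "v \<bullet> w = Re (herm v w)" for v w :: cvec
  by (simp add: inner_vec_def sum_2 herm_2 inner_complex_def)

lemma herm_adjoint: "herm (A *v v) w = herm v (adjoint_mat A *v w)"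
  by (simp add: herm_2 adjoint_mat_def algebra_simps)

lemma unitary_herm: "unitary A \<Longrightarrow> herm (A *v v) (A *v w) = herm v w"
  by (simp add: herm_adjoint unitary_def matrix_vector_mul_assoc del: matrix_vector_2)

lemma linear_cmat: "linear ((*v) (A::cmat))"
  by (auto simp: linear_iff cvec_eq_iff algebra_simps)

lemma bounded_linear_cmat: "bounded_linear ((*v) (A::cmat))"
  using linear_cmat by (simp add: linear_conv_bounded_linear)

lemma unitary_norm: "unitary A \<Longrightarrow> norm (A *v v) = norm v"
  by (simp add: norm_eq_sqrt_inner inner_eq_Re_herm unitary_herm)

lemma unitary_orthogonal: "unitary A \<Longrightarrow> orthogonal_transformation ((*v) A)"
  by (simp add: orthogonal_transformation_def linear_cmat inner_eq_Re_herm unitary_herm)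

lemma unitary_dist: "unitary A \<Longrightarrow> dist (A *v v) (A *v w) = dist v w"
  by (metis dist_norm linear_cmat linear_diff unitary_norm)

lemma unitary_invertible: "unitary A \<Longrightarrow> invertible A"
  by (auto simp: unitary_def invertible_def)

lemma unitary_matrix_inv: assumes "unitary A" shows "matrix_inv A = adjoint_mat A"
proof -
  have inv: "A ** matrix_inv A = mat 1 \<and> matrix_inv A ** A = mat 1"
    using unitary_invertible[OF assms] unfolding matrix_inv_def invertible_def by (rule someI_ex)
  have "matrix_inv A = matrix_inv A ** (A ** adjoint_mat A)" using assms by (simp add: unitary_def)
  also have "\<dots> = adjoint_mat A" using inv by (simp add: matrix_mul_assoc)
  finally show ?thesis .
qed

lemma unitary_adjoint: "unitary A \<Longrightarrow> unitary (adjoint_mat A)"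
  by (simp add: unitary_def adjoint_mat_def)

lemma unitary_inv_vec [simp]:
  assumes "unitary A"
  shows "matrix_inv A *v (A *v v) = v" "A *v (matrix_inv A *v v) = v"
  using assms by (simp_all add: unitary_matrix_inv matrix_vector_mul_assoc unitary_def del: matrix_vector_2)

lemma unitary_mult: assumes "unitary A" "unitary B" shows "unitary (A ** B)"
proof -
  have adj: "adjoint_mat (A ** B) = adjoint_mat B ** adjoint_mat A"
    by (simp add: adjoint_mat_def matrix_matrix_mult_def vec_eq_iff mult.commute)
  have "A ** B ** (adjoint_mat B ** adjoint_mat A) = A ** (B ** adjoint_mat B) ** adjoint_mat A"
    by (simp only: matrix_mul_assoc)
  moreover have "adjoint_mat B ** adjoint_mat A ** (A ** B) = adjoint_mat B ** (adjoint_mat A ** A) ** B"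
    by (simp only: matrix_mul_assoc)
  ultimately show ?thesis using assms by (simp add: unitary_def adj)
qed

lemma unitary_det: assumes "unitary A" shows "det A * cnj (det A) = 1" "cmod (det A) = 1"
proof -
  have "det (adjoint_mat A) = cnj (det A)" by (simp add: det_2 adjoint_mat_def)
  then show 1: "det A * cnj (det A) = 1" using assms by (metis unitary_def det_mul det_I)
  then have "cmod (det A) * cmod (det A) = 1" by (metis complex_mod_cnj norm_mult norm_one)
  then show "cmod (det A) = 1" using norm_ge_zero[of "det A"] by (auto simp: square_eq_1_iff)
qed

section \<open>Holomorphic functions and the Bergman space\<close>

lemma holo_on_compose_cmat:
  assumes f: "holo_on T f" and A: "\<And>x. x \<in> S \<Longrightarrow> A *v x \<in> T"
  shows "holo_on S (\<lambda>x. f (A *v x))"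
  unfolding holo_on_def
proof
  fix x assume "x \<in> S"
  with f A obtain c where c: "(f has_derivative (\<lambda>h. \<Sum>i\<in>UNIV. c $ i * h $ i)) (at (A *v x))"
    unfolding holo_on_def by blast
  have "((\<lambda>x. f (A *v x)) has_derivative (\<lambda>h. \<Sum>i\<in>UNIV. c $ i * (A *v h) $ i)) (at x)"
    using has_derivative_compose[OF bounded_linear_imp_has_derivative[OF bounded_linear_cmat] c] .
  then show "\<exists>c. ((\<lambda>x. f (A *v x)) has_derivative (\<lambda>h. \<Sum>i\<in>UNIV. c $ i * h $ i)) (at x)"
    \<comment> \<open>The coefficients form a linear functional, not a Hermitian one, hence the
      transpose without conjugation.\<close>
    by (intro exI[of _ "transpose A *v c"])
      (simp add: sum_2 transpose_def algebra_simps)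
qed

lemma holo_on_diff: "holo_on S f \<Longrightarrow> holo_on S g \<Longrightarrow> holo_on S (\<lambda>x. f x - g x)"
  unfolding holo_on_def
proof (intro ballI)
  fix x assume "x \<in> S" and "\<forall>x\<in>S. \<exists>c. (f has_derivative (\<lambda>h. \<Sum>i\<in>UNIV. c $ i * h $ i)) (at x)"
    "\<forall>x\<in>S. \<exists>c. (g has_derivative (\<lambda>h. \<Sum>i\<in>UNIV. c $ i * h $ i)) (at x)"
  then obtain c d where "(f has_derivative (\<lambda>h. \<Sum>i\<in>UNIV. c $ i * h $ i)) (at x)"
    "(g has_derivative (\<lambda>h. \<Sum>i\<in>UNIV. d $ i * h $ i)) (at x)" by blast
  from has_derivative_diff[OF this]
  show "\<exists>c. ((\<lambda>x. f x - g x) has_derivative (\<lambda>h. \<Sum>i\<in>UNIV. c $ i * h $ i)) (at x)"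
    by (intro exI[of _ "c - d"]) (simp add: sum_2 algebra_simps)
qed

lemma holo_on_continuous: "holo_on S f \<Longrightarrow> x \<in> S \<Longrightarrow> isCont f x"
  unfolding holo_on_def by (metis has_derivative_continuous)

lemma A2_diff:
  assumes "f \<in> A2 E" "g \<in> A2 E"
  shows "(\<lambda>z. f z - g z) \<in> A2 E"
proof -
  have [measurable]: "(\<lambda>x. indicat_real E x *\<^sub>R f x) \<in> borel_measurable lebesgue"
    "(\<lambda>x. indicat_real E x *\<^sub>R g x) \<in> borel_measurable lebesgue"
    and i: "set_integrable lebesgue E (\<lambda>z. (cmod (f z))\<^sup>2)" "set_integrable lebesgue E (\<lambda>z. (cmod (g z))\<^sup>2)"
    using assms by (auto simp: A2_def L2_def set_borel_measurable_def)
  have m: "(\<lambda>x. indicat_real E x *\<^sub>R (f x - g x)) \<in> borel_measurable lebesgue"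
    by (simp add: scaleR_right_diff_distrib)
  have eq: "(\<lambda>x. indicat_real E x *\<^sub>R (cmod (f x - g x))\<^sup>2) = (\<lambda>x. (cmod (indicat_real E x *\<^sub>R (f x - g x)))\<^sup>2)"
    by (auto simp: indicator_def)
  have "set_integrable lebesgue E (\<lambda>z. (cmod (f z - g z))\<^sup>2)"
  proof (rule set_integrable_bound)
    show "set_integrable lebesgue E (\<lambda>z. 2 * (cmod (f z))\<^sup>2 + 2 * (cmod (g z))\<^sup>2)"
      using i by (intro set_integral_add set_integrable_mult_right) auto
    show "set_borel_measurable lebesgue E (\<lambda>z. (cmod (f z - g z))\<^sup>2)"
      unfolding set_borel_measurable_def eq using m by measurable
    have "(cmod (f x - g x))\<^sup>2 \<le> 2 * (cmod (f x))\<^sup>2 + 2 * (cmod (g x))\<^sup>2" for x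
    proof -
      have "(cmod (f x - g x))\<^sup>2 \<le> (cmod (f x) + cmod (g x))\<^sup>2"
        by (intro power_mono norm_triangle_ineq4) auto
      also have "\<dots> \<le> 2 * (cmod (f x))\<^sup>2 + 2 * (cmod (g x))\<^sup>2"
        using sum_squares_ge_zero[of "cmod (f x) - cmod (g x)" 0] by (simp add: power2_eq_square algebra_simps)
      finally show ?thesis .
    qed
    then show "AE x in lebesgue. x \<in> E \<longrightarrow> norm ((cmod (f x - g x))\<^sup>2) \<le> norm (2 * (cmod (f x))\<^sup>2 + 2 * (cmod (g x))\<^sup>2)"
      by auto
  qed
  then show ?thesis using assms m by (auto simp: A2_def L2_def set_borel_measurable_def holo_on_diff)
qed

section \<open>The Bergman kernel: reproduction, symmetry, invariance\<close>

text \<open>The integral of |h|^2 vanishes, so h = 0 almost everywhere on E; continuity of h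
  upgrades this to every point.\<close>

lemma A2_orthogonal_self_zero:
  assumes E: "open E" and h: "h \<in> A2 E"
    and 0: "set_lebesgue_integral lebesgue E (\<lambda>w. h w * cnj (h w)) = 0" and z: "z \<in> E"
  shows "h z = 0"
proof (rule ccontr)
  assume hz: "h z \<noteq> 0"
  have i: "integrable lebesgue (\<lambda>x. indicat_real E x * (cmod (h x))\<^sup>2)"
    using h by (auto simp: A2_def L2_def set_integrable_def)
  have "complex_of_real (\<integral>x. indicat_real E x * (cmod (h x))\<^sup>2 \<partial>lebesgue)
      = set_lebesgue_integral lebesgue E (\<lambda>w. h w * cnj (h w))"
    unfolding set_lebesgue_integral_def integral_complex_of_real[symmetric]
    by (intro Bochner_Integration.integral_cong refl)
      (auto simp: complex_norm_square[symmetric] scaleR_conv_of_real)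
  with 0 have "(\<integral>x. indicat_real E x * (cmod (h x))\<^sup>2 \<partial>lebesgue) = 0" by simp
  then have ae: "AE x in lebesgue. indicat_real E x * (cmod (h x))\<^sup>2 = 0"
    using integral_nonneg_eq_0_iff_AE[OF i] by auto
  have "isCont h z" using h z by (auto simp: A2_def intro: holo_on_continuous)
  then have "eventually (\<lambda>x. h x \<noteq> 0) (nhds z)"
    using hz by (simp add: isCont_def tendsto_imp_eventually_ne eventually_nhds_conv_at)
  then obtain U where U: "open U" "z \<in> U" "\<And>x. x \<in> U \<Longrightarrow> h x \<noteq> 0"
    by (auto simp: eventually_nhds)
  \<comment> \<open>On the open set where h is nonzero almost every point lies in the closed set
    \<open>{}\<close>, so every point does.\<close>
  have "AE x\<in>U \<inter> E in lebesgue. x \<in> {}"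
    using ae by eventually_elim (use U in auto)
  then have "z \<in> {}"
    using U z E by (intro mem_closed_if_AE_lebesgue_open[of "U \<inter> E" "{}"]) auto
  then show False by simp
qed

text \<open>The difference of f and its projection lies in \<open>A2 E\<close> and is orthogonal to
  \<open>A2 E\<close>, in particular to itself.\<close>

lemma bergman_reproducing:
  assumes E: "open E" and K: "bergman_kernel E K" and f: "f \<in> A2 E" and z: "z \<in> E"
  shows "set_lebesgue_integral lebesgue E (\<lambda>w. K z w * f w) = f z"
proof -
  define Pf where "Pf = (\<lambda>z. set_lebesgue_integral lebesgue E (\<lambda>w. K z w * f w))"
  have "f \<in> L2 E" using f by (simp add: A2_def)
  with K have Pf: "Pf \<in> A2 E"
    and orth: "\<And>g. g \<in> A2 E \<Longrightarrow> set_lebesgue_integral lebesgue E (\<lambda>w. (f w - Pf w) * cnj (g w)) = 0"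
    unfolding bergman_kernel_def Let_def Pf_def by blast+
  have d: "(\<lambda>w. f w - Pf w) \<in> A2 E" using f Pf by (rule A2_diff)
  have "f z - Pf z = 0"
    using A2_orthogonal_self_zero[OF E d orth[OF d] z] .
  then show ?thesis by (simp add: Pf_def)
qed

text \<open>Reproducing the conjugate of K(w,.) at z and the conjugate of K(z,.) at w gives two
  integrals that are conjugate to each other.\<close>

lemma bergman_hermitian:
  assumes E: "open E" and K: "bergman_kernel E K" and zw: "z \<in> E" "w \<in> E"
  shows "K w z = cnj (K z w)"
proof -
  have A: "(\<lambda>x. cnj (K y x)) \<in> A2 E" if "y \<in> E" for y
    using K that by (simp add: bergman_kernel_def)
  have "K w z = cnj (set_lebesgue_integral lebesgue E (\<lambda>x. K z x * cnj (K w x)))"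
    using bergman_reproducing[OF E K A[OF zw(2)] zw(1)] by simp
  also have "\<dots> = set_lebesgue_integral lebesgue E (\<lambda>x. K w x * cnj (K z x))"
    unfolding set_lebesgue_integral_def
    by (subst Bochner_Integration.integral_cnj[symmetric], intro Bochner_Integration.integral_cong) auto
  also have "\<dots> = cnj (K z w)"
    using bergman_reproducing[OF E K A[OF zw(1)] zw(2)] by simp
  finally show ?thesis .
qed

lemma set_integral_unitary:
  fixes h :: "cvec \<Rightarrow> complex"
  assumes A: "unitary A" and E: "(*v) A ` E = E"
    and h: "set_borel_measurable lebesgue E h"
  shows "set_lebesgue_integral lebesgue E (\<lambda>w. h (A *v w)) = set_lebesgue_integral lebesgue E h"
proof -
  have iff: "A *v x \<in> E \<longleftrightarrow> x \<in> E" for x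
    using E by (metis A imageE imageI unitary_inv_vec(1))
  have "set_lebesgue_integral lebesgue E h
      = (\<integral>x. indicat_real E x *\<^sub>R h x \<partial>distr lebesgue lebesgue ((*v) A))"
    by (simp add: set_lebesgue_integral_def distr_lebesgue_orthogonal[OF unitary_orthogonal[OF A]])
  also have "\<dots> = (\<integral>x. indicat_real E (A *v x) *\<^sub>R h (A *v x) \<partial>lebesgue)"
    using h orthogonal_measurable_lebesgue[OF unitary_orthogonal[OF A]]
    by (intro integral_distr) (auto simp: set_borel_measurable_def)
  also have "\<dots> = set_lebesgue_integral lebesgue E (\<lambda>w. h (A *v w))"
    by (simp add: set_lebesgue_integral_def indicator_def iff)
  finally show ?thesis ..
qed

lemma A2_compose_unitary:
  assumes A: "unitary A" and E: "(*v) A ` E = E" and f: "f \<in> A2 E"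
  shows "(\<lambda>z. f (A *v z)) \<in> A2 E"
proof -
  have iff: "A *v x \<in> E \<longleftrightarrow> x \<in> E" for x
    using E by (metis A imageE imageI unitary_inv_vec(1))
  note T = orthogonal_measurable_lebesgue[OF unitary_orthogonal[OF A]]
  note D = distr_lebesgue_orthogonal[OF unitary_orthogonal[OF A]]
  have m: "(\<lambda>x. indicat_real E x *\<^sub>R f x) \<in> borel_measurable lebesgue"
    and i: "integrable lebesgue (\<lambda>x. indicat_real E x * (cmod (f x))\<^sup>2)"
    using f by (auto simp: A2_def L2_def set_borel_measurable_def set_integrable_def)
  have ind: "indicat_real E (A *v x) = indicat_real E x" for x by (simp add: indicator_def iff)
  have "(\<lambda>x. indicat_real E x *\<^sub>R f (A *v x)) \<in> borel_measurable lebesgue"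
    using measurable_compose[OF T m] by (simp add: ind)
  moreover have "integrable lebesgue (\<lambda>x. indicat_real E x * (cmod (f (A *v x)))\<^sup>2)"
    using integrable_distr[OF T, of "\<lambda>x. indicat_real E x * (cmod (f x))\<^sup>2"] i by (simp add: D ind)
  moreover have "holo_on E (\<lambda>z. f (A *v z))"
    using f by (intro holo_on_compose_cmat[of E]) (auto simp: A2_def iff simp del: matrix_vector_2)
  ultimately show ?thesis by (simp add: A2_def L2_def set_borel_measurable_def set_integrable_def)
qed

text \<open>The integral that reproduces the conjugate of K(Az, A.) at w becomes, after the measure
  preserving substitution by \<open>B\<close>, the conjugate of the one that reproduces the
  conjugate of K(w, B.) at Az.\<close>

lemma bergman_unitary_invariant:
  assumes E: "open E" and K: "bergman_kernel E K" and A: "unitary A" and AE: "(*v) A ` E = E"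
    and zw: "z \<in> E" "w \<in> E"
  shows "K (A *v z) (A *v w) = K z w"
proof -
  define B where "B = matrix_inv A"
  have B: "unitary B" using A by (simp add: B_def unitary_matrix_inv unitary_adjoint)
  have AB: "A *v (B *v x) = x" "B *v (A *v x) = x" for x
    using A unfolding B_def by (simp_all only: unitary_inv_vec)
  have BE: "(*v) B ` E = E" using AE AB by (metis (no_types, lifting) image_image image_cong image_ident)
  have inE: "A *v x \<in> E" "B *v x \<in> E" if "x \<in> E" for x using AE BE that by blast+
  have k: "(\<lambda>x. cnj (K y x)) \<in> A2 E" if "y \<in> E" for y
    using K that by (simp add: bergman_kernel_def)
  have kA: "(\<lambda>x. cnj (K (A *v z) (A *v x))) \<in> A2 E"
    using A2_compose_unitary[OF A AE k[OF inE(1)[OF zw(1)]]] .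
  have kB: "(\<lambda>x. cnj (K w (B *v x))) \<in> A2 E"
    using A2_compose_unitary[OF B BE k[OF zw(2)]] .
  have m: "set_borel_measurable lebesgue E (\<lambda>x. K w (B *v x) * cnj (K (A *v z) x))"
  proof -
    have m1: "(\<lambda>x. indicat_real E x *\<^sub>R cnj (K w (B *v x))) \<in> borel_measurable lebesgue"
      and m2: "(\<lambda>x. indicat_real E x *\<^sub>R cnj (K (A *v z) x)) \<in> borel_measurable lebesgue"
      using kB k[OF inE(1)[OF zw(1)]] by (auto simp: A2_def L2_def set_borel_measurable_def)
    have c: "cnj \<in> borel_measurable borel" by (intro borel_measurable_continuous_onI continuous_intros)
    have eq: "(\<lambda>x. indicat_real E x *\<^sub>R (K w (B *v x) * cnj (K (A *v z) x)))
       = (\<lambda>x. cnj (indicat_real E x *\<^sub>R cnj (K w (B *v x))) * (indicat_real E x *\<^sub>R cnj (K (A *v z) x)))"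
      by (auto simp: indicator_def)
    show ?thesis unfolding set_borel_measurable_def eq
      by (intro borel_measurable_times measurable_compose[OF m1 c] m2)
  qed
  have "cnj (K (A *v z) (A *v w)) = set_lebesgue_integral lebesgue E (\<lambda>x. K w x * cnj (K (A *v z) (A *v x)))"
    using bergman_reproducing[OF E K kA zw(2)] by simp
  also have "\<dots> = set_lebesgue_integral lebesgue E (\<lambda>x. K w (B *v x) * cnj (K (A *v z) x))"
    using set_integral_unitary[OF A AE m] by (simp only: AB)
  also have "\<dots> = cnj (set_lebesgue_integral lebesgue E (\<lambda>x. K (A *v z) x * cnj (K w (B *v x))))"
    unfolding set_lebesgue_integral_def
    by (subst Bochner_Integration.integral_cnj[symmetric], intro Bochner_Integration.integral_cong) auto
  also have "\<dots> = K w z"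
    using bergman_reproducing[OF E K kB inE(1)[OF zw(1)]] by (simp add: AB del: matrix_vector_2)
  also have "\<dots> = cnj (K z w)" using bergman_hermitian[OF E K zw] .
  finally show ?thesis by (metis complex_cnj_cnj)
qed

section \<open>Division estimates\<close>

lemma holomorphic_factor_zero:
  assumes f: "f holomorphic_on S" and S: "open S" "a \<in> S" and 0: "f a = 0"
  obtains g where "g holomorphic_on S" "\<And>x. x \<in> S \<Longrightarrow> f x = (x - a) * g x"
proof
  show "(\<lambda>z. if z = a then deriv f a else (f z - f a) / (z - a)) holomorphic_on S"
    using f S by (intro pole_lemma_open)
  show "f x = (x - a) * (if x = a then deriv f a else (f x - f a) / (x - a))" if "x \<in> S" for x
    using 0 by auto
qed

text \<open>The rule d phi(dx) = phi(x) kills the n-th Taylor coefficient unless d^(n+1) = 1 for all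
  d in D. If the k-th is the first that survives, D consists of roots of unity for the exponent k +
  1, so card D <= k + 1. The induction splits off one zero at a time.\<close>

lemma holomorphic_rotation_factor:
  assumes \<rho>: "0 < \<rho>" and \<phi>: "\<phi> holomorphic_on ball 0 \<rho>"
    and D: "finite D" "\<And>d. d \<in> D \<Longrightarrow> cmod d = 1"
    and inv: "\<And>d x. d \<in> D \<Longrightarrow> x \<in> ball 0 \<rho> \<Longrightarrow> d * \<phi> (d * x) = \<phi> x"
    and k: "k < card D"
  shows "\<exists>\<psi>. \<psi> holomorphic_on ball 0 \<rho> \<and> (\<forall>x\<in>ball 0 \<rho>. \<phi> x = x ^ k * \<psi> x)"
  using k
proof (induction k)
  case 0
  then show ?case using \<phi> by auto
next
  case (Suc k)
  then obtain \<psi> where \<psi>: "\<psi> holomorphic_on ball 0 \<rho>" "\<And>x. x \<in> ball 0 \<rho> \<Longrightarrow> \<phi> x = x ^ k * \<psi> x"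
    by (metis Suc_lessD)
  have cont: "isCont \<psi> 0"
    using \<psi>(1) \<rho> by (metis centre_in_ball continuous_on_eq_continuous_at holomorphic_on_imp_continuous_on open_ball)
  \<comment> \<open>Dividing the rule by x^k multiplies it by d^k; continuity gives the value at 0,
    where the division is not allowed.\<close>
  have eig: "d ^ Suc k * \<psi> 0 = \<psi> 0" if d: "d \<in> D" for d
  proof -
    have ev: "\<forall>\<^sub>F x in at 0. d ^ Suc k * \<psi> (d * x) = \<psi> x"
    proof -
      have "\<forall>\<^sub>F x in at 0. x \<in> ball 0 \<rho> - {0}"
        using \<rho> by (intro eventually_at_in_open) auto
      then show ?thesis
      proof eventually_elim
        case (elim x)
        then have "d * x \<in> ball 0 \<rho>" using D(2)[OF d] by (simp add: norm_mult)
        then have "d * ((d * x) ^ k * \<psi> (d * x)) = x ^ k * \<psi> x"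
          using inv[OF d, of x] elim \<psi>(2)[of x] \<psi>(2)[of "d * x"] by auto
        then have "x ^ k * (d ^ Suc k * \<psi> (d * x)) = x ^ k * \<psi> x" by (simp add: power_mult_distrib mult_ac)
        then show ?case using elim by auto
      qed
    qed
    have "((\<lambda>x. \<psi> (d * x)) \<longlongrightarrow> \<psi> (d * 0)) (at 0)"
      using cont by (intro isCont_tendsto_compose[of _ \<psi>] tendsto_intros) simp
    then have "((\<lambda>x. d ^ Suc k * \<psi> (d * x)) \<longlongrightarrow> d ^ Suc k * \<psi> 0) (at 0)"
      by (intro tendsto_mult tendsto_const) simp
    then have "(\<psi> \<longlongrightarrow> d ^ Suc k * \<psi> 0) (at 0)" using ev by (rule Lim_transform_eventually)
    from LIM_unique[OF this cont[unfolded isCont_def]] show ?thesis .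
  qed
  have "\<psi> 0 = 0"
  proof (rule ccontr)
    assume "\<psi> 0 \<noteq> 0"
    \<comment> \<open>There are only \<open>Suc k\<close> such roots, fewer than
      \<open>card D\<close>.\<close>
    then have "D \<subseteq> {z. z ^ Suc k = 1}" using eig by auto
    then have "card D \<le> card {z::complex. z ^ Suc k = 1}"
      by (intro card_mono finite_roots_unity) auto
    also have "\<dots> = Suc k" by (rule card_roots_unity_eq) simp
    finally show False using Suc.prems by simp
  qed
  then obtain g where "g holomorphic_on ball 0 \<rho>" "\<And>x. x \<in> ball 0 \<rho> \<Longrightarrow> \<psi> x = (x - 0) * g x"
    using holomorphic_factor_zero[OF \<psi>(1) open_ball, of 0] \<rho> by auto
  then show ?case using \<psi>(2) by (intro exI[of _ g]) (auto simp: mult_ac)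
qed

text \<open>Here \<open>c\<close> is a lower bound, on the circle of radius \<open>s\<close>, for
  the divisor that was split off: it may vanish inside the disc, but the bound on the circle spreads
  inwards by the maximum principle.\<close>

lemma quotient_bound_max_modulus:
  assumes \<psi>: "\<psi> holomorphic_on ball 0 \<rho>" and s: "0 < s" "s < \<rho>" and c: "0 < c"
    and b: "\<And>x. cmod x = s \<Longrightarrow> c * cmod (\<psi> x) \<le> M"
    and x: "cmod x \<le> s"
  shows "cmod (\<psi> x) \<le> M / c"
proof (rule maximum_modulus_frontier[of \<psi> "cball 0 s"])
  show "\<psi> holomorphic_on interior (cball 0 s)"
    using s by (intro holomorphic_on_subset[OF \<psi>]) auto
  show "continuous_on (closure (cball 0 s)) \<psi>"
    using s by (intro holomorphic_on_imp_continuous_on holomorphic_on_subset[OF \<psi>]) auto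
  show "cmod (\<psi> z) \<le> M / c" if "z \<in> frontier (cball 0 s)" for z
    using that b[of z] c s by (auto simp: field_simps)
qed (use x in auto)

text \<open>After the factors of \<open>I\<close> are split off, their product is nonzero at
  \<open>l j\<close> because the zeros are distinct. So the quotient by the next power is bounded
  near \<open>l j\<close>, and the singularity is removable.\<close>

lemma holomorphic_product_factor:
  assumes I: "finite I" and \<phi>: "\<phi> holomorphic_on ball 0 \<rho>"
    and inj: "inj_on l I" and l: "\<And>i. i \<in> I \<Longrightarrow> l i \<in> ball 0 \<rho>"
    and b: "\<And>i. i \<in> I \<Longrightarrow> \<exists>C. \<forall>x\<in>ball 0 \<rho>. cmod (\<phi> x) \<le> C * cmod (x - l i) ^ a i"
  shows "\<exists>\<psi>. \<psi> holomorphic_on ball 0 \<rho> \<and> (\<forall>x\<in>ball 0 \<rho>. \<phi> x = (\<Prod>i\<in>I. (x - l i) ^ a i) * \<psi> x)"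
  using I inj l b
proof (induction I rule: finite_induct)
  case empty
  then show ?case using \<phi> by auto
next
  case (insert j I)
  have "\<exists>\<psi>. \<psi> holomorphic_on ball 0 \<rho> \<and> (\<forall>x\<in>ball 0 \<rho>. \<phi> x = (\<Prod>i\<in>I. (x - l i) ^ a i) * \<psi> x)"
    by (rule insert.IH) (use insert.prems in auto)
  then obtain \<psi> where \<psi>: "\<psi> holomorphic_on ball 0 \<rho>"
    "\<And>x. x \<in> ball 0 \<rho> \<Longrightarrow> \<phi> x = (\<Prod>i\<in>I. (x - l i) ^ a i) * \<psi> x"
    by blast
  let ?P = "\<lambda>x. \<Prod>i\<in>I. (x - l i) ^ a i"
  have lj: "l j \<in> ball 0 \<rho>" using insert by auto
  have Pne: "?P (l j) \<noteq> 0" using insert.hyps insert.prems(1) by auto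
  obtain C where C: "\<And>x. x \<in> ball 0 \<rho> \<Longrightarrow> cmod (\<phi> x) \<le> C * cmod (x - l j) ^ a j"
    using insert.prems(3)[OF insertI1] by blast
  have "((\<lambda>x. cmod (?P x)) \<longlongrightarrow> cmod (?P (l j))) (at (l j))"
    by (intro tendsto_intros)
  then have "\<forall>\<^sub>F x in at (l j). cmod (?P x) > cmod (?P (l j)) / 2"
    using Pne by (intro order_tendstoD(1)) auto
  moreover have "\<forall>\<^sub>F x in at (l j). x \<in> ball 0 \<rho> - {l j}"
    using lj by (intro eventually_at_in_open) auto
  ultimately have "\<forall>\<^sub>F x in at (l j). cmod (\<psi> x / (x - l j) ^ a j) \<le> C / (cmod (?P (l j)) / 2)"
  proof eventually_elim
    case (elim x)
    have "cmod (?P (l j)) / 2 * cmod (\<psi> x) \<le> cmod (?P x) * cmod (\<psi> x)"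
      using elim by (intro mult_right_mono) auto
    also have "\<dots> \<le> C * cmod (x - l j) ^ a j"
      using C[of x] \<psi>(2)[of x] elim by (simp add: norm_mult)
    finally show ?case using elim Pne by (simp add: norm_divide norm_power field_simps)
  qed
  moreover have "(\<lambda>x. \<psi> x / (x - l j) ^ a j) holomorphic_on ball 0 \<rho> - {l j}"
    by (intro holomorphic_intros holomorphic_on_subset[OF \<psi>(1)]) auto
  ultimately obtain g where g: "g holomorphic_on ball 0 \<rho>"
    "\<And>x. x \<in> ball 0 \<rho> - {l j} \<Longrightarrow> g x = \<psi> x / (x - l j) ^ a j"
    using holomorphic_on_extend_bounded[of "\<lambda>x. \<psi> x / (x - l j) ^ a j" "ball 0 \<rho>" "l j"] lj
    by (auto simp: interior_open)
  \<comment> \<open>The extension \<open>g\<close> agrees with the quotient only off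
    \<open>l j\<close>. At \<open>l j\<close> itself the factorisation reads 0 = 0 when the exponent
    is positive; for exponent 0 the old \<open>\<psi>\<close> serves unchanged.\<close>
  show ?case
  proof (cases "a j = 0")
    case True
    then show ?thesis using \<psi> insert.hyps by (intro exI[of _ \<psi>]) auto
  next
    case False
    then have "\<phi> (l j) = 0" using C[OF lj] by (simp add: power_0_left)
    then have 0: "\<psi> (l j) = 0" using \<psi>(2)[OF lj] Pne by simp
    have "\<psi> x = (x - l j) ^ a j * g x" if "x \<in> ball 0 \<rho>" for x
      using g(2)[of x] that False 0 by (cases "x = l j") auto
    then have "\<phi> x = (\<Prod>i\<in>insert j I. (x - l i) ^ a i) * g x" if "x \<in> ball 0 \<rho>" for x
      using \<psi>(2)[OF that] that insert.hyps by (simp add: mult_ac)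
    then show ?thesis using g(1) by blast
  qed
qed

section \<open>Division by linear forms in the plane\<close>

lemma holo_on_line:
  assumes f: "holo_on S f" and T: "\<And>t. t \<in> T \<Longrightarrow> z + t *s v \<in> S"
  shows "(\<lambda>t. f (z + t *s v)) holomorphic_on T"
proof (rule holomorphic_onI)
  fix t assume "t \<in> T"
  then obtain c where c: "(f has_derivative (\<lambda>h. \<Sum>i\<in>UNIV. c $ i * h $ i)) (at (z + t *s v))"
    using f T unfolding holo_on_def by blast
  have "((\<lambda>t. z + t *s v) has_derivative (\<lambda>h. h *s v)) (at t)"
  proof -
    have "bounded_linear (\<lambda>h::complex. h *s v)"
      by (intro linear_conv_bounded_linear[THEN iffD1] linearI) (auto simp: cvec_eq_iff algebra_simps)
    from has_derivative_add[OF has_derivative_const[of z] bounded_linear_imp_has_derivative[OF this]]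
    show ?thesis by simp
  qed
  from has_derivative_compose[OF this c]
  have "((\<lambda>t. f (z + t *s v)) has_derivative (*) (\<Sum>i\<in>UNIV. c $ i * v $ i)) (at t)"
    by (rule has_derivative_eq_rhs) (auto simp: sum_2 algebra_simps)
  then have "((\<lambda>t. f (z + t *s v)) has_field_derivative (\<Sum>i\<in>UNIV. c $ i * v $ i)) (at t)"
    by (simp add: has_field_derivative_def)
  then show "(\<lambda>t. f (z + t *s v)) field_differentiable at t within T"
    by (meson field_differentiable_at_within field_differentiable_def)
qed

lemma herm_Cauchy_Schwarz: "cmod (herm x y) \<le> norm x * norm y"
proof (cases "herm x y = 0")
  case False
  \<comment> \<open>This unimodular factor turns the Hermitian product into a positive real number,
    where it is the real inner product.\<close>
  define c where "c = cnj (herm x y) / of_real (cmod (herm x y))"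
  have c: "cmod c = 1" using False by (simp add: c_def norm_divide)
  have "c * herm x y = of_real (cmod (herm x y))"
    using False complex_norm_square[of "herm x y"] by (simp add: c_def field_simps power2_eq_square)
  then have "cmod (herm x y) = (c *s x) \<bullet> y" by (simp add: inner_eq_Re_herm herm_scale_left)
  also have "\<dots> \<le> norm (c *s x) * norm y" by (rule norm_cauchy_schwarz)
  finally show ?thesis by (simp add: norm_scaleC c)
qed simp

text \<open>One hyperplane: restricting to the complex lines orthogonal to it turns the transformation
  rule under the stabiliser into a rotation rule about the origin of a disc.\<close>

lemma rotation_invariant_bound:
  assumes \<rho>: "0 < \<rho>" and f: "holo_on (ball z0 \<rho>) f" "\<And>x. x \<in> ball z0 \<rho> \<Longrightarrow> cmod (f x) \<le> M"
    and e: "norm e = 1" "herm z0 e = 0"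
    and D: "finite D" "D \<noteq> {}" "\<And>d. d \<in> D \<Longrightarrow> cmod d = 1"
    and inv: "\<And>d x. d \<in> D \<Longrightarrow> x \<in> ball z0 \<rho> \<Longrightarrow> d * f (x + ((d - 1) * herm x e) *s e) = f x"
    and x: "x \<in> ball z0 (\<rho> / 4)"
  shows "cmod (f x) \<le> M / (\<rho> / 4) ^ (card D - 1) * cmod (herm x e) ^ (card D - 1)"
proof -
  define k where "k = card D - 1"
  \<comment> \<open>The foot of x on the hyperplane orthogonal to e; the line y + t e returns to x
    at t = \<open>herm x e\<close>.\<close>
  define y where "y = x - herm x e *s e"
  have ee: "herm e e = 1" using e by (simp add: herm_self)
  have ye: "herm y e = 0" by (simp add: y_def herm_diff_left herm_scale_left ee)
  have xz: "norm (x - z0) < \<rho> / 4" using x by (simp add: dist_norm norm_minus_commute)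
  have hx: "cmod (herm x e) < \<rho> / 4"
  proof -
    have "herm x e = herm (x - z0) e" using e by (simp add: herm_diff_left)
    then have "cmod (herm x e) \<le> norm (x - z0)" using herm_Cauchy_Schwarz[of "x - z0" e] e by simp
    then show ?thesis using xz by simp
  qed
  \<comment> \<open>The two quarters add up to \<open>\<rho>\<close> / 2, which leaves room for a
    disc of radius \<open>\<rho>\<close> / 2 on the line; the circle of radius \<open>\<rho>\<close>
    / 4 inside it still encloses \<open>herm x e\<close>.\<close>
  have yz: "norm (y - z0) < \<rho> / 2"
  proof -
    have "norm (y - z0) \<le> norm (x - z0) + norm (herm x e *s e)"
      using norm_triangle_ineq4[of "x - z0" "herm x e *s e"] by (simp add: y_def algebra_simps)
    then show ?thesis using xz hx e by (simp add: norm_scaleC)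
  qed
  have inball: "y + t *s e \<in> ball z0 \<rho>" if "t \<in> ball 0 (\<rho>/2)" for t
  proof -
    have "norm (y + t *s e - z0) \<le> norm (y - z0) + norm (t *s e)"
      using norm_triangle_ineq[of "y - z0" "t *s e"] by (simp add: algebra_simps)
    then show ?thesis using yz that e by (simp add: norm_scaleC dist_norm norm_minus_commute)
  qed
  define \<phi> where "\<phi> = (\<lambda>t. f (y + t *s e))"
  have "\<phi> holomorphic_on ball 0 (\<rho>/2)" unfolding \<phi>_def using holo_on_line[OF f(1)] inball by blast
  moreover have "d * \<phi> (d * t) = \<phi> t" if "d \<in> D" "t \<in> ball 0 (\<rho>/2)" for d t
  proof -
    have "herm (y + t *s e) e = t" by (simp add: herm_add_left herm_scale_left ye ee)
    moreover have "y + t *s e + ((d - 1) * t) *s e = y + (d * t) *s e"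
      by (simp add: cvec_eq_iff algebra_simps)
    ultimately show ?thesis using inv[OF that(1) inball[OF that(2)]] unfolding \<phi>_def by metis
  qed
  moreover have "k < card D" using D by (simp add: k_def card_gt_0_iff)
  ultimately have "\<exists>\<psi>. \<psi> holomorphic_on ball 0 (\<rho>/2) \<and> (\<forall>t\<in>ball 0 (\<rho>/2). \<phi> t = t ^ k * \<psi> t)"
    using \<rho> D by (intro holomorphic_rotation_factor[of "\<rho>/2" \<phi> D k]) auto
  then obtain \<psi> where \<psi>: "\<psi> holomorphic_on ball 0 (\<rho>/2)"
    "\<And>t. t \<in> ball 0 (\<rho>/2) \<Longrightarrow> \<phi> t = t ^ k * \<psi> t" by blast
  have "cmod (\<psi> (herm x e)) \<le> M / (\<rho>/4) ^ k"
  proof (rule quotient_bound_max_modulus[OF \<psi>(1), of "\<rho>/4"])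
    fix t :: complex assume t: "cmod t = \<rho>/4"
    then have "t \<in> ball 0 (\<rho>/2)" using \<rho> by simp
    then show "(\<rho>/4) ^ k * cmod (\<psi> t) \<le> M"
      using \<psi>(2)[of t] f(2)[OF inball, of t] t by (simp add: \<phi>_def norm_mult norm_power)
  qed (use \<rho> hx in auto)
  moreover have "f x = herm x e ^ k * \<psi> (herm x e)"
  proof -
    have "\<phi> (herm x e) = f x" by (simp add: \<phi>_def y_def)
    then show ?thesis using \<psi>(2)[of "herm x e"] hx \<rho> by simp
  qed
  ultimately have "cmod (f x) \<le> cmod (herm x e) ^ k * (M / (\<rho>/4) ^ k)"
    by (simp only: norm_mult norm_power) (intro mult_left_mono, auto)
  then show ?thesis by (simp only: k_def mult.commute)
qed

text \<open>The constant in the last clause may depend on f and e: it records only the order of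
  vanishing. Uniform estimates come from M.\<close>

definition vanishes_along :: "cvec set \<Rightarrow> (cvec \<Rightarrow> nat) \<Rightarrow> cvec set \<Rightarrow> (cvec \<Rightarrow> complex) \<Rightarrow> real \<Rightarrow> bool" where
  "vanishes_along A a B f M \<longleftrightarrow> holo_on B f \<and> (\<forall>x\<in>B. cmod (f x) \<le> M) \<and>
     (\<forall>e\<in>A. \<exists>C. \<forall>x\<in>B. cmod (f x) \<le> C * cmod (herm x e) ^ a e)"

text \<open>On a complex line \<open>z + t v\<close> transverse to all hyperplanes the zeros belonging to different
  hyperplanes are distinct unless \<open>z\<close> is parallel to \<open>v\<close>, so they can be divided out one after the
  other; the maximum principle on a fixed disc then gives a bound independent of \<open>f\<close>. Two
  independent directions \<open>v\<close> cover all \<open>z \<noteq> 0\<close>.\<close>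

lemma product_division_bound_line:
  fixes A :: "cvec set" and a :: "cvec \<Rightarrow> nat"
  assumes A: "finite A" and \<rho>: "0 < \<rho>" and z0: "\<And>e. e \<in> A \<Longrightarrow> herm z0 e = 0"
    and indep: "\<forall>e\<in>A. \<forall>e'\<in>A. \<forall>x. e \<noteq> e' \<and> herm x e = 0 \<and> herm x e' = 0 \<longrightarrow> x = 0"
    and v: "v \<noteq> 0" "\<And>e. e \<in> A \<Longrightarrow> herm v e \<noteq> 0"
  shows "\<exists>\<delta>>0. \<exists>C>0. \<forall>f M. vanishes_along A a (ball z0 \<rho>) f M \<longrightarrow>
    (\<forall>z\<in>ball z0 \<delta>. (\<nexists>t. z = t *s v) \<longrightarrow> cmod (f z) \<le> C * M * (\<Prod>e\<in>A. cmod (herm z e) ^ a e))"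
proof -
  \<comment> \<open>For |t| < \<open>\<sigma>\<close> the point z + t v moves by less than
    \<open>\<rho>\<close> / 2, so it stays in the ball if z starts within \<open>\<rho>\<close> / 2
    of z0.\<close>
  define \<sigma> where "\<sigma> = \<rho> / (2 * norm v)"
  have \<sigma>: "0 < \<sigma>" "\<sigma> * norm v = \<rho> / 2" using \<rho> v by (auto simp: \<sigma>_def)
  \<comment> \<open>This \<open>\<delta>\<close> keeps all zeros on the line within
    \<open>\<sigma>\<close> / 4 of t = 0, for every starting point z in its ball. It is a minimum
    over A, built by induction so that A may be empty.\<close>
  have "\<exists>\<delta>>0. \<delta> \<le> \<rho> / 2 \<and> (\<forall>e\<in>A. \<delta> * norm e \<le> \<sigma> / 4 * cmod (herm v e))"
    using A v(2)
  proof (induction A rule: finite_induct)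
    case empty
    then show ?case using \<rho> by (intro exI[of _ "\<rho>/2"]) auto
  next
    case (insert e A)
    then obtain \<delta> where \<delta>: "\<delta> > 0" "\<delta> \<le> \<rho> / 2" "\<And>e. e \<in> A \<Longrightarrow> \<delta> * norm e \<le> \<sigma> / 4 * cmod (herm v e)" by auto
    have e: "e \<noteq> 0" using insert.prems[of e] by (auto simp: herm_2)
    define \<delta>' where "\<delta>' = min \<delta> (\<sigma> / 4 * cmod (herm v e) / norm e)"
    have "\<delta>' > 0" using \<delta> e \<sigma> insert.prems[of e] by (auto simp: \<delta>'_def)
    moreover have "\<delta>' * norm e' \<le> \<sigma> / 4 * cmod (herm v e')" if "e' \<in> A" for e'
      using \<delta>(3)[OF that] mult_right_mono[of \<delta>' \<delta> "norm e'"] by (auto simp: \<delta>'_def)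
    moreover have "\<delta>' * norm e \<le> \<sigma> / 4 * cmod (herm v e)"
      using mult_right_mono[of \<delta>' "\<sigma> / 4 * cmod (herm v e) / norm e" "norm e"] e by (auto simp: \<delta>'_def)
    moreover have "\<delta>' \<le> \<rho> / 2" using \<delta>(2) by (auto simp: \<delta>'_def)
    ultimately show ?case by (intro exI[of _ \<delta>']) blast
  qed
  then obtain \<delta> where \<delta>: "\<delta> > 0" "\<delta> \<le> \<rho> / 2" "\<And>e. e \<in> A \<Longrightarrow> \<delta> * norm e \<le> \<sigma> / 4 * cmod (herm v e)" by auto
  \<comment> \<open>On the circle |t| = \<open>\<sigma>\<close> / 2 every zero is at distance at
    least \<open>\<sigma>\<close> / 4, so \<open>c\<close> bounds the divisor from below. The extra
    factor in \<open>C\<close> comes from |\<open>l e\<close>| = |\<open>herm z e\<close>| /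
    |\<open>herm v e\<close>|.\<close>
  define c where "c = (\<Prod>e\<in>A. (\<sigma> / 4) ^ a e)"
  have c: "c > 0" using \<sigma> by (auto simp: c_def intro!: prod_pos)
  define C where "C = 1 / (c * (\<Prod>e\<in>A. cmod (herm v e) ^ a e))"
  show ?thesis
  proof (intro exI conjI allI impI ballI)
    show "0 < \<delta>" by fact
    show "0 < C" unfolding C_def using c v A by (auto intro!: divide_pos_pos mult_pos_pos prod_pos)
    fix f M z
    assume va: "vanishes_along A a (ball z0 \<rho>) f M" and z: "z \<in> ball z0 \<delta>" "\<nexists>t. z = t *s v"
    have f: "holo_on (ball z0 \<rho>) f" "\<And>x. x \<in> ball z0 \<rho> \<Longrightarrow> cmod (f x) \<le> M"
      and fe: "\<And>e. e \<in> A \<Longrightarrow> \<exists>C. \<forall>x\<in>ball z0 \<rho>. cmod (f x) \<le> C * cmod (herm x e) ^ a e"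
      using va by (auto simp: vanishes_along_def)
    have inball: "z + t *s v \<in> ball z0 \<rho>" if "t \<in> ball 0 \<sigma>" for t
    proof -
      have "norm (z + t *s v - z0) \<le> norm (z - z0) + norm (t *s v)"
        using norm_triangle_ineq[of "z - z0" "t *s v"] by (simp add: algebra_simps)
      moreover have "norm (z - z0) < \<rho> / 2" using z(1) \<delta>(2) by (simp add: dist_norm norm_minus_commute)
      moreover have "norm (t *s v) < \<rho> / 2"
        unfolding norm_scaleC \<sigma>(2)[symmetric] using that v by (intro mult_strict_right_mono) auto
      ultimately show ?thesis by (simp add: dist_norm norm_minus_commute)
    qed
    define l where "l e = - herm z e / herm v e" for e
    have l_eq: "herm (z + t *s v) e = herm v e * (t - l e)" if "e \<in> A" for t e
      using v(2)[OF that] by (simp add: herm_add_left herm_scale_left l_def field_simps)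
    have l_small: "cmod (l e) \<le> \<sigma> / 4" if e: "e \<in> A" for e
    proof -
      have "herm z e = herm (z - z0) e" using z0[OF e] by (simp add: herm_diff_left)
      then have "cmod (herm z e) \<le> norm (z - z0) * norm e" using herm_Cauchy_Schwarz by metis
      also have "\<dots> \<le> \<delta> * norm e" using z(1) by (intro mult_right_mono) (auto simp: dist_norm norm_minus_commute)
      also have "\<dots> \<le> \<sigma> / 4 * cmod (herm v e)" using \<delta>(3)[OF e] .
      finally show ?thesis using v(2)[OF e] by (simp add: l_def norm_divide divide_le_eq)
    qed
    have inj: "inj_on l A"
    proof (rule inj_onI, rule ccontr)
      fix e e' assume e: "e \<in> A" "e' \<in> A" "l e = l e'" "e \<noteq> e'"
      then have "z + l e *s v = 0" using l_eq[of e "l e"] l_eq[of e' "l e"] indep by auto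
      then have "z = (- l e) *s v" by (simp add: cvec_eq_iff eq_neg_iff_add_eq_0)
      then show False using z(2) by blast
    qed
    define \<phi> where "\<phi> t = f (z + t *s v)" for t
    have hol: "\<phi> holomorphic_on ball 0 \<sigma>" unfolding \<phi>_def using holo_on_line[OF f(1)] inball by blast
    have "\<exists>\<psi>. \<psi> holomorphic_on ball 0 \<sigma> \<and> (\<forall>x\<in>ball 0 \<sigma>. \<phi> x = (\<Prod>e\<in>A. (x - l e) ^ a e) * \<psi> x)"
    proof (rule holomorphic_product_factor[OF A hol inj])
      fix e assume e: "e \<in> A"
      show "l e \<in> ball 0 \<sigma>" using l_small[OF e] \<sigma> by auto
      obtain B where B: "\<And>x. x \<in> ball z0 \<rho> \<Longrightarrow> cmod (f x) \<le> B * cmod (herm x e) ^ a e" using fe[OF e] by blast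
      have "cmod (\<phi> t) \<le> (B * cmod (herm v e) ^ a e) * cmod (t - l e) ^ a e" if "t \<in> ball 0 \<sigma>" for t
        using B[OF inball[OF that]] unfolding \<phi>_def l_eq[OF e] by (simp add: norm_mult power_mult_distrib mult_ac)
      then show "\<exists>C. \<forall>x\<in>ball 0 \<sigma>. cmod (\<phi> x) \<le> C * cmod (x - l e) ^ a e" by blast
    qed
    then obtain \<psi> where \<psi>: "\<psi> holomorphic_on ball 0 \<sigma>"
      "\<And>x. x \<in> ball 0 \<sigma> \<Longrightarrow> \<phi> x = (\<Prod>e\<in>A. (x - l e) ^ a e) * \<psi> x" by blast
    have "cmod (\<psi> 0) \<le> M / c"
    proof (rule quotient_bound_max_modulus[OF \<psi>(1), of "\<sigma> / 2"])
      fix t :: complex assume t: "cmod t = \<sigma> / 2"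
      then have tb: "t \<in> ball 0 \<sigma>" using \<sigma> by simp
      have "c \<le> (\<Prod>e\<in>A. cmod (t - l e) ^ a e)" unfolding c_def
      proof (intro prod_mono conjI power_mono)
        fix e assume "e \<in> A"
        then show "\<sigma> / 4 \<le> cmod (t - l e)" using t l_small[of e] norm_triangle_ineq2[of t "l e"] by simp
      qed (use \<sigma> in auto)
      then have "c * cmod (\<psi> t) \<le> (\<Prod>e\<in>A. cmod (t - l e) ^ a e) * cmod (\<psi> t)" by (intro mult_right_mono) auto
      also have "\<dots> = cmod (\<phi> t)" by (simp add: \<psi>(2)[OF tb] norm_mult norm_power flip: prod_norm)
      also have "\<dots> \<le> M" using f(2)[OF inball[OF tb]] by (simp add: \<phi>_def)
      finally show "c * cmod (\<psi> t) \<le> M" .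
    qed (use \<sigma> c in auto)
    then have "(\<Prod>e\<in>A. cmod (l e) ^ a e) * cmod (\<psi> 0) \<le> (\<Prod>e\<in>A. cmod (l e) ^ a e) * (M / c)"
      by (intro mult_left_mono prod_nonneg) auto
    moreover have "cmod (f z) = (\<Prod>e\<in>A. cmod (l e) ^ a e) * cmod (\<psi> 0)"
      using \<psi>(2)[of 0] \<sigma> by (simp add: \<phi>_def norm_mult norm_power flip: prod_norm)
    ultimately have "cmod (f z) \<le> (\<Prod>e\<in>A. cmod (l e) ^ a e) * (M / c)" by metis
    also have "(\<Prod>e\<in>A. cmod (l e) ^ a e) = (\<Prod>e\<in>A. cmod (herm z e) ^ a e) / (\<Prod>e\<in>A. cmod (herm v e) ^ a e)"
      by (simp add: l_def norm_divide power_divide prod_dividef)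
    finally show "cmod (f z) \<le> C * M * (\<Prod>e\<in>A. cmod (herm z e) ^ a e)"
      by (simp add: C_def mult_ac)
  qed
qed

lemma product_division_bound:
  fixes A :: "cvec set" and a :: "cvec \<Rightarrow> nat"
  assumes A: "finite A" and \<rho>: "0 < \<rho>" and z0: "\<And>e. e \<in> A \<Longrightarrow> herm z0 e = 0" "\<And>e. e \<in> A \<Longrightarrow> e \<noteq> 0"
    and indep: "\<forall>e\<in>A. \<forall>e'\<in>A. \<forall>x. e \<noteq> e' \<and> herm x e = 0 \<and> herm x e' = 0 \<longrightarrow> x = 0"
  shows "\<exists>\<delta>>0. \<exists>C>0. \<forall>f M. vanishes_along A a (ball z0 \<rho>) f M \<longrightarrow>
    (\<forall>z\<in>ball z0 \<delta>. cmod (f z) \<le> C * M * (\<Prod>e\<in>A. cmod (herm z e) ^ a e))"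
proof -
  \<comment> \<open>Each e in A is orthogonal to (1,t) for at most one t, recorded in
    \<open>B\<close>; if the second entry of e is 0 there is none, and the recorded value 0 is
    harmless. So two transverse directions exist.\<close>
  define w :: "complex \<Rightarrow> cvec" where "w t = vector [1, t]" for t
  have w: "w t $ 1 = 1" "w t $ 2 = t" for t by (simp_all add: w_def)
  define B where "B = (\<lambda>e. - cnj (e $ 1) / cnj (e $ 2)) ` A"
  have fB: "finite B" using A by (simp add: B_def)
  obtain t1 where t1: "t1 \<notin> B" using fB infinite_UNIV_char_0 ex_new_if_finite by blast
  obtain t2 where t2: "t2 \<notin> insert t1 B" using fB infinite_UNIV_char_0 ex_new_if_finite finite.insertI by metis
  have wA: "herm (w t) e \<noteq> 0" if "t \<notin> B" "e \<in> A" for t e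
  proof
    assume "herm (w t) e = 0"
    then have 0: "cnj (e $ 1) + t * cnj (e $ 2) = 0" by (simp add: herm_2 w)
    show False
    proof (cases "e $ 2 = 0")
      case True
      then show False using 0 z0(2)[OF that(2)] by (simp add: cvec_eq_iff)
    next
      case False
      then have "t = - cnj (e $ 1) / cnj (e $ 2)" using 0 by (simp add: field_simps add_eq_0_iff)
      then show False using that by (auto simp: B_def)
    qed
  qed
  have w0: "w t \<noteq> 0" for t by (metis w(1) zero_index zero_neq_one)
  obtain \<delta>1 C1 where 1: "0 < \<delta>1" "0 < C1" "\<And>f M z. vanishes_along A a (ball z0 \<rho>) f M \<Longrightarrow> z \<in> ball z0 \<delta>1 \<Longrightarrow> \<nexists>t. z = t *s w t1 \<Longrightarrow>
      cmod (f z) \<le> C1 * M * (\<Prod>e\<in>A. cmod (herm z e) ^ a e)"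
    using product_division_bound_line[OF A \<rho> z0(1) indep w0 wA[OF t1], where a=a] by blast
  have t2B: "t2 \<notin> B" using t2 by simp
  obtain \<delta>2 C2 where 2: "0 < \<delta>2" "0 < C2" "\<And>f M z. vanishes_along A a (ball z0 \<rho>) f M \<Longrightarrow> z \<in> ball z0 \<delta>2 \<Longrightarrow> \<nexists>t. z = t *s w t2 \<Longrightarrow>
      cmod (f z) \<le> C2 * M * (\<Prod>e\<in>A. cmod (herm z e) ^ a e)"
    using product_division_bound_line[OF A \<rho> z0(1) indep w0 wA[OF t2B], where a=a] by blast
  show ?thesis
  proof (intro exI conjI allI impI ballI)
    show "0 < min \<rho> (min \<delta>1 \<delta>2)" "0 < 1 + C1 + C2" using 1 2 \<rho> by auto
    fix f M z
    assume va: "vanishes_along A a (ball z0 \<rho>) f M" and z: "z \<in> ball z0 (min \<rho> (min \<delta>1 \<delta>2))"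
    have f: "\<And>x. x \<in> ball z0 \<rho> \<Longrightarrow> cmod (f x) \<le> M"
      and fe: "\<And>e. e \<in> A \<Longrightarrow> \<exists>C. \<forall>x\<in>ball z0 \<rho>. cmod (f x) \<le> C * cmod (herm x e) ^ a e"
      using va by (auto simp: vanishes_along_def)
    let ?P = "\<Prod>e\<in>A. cmod (herm z e) ^ a e"
    have P: "0 \<le> ?P" by (intro prod_nonneg) auto
    have M: "0 \<le> M" using f[of z] z by (auto intro: order_trans[OF norm_ge_zero])
    have "\<exists>c\<le>1 + C1 + C2. cmod (f z) \<le> c * M * ?P"
    proof -
      consider (a) "\<nexists>t. z = t *s w t1" | (b) "\<nexists>t. z = t *s w t2" | (c) t s where "z = t *s w t1" "z = s *s w t2" by blast
      then show ?thesis
      proof cases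
        case a
        then show ?thesis using 1(3)[OF va, of z] z 1 2 by (intro exI[of _ C1]) auto
      next
        case b
        then show ?thesis using 2(3)[OF va, of z] z 1 2 by (intro exI[of _ C2]) auto
      next
        \<comment> \<open>Parallel to both directions means z = 0. A positive exponent makes f z
          vanish; otherwise the product is 1 and M itself is the bound, which explains the 1 in 1 +
          C1 + C2.\<close>
        case c
        then have "t = s" "t * t1 = s * t2" by (auto simp: cvec_eq_iff w)
        then have "t = 0" using t2 by auto
        then have z0: "z = 0" using c by simp
        show ?thesis
        proof (cases "\<exists>e\<in>A. a e > 0")
          case True
          then obtain e where e: "e \<in> A" "a e > 0" by blast
          then obtain D where "\<And>x. x \<in> ball z0 \<rho> \<Longrightarrow> cmod (f x) \<le> D * cmod (herm x e) ^ a e" using fe by blast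
          from this[of z] have "cmod (f z) \<le> D * cmod (herm z e) ^ a e" using z by simp
          then have "f z = 0" using e z0 by (simp add: herm_2 power_0_left)
          then show ?thesis using M P 1 2 by (intro exI[of _ 0]) auto
        next
          case False
          then have "?P = 1" by simp
          then show ?thesis using f[of z] z 1 2 by (intro exI[of _ 1]) auto
        qed
      qed
    qed
    then obtain c where c: "c \<le> 1 + C1 + C2" "cmod (f z) \<le> c * M * ?P" by blast
    have "c * M * ?P \<le> (1 + C1 + C2) * M * ?P" using c M P by (intro mult_right_mono) auto
    then show "cmod (f z) \<le> (1 + C1 + C2) * M * ?P" using c by simp
  qed
qed

section \<open>Finite unitary groups and Jacobians\<close>

text \<open>Unlike \<open>furg\<close>, this form passes at once to the subgroups
  \<open>sub_gen G S\<close>, so that one set of lemmas serves all three groups.\<close>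

definition unitary_group :: "cmat set \<Rightarrow> bool" where
  "unitary_group H \<longleftrightarrow> finite H \<and> (\<forall>h\<in>H. unitary h) \<and> mat 1 \<in> H
     \<and> (\<forall>a\<in>H. \<forall>b\<in>H. a ** b \<in> H) \<and> (\<forall>a\<in>H. matrix_inv a \<in> H)"

lemma furg_unitary_group: assumes "furg G" shows "unitary_group G"
proof -
  have G: "gen_grp {r \<in> G. reflection r} = G" and "finite G" "\<forall>g\<in>G. unitary g"
    using assms by (auto simp: furg_def)
  show ?thesis unfolding unitary_group_def
    using \<open>finite G\<close> \<open>\<forall>g\<in>G. unitary g\<close> gen_grp.intros(1)[of "{r \<in> G. reflection r}"]
      gen_grp.intros(3,4)[of _ "{r \<in> G. reflection r}"] unfolding G by blast
qed

lemma gen_grp_subset: assumes "unitary_group G" "S \<subseteq> G" shows "gen_grp S \<subseteq> G"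
proof
  fix x assume "x \<in> gen_grp S"
  then show "x \<in> G" using assms by induction (auto simp: unitary_group_def)
qed

lemma sub_gen_subset: "unitary_group G \<Longrightarrow> sub_gen G S \<subseteq> G"
  unfolding sub_gen_def by (rule gen_grp_subset) auto

lemma sub_gen_unitary_group: assumes "unitary_group G" shows "unitary_group (sub_gen G S)"
  using sub_gen_subset[OF assms, of S] assms unfolding unitary_group_def
  by (auto simp: sub_gen_def intro: gen_grp.intros finite_subset)

lemma matrix_inv_mult_cancel:
  assumes "unitary A"
  shows "matrix_inv A ** A = mat 1" "A ** matrix_inv A = mat 1"
  using assms by (auto simp: unitary_matrix_inv unitary_def)

lemma unitary_inv: "unitary A \<Longrightarrow> unitary (matrix_inv A)"
  by (simp add: unitary_matrix_inv unitary_adjoint)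

lemma matrix_inv_inv: "unitary A \<Longrightarrow> matrix_inv (matrix_inv A) = A"
  by (simp add: unitary_matrix_inv unitary_adjoint) (simp add: adjoint_mat_def)

lemma det_matrix_inv: assumes "unitary A" shows "det (matrix_inv A) = cnj (det A)"
  using assms by (simp add: unitary_matrix_inv det_2 adjoint_mat_def)

text \<open>Two powers of g coincide, and cancelling the smaller one gives the identity. This
  supplies the finite order that \<open>reflection\<close> asks for.\<close>

lemma unitary_group_finite_order:
  assumes H: "unitary_group H" and g: "g \<in> H"
  shows "\<exists>n>0. mpow g n = mat 1"
proof -
  have suc: "mpow g (Suc n) = g ** mpow g n" for n by (simp add: mpow_def)
  have mem: "mpow g n \<in> H" for n
  proof (induction n)
    case 0 then show ?case using H by (simp add: mpow_def unitary_group_def)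
  next
    case (Suc n) then show ?case using H g by (simp add: suc unitary_group_def)
  qed
  have add: "mpow g (i + k) = mpow g i ** mpow g k" for i k
    by (induction i) (simp_all add: suc matrix_mul_assoc, simp add: mpow_def)
  have "\<not> inj (mpow g)"
  proof
    assume "inj (mpow g)"
    then have "infinite (range (mpow g))" by (rule range_inj_infinite)
    moreover have "range (mpow g) \<subseteq> H" using mem by auto
    ultimately show False using H finite_subset by (auto simp: unitary_group_def)
  qed
  then obtain i j where ij: "mpow g i = mpow g j" "i < j" unfolding inj_def by (metis linorder_neqE_nat)
  have u: "unitary (mpow g i)" using mem H by (auto simp: unitary_group_def)
  have "mpow g i ** mpow g (j - i) = mpow g i" using add[of i "j - i"] ij by simp
  then have "matrix_inv (mpow g i) ** mpow g i ** mpow g (j - i) = matrix_inv (mpow g i) ** mpow g i"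
    by (metis matrix_mul_assoc)
  then have "mpow g (j - i) = mat 1" using matrix_inv_mult_cancel(1)[OF u] by simp
  then show ?thesis using ij by (intro exI[of _ "j - i"]) auto
qed

section \<open>Complex lines, reflections and roots\<close>

text \<open>The line spanned by w, as the zero set of the determinant of v and w: a matrix merely
  multiplies that determinant. For w = 0 it would be the whole plane, hence the recurring
  \<open>w \<noteq> 0\<close>.\<close>

definition cline :: "cvec \<Rightarrow> cvec set" where
  "cline w = {v. v $ 1 * w $ 2 = v $ 2 * w $ 1}"

lemma cline_self: "w \<in> cline w"
  by (simp add: cline_def)

lemma in_cline_iff: assumes "w \<noteq> 0" shows "v \<in> cline w \<longleftrightarrow> (\<exists>c. v = c *s w)"
proof
  assume v: "v \<in> cline w"
  show "\<exists>c. v = c *s w"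
  proof (cases "w $ 1 = 0")
    case True
    then have "w $ 2 \<noteq> 0" using assms by (auto simp: cvec_eq_iff)
    then show ?thesis using v True by (intro exI[of _ "v $ 2 / w $ 2"]) (auto simp: cvec_eq_iff cline_def)
  next
    case False
    then show ?thesis using v by (intro exI[of _ "v $ 1 / w $ 1"]) (auto simp: cvec_eq_iff cline_def field_simps)
  qed
qed (auto simp: cline_def)

lemma cline_eq: assumes "w \<noteq> 0" "v \<in> cline w" "v \<noteq> 0" shows "cline v = cline w"
proof -
  obtain c where c: "v = c *s w" using assms in_cline_iff by blast
  then have "c \<noteq> 0" using assms by auto
  then show ?thesis using c by (auto simp: cline_def)
qed

lemma chyperplane_iff: "chyperplane Y \<longleftrightarrow> (\<exists>w. w \<noteq> 0 \<and> Y = cline w)"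
proof
  assume "chyperplane Y"
  then obtain c :: cvec where c: "c \<noteq> 0" "Y = {v. c $ 1 * v $ 1 + c $ 2 * v $ 2 = 0}"
    by (auto simp: chyperplane_def sum_2)
  let ?w = "vector [- (c $ 2), c $ 1] :: cvec"
  have "?w \<noteq> 0" using c by (auto simp: cvec_eq_iff)
  moreover have "Y = cline ?w" using c by (auto simp: cline_def algebra_simps eq_neg_iff_add_eq_0)
  ultimately show "\<exists>w. w \<noteq> 0 \<and> Y = cline w" by blast
next
  assume "\<exists>w. w \<noteq> 0 \<and> Y = cline w"
  then obtain w where w: "w \<noteq> 0" "Y = cline w" by blast
  let ?c = "vector [w $ 2, - (w $ 1)] :: cvec"
  have "?c \<noteq> 0" using w by (auto simp: cvec_eq_iff)
  moreover have "Y = {v. (\<Sum>i\<in>UNIV. ?c $ i * v $ i) = 0}"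
    using w by (auto simp: cline_def sum_2 algebra_simps)
  ultimately show "chyperplane Y" unfolding chyperplane_def by blast
qed

text \<open>A fixed vector off the line would, together with w, form a basis of fixed
  vectors.\<close>

lemma fixset_eq_cline:
  assumes g: "g \<noteq> mat 1" and w: "w \<noteq> 0" "g *v w = w"
  shows "fixset g = cline w"
proof
  show "cline w \<subseteq> fixset g"
    using w by (auto simp: fixset_def in_cline_iff matrix_vector_scaleC simp del: matrix_vector_2)
  show "fixset g \<subseteq> cline w"
  proof (rule subsetI, rule ccontr)
    fix v assume "v \<in> fixset g" "v \<notin> cline w"
    then have v: "g *v v = v" and d: "v $ 1 * w $ 2 - v $ 2 * w $ 1 \<noteq> 0" by (auto simp: fixset_def cline_def)
    \<comment> \<open>Cramer's rule, applied below to the two rows of g - 1.\<close>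
    have solve: "a = 0 \<and> b = 0" if "a * v $ 1 + b * v $ 2 = 0" "a * w $ 1 + b * w $ 2 = 0" for a b
    proof -
      have "a * (v $ 1 * w $ 2 - v $ 2 * w $ 1) = (a * v $ 1 + b * v $ 2) * w $ 2 - (a * w $ 1 + b * w $ 2) * v $ 2"
        "b * (v $ 1 * w $ 2 - v $ 2 * w $ 1) = (a * w $ 1 + b * w $ 2) * v $ 1 - (a * v $ 1 + b * v $ 2) * w $ 1"
        by (simp_all add: algebra_simps)
      then show ?thesis using that d by simp
    qed
    have "g $ 1 $ 1 - 1 = 0 \<and> g $ 1 $ 2 = 0" using v w(2) by (intro solve) (auto simp: cvec_eq_iff algebra_simps)
    moreover have "g $ 2 $ 1 = 0 \<and> g $ 2 $ 2 - 1 = 0" using v w(2) by (intro solve) (auto simp: cvec_eq_iff algebra_simps)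
    ultimately have "g = mat 1" by (simp add: vec_eq_iff forall_2 mat_def)
    then show False using g by simp
  qed
qed

lemma reflectionD: assumes "reflection r" shows "r \<noteq> mat 1" "\<exists>w. w \<noteq> 0 \<and> r *v w = w"
proof -
  obtain w where w: "w \<noteq> 0" "fixset r = cline w" using assms by (auto simp: reflection_def chyperplane_iff)
  show "\<exists>w. w \<noteq> 0 \<and> r *v w = w" using w cline_self[of w] by (auto simp: fixset_def simp del: matrix_vector_2)
  have "cline w \<noteq> UNIV"
  proof
    assume "cline w = UNIV"
    then have "vector [1, 0] \<in> cline w" "vector [0, 1] \<in> cline w" by auto
    then show False using w by (simp add: cline_def cvec_eq_iff)
  qed
  moreover have "fixset (mat 1) = UNIV" by (simp add: fixset_def del: matrix_vector_2)
  ultimately show "r \<noteq> mat 1" using w by metis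
qed

text \<open>Here dimension two enters: stabilisers of nonzero points consist of reflections and the
  identity.\<close>

lemma unitary_group_reflectionI:
  assumes H: "unitary_group H" "g \<in> H" "g \<noteq> mat 1" and w: "w \<noteq> 0" "g *v w = w"
  shows "reflection g" "fixset g = cline w"
proof -
  show fixset: "fixset g = cline w" using assms by (intro fixset_eq_cline)
  show "reflection g" unfolding reflection_def using unitary_group_finite_order[OF H(1,2)] H w fixset
    by (auto simp: chyperplane_iff unitary_group_def)
qed

lemma refl_hyps_cline: "Y \<in> refl_hyps H \<Longrightarrow> \<exists>w. w \<noteq> 0 \<and> Y = cline w"
  by (auto simp: refl_hyps_def reflection_def chyperplane_iff)

lemma finite_refl_hyps: "finite H \<Longrightarrow> finite (refl_hyps H)"
proof -
  assume "finite H"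
  moreover have "refl_hyps H \<subseteq> fixset ` H" by (auto simp: refl_hyps_def)
  ultimately show ?thesis by (meson finite_imageI finite_subset)
qed

text \<open>The product with e and the determinant with w are linear forms in z with the same
  kernel, hence proportional; comparing norms gives the factor.\<close>

lemma herm_orthogonal_line:
  assumes w: "w \<noteq> 0" and e: "herm w e = 0"
  shows "cmod (herm z e) * norm w = cmod (z $ 1 * w $ 2 - z $ 2 * w $ 1) * norm e"
proof -
  have "\<exists>t. cnj (e $ 1) = - t * w $ 2 \<and> cnj (e $ 2) = t * w $ 1"
  proof (cases "w $ 1 = 0")
    case True
    then have "w $ 2 \<noteq> 0" using w by (auto simp: cvec_eq_iff)
    then show ?thesis using e True by (intro exI[of _ "- cnj (e $ 1) / w $ 2"]) (auto simp: herm_2)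
  next
    case False
    then show ?thesis using e by (intro exI[of _ "cnj (e $ 2) / w $ 1"]) (auto simp: herm_2 field_simps eq_neg_iff_add_eq_0)
  qed
  then obtain t where t: "cnj (e $ 1) = - t * w $ 2" "cnj (e $ 2) = t * w $ 1" by blast
  have "herm z e = - t * (z $ 1 * w $ 2 - z $ 2 * w $ 1)" by (simp add: herm_2 t algebra_simps)
  then have "cmod (herm z e) = cmod t * cmod (z $ 1 * w $ 2 - z $ 2 * w $ 1)" by (simp add: norm_mult)
  moreover have "norm e = cmod t * norm w"
  proof -
    have "cmod (e $ 1) = cmod t * cmod (w $ 2)" "cmod (e $ 2) = cmod t * cmod (w $ 1)"
      using t by (metis complex_mod_cnj norm_minus_cancel norm_mult mult_minus_left)+
    then show ?thesis
      by (simp add: norm_vec_def L2_set_def sum_2 power_mult_distrib add.commute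
          flip: distrib_left) (simp add: real_sqrt_mult)
  qed
  ultimately show ?thesis by simp
qed

text \<open>The last identity frees moduli from the choice made in \<open>root\<close>; this is what
  makes Jacobians at transformed points comparable.\<close>

lemma root_cline:
  assumes w: "w \<noteq> 0"
  shows "norm (root (cline w)) = 1" "\<And>v. v \<in> cline w \<Longrightarrow> herm v (root (cline w)) = 0"
    "cmod (herm z (root (cline w))) = cmod (z $ 1 * w $ 2 - z $ 2 * w $ 1) / norm w"
proof -
  define e :: cvec where "e = (1 / of_real (norm w)) *s vector [- cnj (w $ 2), cnj (w $ 1)]"
  have "norm (vector [- cnj (w $ 2), cnj (w $ 1)] :: cvec) = norm w"
    by (simp add: norm_vec_def L2_set_def sum_2 add.commute)
  then have "norm e = 1" using w by (simp add: e_def norm_scaleC norm_divide)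
  moreover have "\<forall>v\<in>cline w. herm v e = 0"
    by (auto simp: e_def herm_scale_right) (auto simp: herm_2 cline_def)
  ultimately have "\<exists>e. norm e = 1 \<and> (\<forall>v\<in>cline w. herm v e = 0)" by blast
  from someI_ex[OF this]
  have *: "norm (root (cline w)) = 1 \<and> (\<forall>v\<in>cline w. herm v (root (cline w)) = 0)"
    unfolding root_def .
  then show "norm (root (cline w)) = 1" "\<And>v. v \<in> cline w \<Longrightarrow> herm v (root (cline w)) = 0" by auto
  show "cmod (herm z (root (cline w))) = cmod (z $ 1 * w $ 2 - z $ 2 * w $ 1) / norm w"
    using herm_orthogonal_line[OF w, of "root (cline w)" z] * cline_self[of w] w
    by (subst eq_divide_eq) simp
qed

lemma herm_root_eq_0_iff: assumes "w \<noteq> 0" shows "herm z (root (cline w)) = 0 \<longleftrightarrow> z \<in> cline w"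
  using root_cline(3)[OF assms, of z] assms by (auto simp: cline_def)

lemma image_cline: assumes g: "unitary g" shows "(*v) g ` cline w = cline (g *v w)"
proof -
  have d: "(g *v v) $ 1 * (g *v w) $ 2 - (g *v v) $ 2 * (g *v w) $ 1 = det g * (v $ 1 * w $ 2 - v $ 2 * w $ 1)" for v
    by (simp add: det_2 algebra_simps)
  have dg: "det g \<noteq> 0" using unitary_det(2)[OF g] by auto
  have iff: "g *v v \<in> cline (g *v w) \<longleftrightarrow> v \<in> cline w" for v
    using d[of v] dg unfolding cline_def by (auto simp del: matrix_vector_2)
  show ?thesis
  proof
    show "(*v) g ` cline w \<subseteq> cline (g *v w)" using iff by blast
    show "cline (g *v w) \<subseteq> (*v) g ` cline w"
    proof
      fix x assume "x \<in> cline (g *v w)"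
      then have "matrix_inv g *v x \<in> cline w" using iff[of "matrix_inv g *v x"] g by (simp only: unitary_inv_vec)
      then show "x \<in> (*v) g ` cline w" by (metis g image_eqI unitary_inv_vec(2))
    qed
  qed
qed

lemma unitary_nonzero: "unitary g \<Longrightarrow> w \<noteq> 0 \<Longrightarrow> g *v w \<noteq> 0"
  by (metis norm_eq_zero unitary_norm)

text \<open>The chosen root of the image line need not be the image of the chosen root, so only
  moduli can agree; they do because the determinant is multiplied by the unimodular det g.\<close>

lemma herm_root_image:
  assumes g: "unitary g" and w: "w \<noteq> 0"
  shows "cmod (herm (g *v z) (root ((*v) g ` cline w))) = cmod (herm z (root (cline w)))"
proof -
  have d: "(g *v z) $ 1 * (g *v w) $ 2 - (g *v z) $ 2 * (g *v w) $ 1 = det g * (z $ 1 * w $ 2 - z $ 2 * w $ 1)"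
    by (simp add: det_2 algebra_simps)
  show ?thesis
    unfolding image_cline[OF g] root_cline(3)[OF w] root_cline(3)[OF unitary_nonzero[OF g w]] d
    by (simp add: norm_mult unitary_det(2)[OF g] unitary_norm[OF g] del: matrix_vector_2)
qed

section \<open>Jacobians under the normaliser\<close>

text \<open>Both conjugations are demanded, so the condition passes to the inverse of g without a
  counting argument.\<close>

definition normalizes :: "cmat \<Rightarrow> cmat set \<Rightarrow> bool" where
  "normalizes g H \<longleftrightarrow> (\<forall>h\<in>H. g ** h ** matrix_inv g \<in> H \<and> matrix_inv g ** h ** g \<in> H)"

lemma normalizes_inv: "unitary g \<Longrightarrow> normalizes g H \<Longrightarrow> normalizes (matrix_inv g) H"
  by (auto simp: normalizes_def matrix_inv_inv)

lemma conj_vec: "unitary g \<Longrightarrow> (g ** h ** matrix_inv g) *v (g *v v) = g *v (h *v v)"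
  by (simp add: matrix_vector_mul_assoc[symmetric] del: matrix_vector_2)

lemma conj_reflection:
  assumes H: "unitary_group H" and g: "unitary g" "normalizes g H" and r: "r \<in> H" "reflection r"
  shows "reflection (g ** r ** matrix_inv g)" "fixset (g ** r ** matrix_inv g) = (*v) g ` fixset r"
proof -
  obtain w where w: "w \<noteq> 0" "r *v w = w" using reflectionD(2)[OF r(2)] by blast
  let ?s = "g ** r ** matrix_inv g"
  have s: "?s \<in> H" using g r by (auto simp: normalizes_def)
  have s1: "?s \<noteq> mat 1"
  proof
    assume "?s = mat 1"
    then have "g *v (r *v v) = g *v v" for v using conj_vec[OF g(1), of r v] by (simp del: matrix_vector_2)
    then have "r *v v = v" for v by (metis g(1) unitary_inv_vec(1))
    then have "r = mat 1" by (simp add: matrix_eq del: matrix_vector_2)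
    then show False using reflectionD(1)[OF r(2)] by simp
  qed
  have sw: "?s *v (g *v w) = g *v w" using conj_vec[OF g(1), of r w] w by (simp del: matrix_vector_2)
  show "reflection ?s" and "fixset ?s = (*v) g ` fixset r"
    using unitary_group_reflectionI[OF H s s1 unitary_nonzero[OF g(1) w(1)] sw]
      image_cline[OF g(1)] fixset_eq_cline[OF reflectionD(1)[OF r(2)] w] by auto
qed

lemma refl_hyps_image:
  assumes H: "unitary_group H" and g: "unitary g" "normalizes g H" and Y: "Y \<in> refl_hyps H"
  shows "(*v) g ` Y \<in> refl_hyps H"
proof -
  obtain r where r: "r \<in> H" "reflection r" "Y = fixset r" using Y by (auto simp: refl_hyps_def)
  then have "g ** r ** matrix_inv g \<in> H" using g by (auto simp: normalizes_def)
  then show ?thesis using conj_reflection[OF H g r(1,2)] r(3) unfolding refl_hyps_def by blast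
qed

lemma image_inv_image: "unitary g \<Longrightarrow> (*v) g ` ((*v) (matrix_inv g) ` Y) = Y"
  by (simp add: image_image del: matrix_vector_2)

lemma inv_image_image: "unitary g \<Longrightarrow> (*v) (matrix_inv g) ` ((*v) g ` Y) = Y"
  by (simp add: image_image del: matrix_vector_2)

lemma stab_image_subset:
  assumes g: "unitary g" "normalizes g H"
  shows "(\<lambda>h. g ** h ** matrix_inv g) ` stab H Y \<subseteq> stab H ((*v) g ` Y)"
  using g by (auto simp: stab_def normalizes_def conj_vec simp del: matrix_vector_2)

lemma mult_image:
  assumes H: "finite H" and g: "unitary g" "normalizes g H"
  shows "mult H ((*v) g ` Y) = mult H Y"
proof -
  have le: "mult H Y \<le> mult H ((*v) g ` Y)" if g: "unitary g" "normalizes g H" for g Y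
  proof -
    have "inj_on (\<lambda>h. g ** h ** matrix_inv g) (stab H Y)"
    proof (rule inj_onI)
      fix a b assume "g ** a ** matrix_inv g = g ** b ** matrix_inv g"
      then have "g *v (a *v v) = g *v (b *v v)" for v by (metis conj_vec g(1))
      then have "a *v v = b *v v" for v by (metis g(1) unitary_inv_vec(1))
      then show "a = b" by (simp add: matrix_eq del: matrix_vector_2)
    qed
    then show ?thesis unfolding mult_def
      using card_inj_on_le[OF _ stab_image_subset[OF g]] H by (simp add: stab_def)
  qed
  have "mult H ((*v) g ` Y) \<le> mult H ((*v) (matrix_inv g) ` ((*v) g ` Y))"
    using le[of "matrix_inv g"] g by (simp add: unitary_inv normalizes_inv)
  then show ?thesis using le[OF g, of Y] inv_image_image[OF g(1)] by simp
qed

lemma jac_unitary: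
  assumes H: "unitary_group H" and g: "unitary g" "normalizes g H"
  shows "cmod (jac H (g *v z)) = cmod (jac H z)"
proof -
  have fin: "finite H" using H by (simp add: unitary_group_def)
  have bij: "bij_betw (\<lambda>Y. (*v) g ` Y) (refl_hyps H) (refl_hyps H)"
    by (rule bij_betwI[where g = "\<lambda>Y. (*v) (matrix_inv g) ` Y"])
      (use refl_hyps_image[OF H g] refl_hyps_image[OF H unitary_inv[OF g(1)] normalizes_inv[OF g]]
        image_inv_image[OF g(1)] inv_image_image[OF g(1)] in auto)
  have "cmod (jac H (g *v z)) = (\<Prod>Y\<in>refl_hyps H. cmod (herm (g *v z) (root Y)) ^ (mult H Y - 1))"
    by (simp add: jac_def norm_power flip: prod_norm del: matrix_vector_2)
  also have "\<dots> = (\<Prod>Y\<in>refl_hyps H. cmod (herm (g *v z) (root ((*v) g ` Y))) ^ (mult H ((*v) g ` Y) - 1))"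
    by (rule prod.reindex_bij_betw[OF bij, symmetric])
  also have "\<dots> = (\<Prod>Y\<in>refl_hyps H. cmod (herm z (root Y)) ^ (mult H Y - 1))"
  proof (rule prod.cong)
    fix Y assume "Y \<in> refl_hyps H"
    then obtain w where "w \<noteq> 0" "Y = cline w" using refl_hyps_cline by blast
    then show "cmod (herm (g *v z) (root ((*v) g ` Y))) ^ (mult H ((*v) g ` Y) - 1) = cmod (herm z (root Y)) ^ (mult H Y - 1)"
      using herm_root_image[OF g(1)] mult_image[OF fin g] by simp
  qed simp
  also have "\<dots> = cmod (jac H z)" by (simp add: jac_def norm_power flip: prod_norm)
  finally show ?thesis .
qed

section \<open>Anti-invariance forces divisibility by the Jacobian\<close>

text \<open>A unitary map that fixes w preserves the orthogonal complement, spanned by e, and acts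
  there by a scalar, which must be its determinant.\<close>

lemma stab_acts_on_root:
  assumes r: "unitary r" "r *v w = w" and w: "w \<noteq> 0"
  defines "e \<equiv> root (cline w)"
  shows "r *v x = x + ((det r - 1) * herm x e) *s e"
proof -
  have ne: "norm e = 1" and ce: "\<And>v. v \<in> cline w \<Longrightarrow> herm v e = 0" unfolding e_def using root_cline[OF w] by auto
  have ee: "herm e e = 1" using ne by (simp add: herm_self)
  have herm_swap: "herm a b = cnj (herm b a)" for a b by (simp add: herm_2)
  have ew: "herm e w = 0" using herm_swap[of e w] ce[OF cline_self] by simp
  have fixed: "r *v y = y" if "herm y e = 0" for y
  proof -
    have "y \<in> cline w" using that herm_root_eq_0_iff[OF w] unfolding e_def by simp
    then show ?thesis using r w by (auto simp: in_cline_iff matrix_vector_scaleC simp del: matrix_vector_2)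
  qed
  define d where "d = herm (r *v e) e"
  have re: "r *v e = d *s e"
  proof -
    define u where "u = r *v e - d *s e"
    have "herm (r *v e) w = 0" using unitary_herm[OF r(1), of e w] r(2) ew by simp
    then have "herm u w = 0" by (simp add: u_def herm_diff_left herm_scale_left ew)
    moreover have "herm u e = 0" by (simp add: u_def herm_diff_left herm_scale_left ee d_def)
    then have "u \<in> cline w" using herm_root_eq_0_iff[OF w] unfolding e_def by simp
    then obtain c where c: "u = c *s w" using in_cline_iff[OF w] by blast
    ultimately have "c * of_real ((norm w)\<^sup>2) = 0" by (simp add: herm_scale_left herm_self)
    then have "u = 0" using w c by simp
    then show ?thesis by (simp add: u_def)
  qed
  have "det r = d"
  proof -
    have "e \<notin> cline w" using ce[of e] ee by auto
    then have ne: "e $ 1 * w $ 2 - e $ 2 * w $ 1 \<noteq> 0" by (simp add: cline_def)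
    have "det r * (e $ 1 * w $ 2 - e $ 2 * w $ 1) = (r *v e) $ 1 * (r *v w) $ 2 - (r *v e) $ 2 * (r *v w) $ 1"
      by (simp add: det_2 algebra_simps)
    also have "\<dots> = d * (e $ 1 * w $ 2 - e $ 2 * w $ 1)"
      unfolding re r(2) by (simp add: algebra_simps)
    finally show ?thesis using ne by simp
  qed
  define y where "y = x - herm x e *s e"
  have "herm y e = 0" by (simp add: y_def herm_diff_left herm_scale_left ee)
  then have ry: "r *v y = y" by (rule fixed)
  have "x = y + herm x e *s e" by (simp add: y_def)
  then have "r *v x = r *v y + herm x e *s (r *v e)"
    by (metis matrix_vector_right_distrib matrix_vector_scaleC)
  also have "\<dots> = y + (herm x e * d) *s e" by (simp add: ry re vector_smult_assoc del: matrix_vector_2)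
  also have "\<dots> = x + ((det r - 1) * herm x e) *s e"
    by (simp add: y_def \<open>det r = d\<close> cvec_eq_iff algebra_simps)
  finally show ?thesis .
qed

text \<open>An element of the stabiliser of a line is determined by its determinant. So the number
  of rotations in the division lemma is the multiplicity, and its exponent \<open>card D - 1\<close>
  is the one in \<open>jac\<close>.\<close>

lemma card_det_stab:
  assumes H: "unitary_group H" and w: "w \<noteq> 0"
  shows "card (det ` stab H (cline w)) = mult H (cline w)"
  unfolding mult_def
proof (rule card_image, rule inj_onI)
  fix a b assume ab: "a \<in> stab H (cline w)" "b \<in> stab H (cline w)" "det a = det b"
  then have "unitary a" "unitary b" "a *v w = w" "b *v w = w"
    using H cline_self[of w] by (auto simp: stab_def unitary_group_def simp del: matrix_vector_2)
  then have "a *v x = b *v x" for x using stab_acts_on_root[of a w x] stab_acts_on_root[of b w x] ab(3) w by simp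
  then show "a = b" by (simp add: matrix_eq del: matrix_vector_2)
qed

lemma holo_on_subset: "holo_on S f \<Longrightarrow> T \<subseteq> S \<Longrightarrow> holo_on T f"
  unfolding holo_on_def by blast

text \<open>Lines through z0 are treated by the rotation rule and the product division; the Jacobian
  factors of all other lines stay away from 0 near z0.\<close>

lemma anti_invariant_division_bound:
  assumes H: "unitary_group H" and \<rho>: "0 < \<rho>"
  shows "\<exists>\<delta>>0. \<exists>C>0. \<forall>f M. holo_on (ball z0 \<rho>) f \<longrightarrow> (\<forall>x\<in>ball z0 \<rho>. cmod (f x) \<le> M) \<longrightarrow>
     (\<forall>r\<in>H. r *v z0 = z0 \<longrightarrow> (\<forall>x\<in>ball z0 \<rho>. det r * f (r *v x) = f x)) \<longrightarrow>
     (\<forall>z\<in>ball z0 \<delta>. cmod (f z) \<le> C * M * cmod (jac H z))"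
proof -
  define R where "R = {Y \<in> refl_hyps H. z0 \<in> Y}"
  define A where "A = root ` R"
  \<comment> \<open>The product lemma indexes exponents by roots; the line is recovered from its
    root as the orthogonal complement.\<close>
  define a where "a e = mult H {v. herm v e = 0} - 1" for e
  have fin: "finite H" and finR: "finite (refl_hyps H)" using H by (auto simp: unitary_group_def intro: finite_refl_hyps)
  have Y_eq: "Y = {v. herm v (root Y) = 0}" if Y: "Y \<in> refl_hyps H" for Y
  proof -
    obtain w where "w \<noteq> 0" "Y = cline w" using refl_hyps_cline[OF Y] by blast
    then show ?thesis using herm_root_eq_0_iff by auto
  qed
  have a_root: "a (root Y) = mult H Y - 1" if Y: "Y \<in> refl_hyps H" for Y
    using Y_eq[OF Y] by (simp add: a_def)
  have inj: "inj_on root (refl_hyps H)"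
  proof (rule inj_onI)
    fix Y Y' assume Y: "Y \<in> refl_hyps H" "Y' \<in> refl_hyps H" "root Y = root Y'"
    have "Y = {v. herm v (root Y) = 0}" by (rule Y_eq[OF Y(1)])
    also have "\<dots> = {v. herm v (root Y') = 0}" by (simp only: Y(3))
    also have "\<dots> = Y'" by (rule Y_eq[OF Y(2), symmetric])
    finally show "Y = Y'" .
  qed
  have "finite A" using finR by (simp add: A_def R_def)
  moreover have "herm z0 e = 0" if "e \<in> A" for e using that Y_eq by (auto simp: A_def R_def)
  moreover have "e \<noteq> 0" if "e \<in> A" for e
  proof -
    obtain Y where "Y \<in> refl_hyps H" "e = root Y" using \<open>e \<in> A\<close> by (auto simp: A_def R_def)
    then obtain w where "w \<noteq> 0" "e = root (cline w)" using refl_hyps_cline by blast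
    then have "norm e = 1" using root_cline(1) by blast
    then show ?thesis by auto
  qed
  moreover have "\<forall>e\<in>A. \<forall>e'\<in>A. \<forall>x. e \<noteq> e' \<and> herm x e = 0 \<and> herm x e' = 0 \<longrightarrow> x = 0"
  proof (intro ballI allI impI, rule ccontr)
    fix e e' x assume e: "e \<in> A" "e' \<in> A" "e \<noteq> e' \<and> herm x e = 0 \<and> herm x e' = 0" "x \<noteq> 0"
    then obtain Y Y' where Y: "Y \<in> refl_hyps H" "e = root Y" "Y' \<in> refl_hyps H" "e' = root Y'"
      by (auto simp: A_def R_def)
    have "x \<in> Y" "x \<in> Y'" using Y Y_eq e by auto
    then have "Y = cline x" "Y' = cline x" using Y refl_hyps_cline cline_eq e(4) by metis+
    then show False using Y e by simp
  qed
  \<comment> \<open>The rotation rule yields the order of vanishing only on the ball of radius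
    \<open>\<rho>\<close> / 4.\<close>
  ultimately have "\<exists>\<delta>>0. \<exists>C>0. \<forall>f M. vanishes_along A a (ball z0 (\<rho> / 4)) f M \<longrightarrow>
    (\<forall>z\<in>ball z0 \<delta>. cmod (f z) \<le> C * M * (\<Prod>e\<in>A. cmod (herm z e) ^ a e))"
    using \<rho> by (intro product_division_bound) auto
  then obtain \<delta> C where \<delta>: "\<delta> > 0" "C > 0" and bound: "\<And>f M z. vanishes_along A a (ball z0 (\<rho> / 4)) f M \<Longrightarrow> z \<in> ball z0 \<delta> \<Longrightarrow>
     cmod (f z) \<le> C * M * (\<Prod>e\<in>A. cmod (herm z e) ^ a e)" by blast
  \<comment> \<open>The factors whose lines miss z0. Near z0 they exceed half their value there,
    which costs the constant 2 / \<open>Q z0\<close>.\<close>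
  define Q where "Q z = (\<Prod>Y\<in>refl_hyps H - R. cmod (herm z (root Y)) ^ (mult H Y - 1))" for z
  have Q0: "Q z0 > 0" unfolding Q_def
  proof (intro prod_pos ballI zero_less_power)
    fix Y assume "Y \<in> refl_hyps H - R"
    then show "0 < cmod (herm z0 (root Y))" using Y_eq[of Y] by (auto simp: R_def)
  qed
  have "isCont Q z0" unfolding Q_def herm_2 by (intro continuous_intros)
  then have "(Q \<longlongrightarrow> Q z0) (nhds z0)" by (simp add: isCont_def tendsto_at_iff_tendsto_nhds)
  then have "\<forall>\<^sub>F z in nhds z0. Q z > Q z0 / 2" by (rule order_tendstoD(1)) (use Q0 in simp)
  then obtain \<delta>2 where \<delta>2: "\<delta>2 > 0" "\<And>z. z \<in> ball z0 \<delta>2 \<Longrightarrow> Q z > Q z0 / 2"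
    unfolding eventually_nhds_metric mem_ball by (metis dist_commute)
  have jac_eq: "cmod (jac H z) = (\<Prod>e\<in>A. cmod (herm z e) ^ a e) * Q z" for z
  proof -
    have "cmod (jac H z) = (\<Prod>Y\<in>refl_hyps H. cmod (herm z (root Y)) ^ (mult H Y - 1))"
      by (simp add: jac_def norm_power flip: prod_norm)
    also have "\<dots> = Q z * (\<Prod>Y\<in>R. cmod (herm z (root Y)) ^ (mult H Y - 1))"
      unfolding Q_def using finR by (intro prod.subset_diff) (auto simp: R_def)
    also have "(\<Prod>Y\<in>R. cmod (herm z (root Y)) ^ (mult H Y - 1)) = (\<Prod>e\<in>A. cmod (herm z e) ^ a e)"
      unfolding A_def using inj a_root
      by (subst prod.reindex) (auto simp: R_def inj_on_def intro!: prod.cong)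
    finally show ?thesis by (simp add: mult.commute)
  qed
  show ?thesis
  proof (intro exI conjI allI impI ballI)
    show "0 < min \<delta> \<delta>2" using \<delta> \<delta>2 by simp
    show "0 < C * (2 / Q z0)" using \<delta> Q0 by simp
    fix f M z
    assume f: "holo_on (ball z0 \<rho>) f" "\<forall>x\<in>ball z0 \<rho>. cmod (f x) \<le> M"
      and inv: "\<forall>r\<in>H. r *v z0 = z0 \<longrightarrow> (\<forall>x\<in>ball z0 \<rho>. det r * f (r *v x) = f x)"
      and z: "z \<in> ball z0 (min \<delta> \<delta>2)"
    have "0 \<le> cmod (f z0)" by simp
    also have "\<dots> \<le> M" using f(2) \<rho> by auto
    finally have M: "0 \<le> M" .
    have "\<exists>B. \<forall>x\<in>ball z0 (\<rho> / 4). cmod (f x) \<le> B * cmod (herm x e) ^ a e" if "e \<in> A" for e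
    proof -
      obtain Y where Y: "Y \<in> refl_hyps H" "z0 \<in> Y" "e = root Y" using \<open>e \<in> A\<close> by (auto simp: A_def R_def)
      obtain w where w: "w \<noteq> 0" "Y = cline w" using refl_hyps_cline[OF Y(1)] by blast
      let ?D = "det ` stab H Y"
      have cD: "card ?D = mult H Y" using card_det_stab[OF H w(1)] w(2) by simp
      have "cmod (f x) \<le> M / (\<rho> / 4) ^ (card ?D - 1) * cmod (herm x e) ^ (card ?D - 1)"
        if x: "x \<in> ball z0 (\<rho> / 4)" for x
      proof (rule rotation_invariant_bound[OF \<rho> f(1) _ _ _ _ _ _ _ x])
        show "norm e = 1" "herm z0 e = 0" using root_cline[OF w(1)] w Y by auto
        show "finite ?D" using fin by (simp add: stab_def)
        have "mat 1 \<in> stab H Y" using H by (simp add: stab_def unitary_group_def del: matrix_vector_2)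
        then show "?D \<noteq> {}" by blast
        show "cmod d = 1" if "d \<in> ?D" for d
          using that H unitary_det(2) by (auto simp: stab_def unitary_group_def)
        fix d y assume d: "d \<in> ?D" and y: "y \<in> ball z0 \<rho>"
        then obtain r where r: "r \<in> H" "\<And>v. v \<in> Y \<Longrightarrow> r *v v = v" "d = det r" by (auto simp: stab_def)
        have "r *v y = y + ((det r - 1) * herm y e) *s e"
          using stab_acts_on_root[of r w y] r w Y H cline_self[of w] by (auto simp: unitary_group_def simp del: matrix_vector_2)
        then show "d * f (y + ((d - 1) * herm y e) *s e) = f y"
          using inv r Y(2) y by (metis)
      qed (use f in auto)
      moreover have "a e = card ?D - 1" using a_root[OF Y(1)] Y(3) cD by simp
      ultimately show ?thesis by metis
    qed
    moreover have sub: "ball z0 (\<rho> / 4) \<subseteq> ball z0 \<rho>" by (rule subset_ball) (use \<rho> in simp)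
    then have "holo_on (ball z0 (\<rho> / 4)) f" by (rule holo_on_subset[OF f(1)])
    ultimately have "vanishes_along A a (ball z0 (\<rho> / 4)) f M"
      unfolding vanishes_along_def using f(2) sub by blast
    then have 1: "cmod (f z) \<le> C * M * (\<Prod>e\<in>A. cmod (herm z e) ^ a e)" using bound z by simp
    have Qz: "1 \<le> 2 / Q z0 * Q z" using \<delta>2(2)[of z] z Q0 by (simp add: field_simps)
    have "C * M * (\<Prod>e\<in>A. cmod (herm z e) ^ a e) * 1 \<le> C * M * (\<Prod>e\<in>A. cmod (herm z e) ^ a e) * (2 / Q z0 * Q z)"
      using M \<delta> by (intro mult_left_mono[OF Qz] mult_nonneg_nonneg prod_nonneg) auto
    then show "cmod (f z) \<le> C * (2 / Q z0) * M * cmod (jac H z)"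
      using 1 by (simp add: jac_eq mult_ac)
  qed
qed

section \<open>Continuation in the first variable\<close>

lemma holo_on_const: "holo_on S (\<lambda>x. c)"
  unfolding holo_on_def by (auto intro!: exI[of _ 0] simp: sum_2)

lemma holo_on_add: "holo_on S f \<Longrightarrow> holo_on S g \<Longrightarrow> holo_on S (\<lambda>x. f x + g x)"
  unfolding holo_on_def
proof (intro ballI)
  fix x assume "x \<in> S" and "\<forall>x\<in>S. \<exists>c. (f has_derivative (\<lambda>h. \<Sum>i\<in>UNIV. c $ i * h $ i)) (at x)"
    "\<forall>x\<in>S. \<exists>c. (g has_derivative (\<lambda>h. \<Sum>i\<in>UNIV. c $ i * h $ i)) (at x)"
  then obtain c d where "(f has_derivative (\<lambda>h. \<Sum>i\<in>UNIV. c $ i * h $ i)) (at x)"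
    "(g has_derivative (\<lambda>h. \<Sum>i\<in>UNIV. d $ i * h $ i)) (at x)" by blast
  from has_derivative_add[OF this]
  show "\<exists>c. ((\<lambda>x. f x + g x) has_derivative (\<lambda>h. \<Sum>i\<in>UNIV. c $ i * h $ i)) (at x)"
    by (intro exI[of _ "c + d"]) (simp add: sum_2 algebra_simps)
qed

lemma holo_on_cmult: assumes f: "holo_on S f" shows "holo_on S (\<lambda>x. k * f x)"
  unfolding holo_on_def
proof
  fix x assume "x \<in> S"
  with f obtain c where "(f has_derivative (\<lambda>h. \<Sum>i\<in>UNIV. c $ i * h $ i)) (at x)"
    unfolding holo_on_def by blast
  from has_derivative_mult_right[OF this, of k]
  show "\<exists>c. ((\<lambda>x. k * f x) has_derivative (\<lambda>h. \<Sum>i\<in>UNIV. c $ i * h $ i)) (at x)"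
    by (intro exI[of _ "k *s c"]) (simp add: sum_2 algebra_simps)
qed

lemma holo_on_sum: "finite I \<Longrightarrow> (\<And>i. i \<in> I \<Longrightarrow> holo_on S (f i)) \<Longrightarrow> holo_on S (\<lambda>x. \<Sum>i\<in>I. f i x)"
  by (induction I rule: finite_induct) (auto intro: holo_on_const holo_on_add)

text \<open>Near \<open>(z0, w0)\<close> the functions \<open>L _ w\<close> continue holomorphically to a common ball, with a bound
  uniform in \<open>w\<close>; regularity in \<open>w\<close> is never needed.\<close>

definition zreg :: "cvec set \<Rightarrow> (cvec \<Rightarrow> cvec \<Rightarrow> complex) \<Rightarrow> cvec \<Rightarrow> cvec \<Rightarrow> bool" where
  "zreg E L z0 w0 \<longleftrightarrow> (\<exists>\<rho>>0. \<exists>M. \<forall>w\<in>E \<inter> ball w0 \<rho>. \<exists>f. holo_on (ball z0 \<rho>) f \<and>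
     (\<forall>x\<in>ball z0 \<rho>. cmod (f x) \<le> M) \<and> (\<forall>z\<in>E \<inter> ball z0 \<rho>. f z = L z w))"

lemma zreg_add_cmult:
  assumes "zreg E P z0 w0" "zreg E Q z0 w0"
  shows "zreg E (\<lambda>z w. c * P z w + Q z w) z0 w0"
proof -
  obtain \<rho>1 M1 where 1: "\<rho>1 > 0" "\<And>w. w \<in> E \<inter> ball w0 \<rho>1 \<Longrightarrow> \<exists>f. holo_on (ball z0 \<rho>1) f \<and>
     (\<forall>x\<in>ball z0 \<rho>1. cmod (f x) \<le> M1) \<and> (\<forall>z\<in>E \<inter> ball z0 \<rho>1. f z = P z w)"
    using assms(1) unfolding zreg_def by blast
  obtain \<rho>2 M2 where 2: "\<rho>2 > 0" "\<And>w. w \<in> E \<inter> ball w0 \<rho>2 \<Longrightarrow> \<exists>f. holo_on (ball z0 \<rho>2) f \<and>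
     (\<forall>x\<in>ball z0 \<rho>2. cmod (f x) \<le> M2) \<and> (\<forall>z\<in>E \<inter> ball z0 \<rho>2. f z = Q z w)"
    using assms(2) unfolding zreg_def by blast
  define \<rho> where "\<rho> = min \<rho>1 \<rho>2"
  have sub: "ball x \<rho> \<subseteq> ball x \<rho>1" "ball x \<rho> \<subseteq> ball x \<rho>2" for x :: cvec
    unfolding \<rho>_def by (auto intro!: subset_ball)
  have "\<exists>f. holo_on (ball z0 \<rho>) f \<and> (\<forall>x\<in>ball z0 \<rho>. cmod (f x) \<le> cmod c * M1 + M2) \<and>
      (\<forall>z\<in>E \<inter> ball z0 \<rho>. f z = c * P z w + Q z w)" if w: "w \<in> E \<inter> ball w0 \<rho>" for w
  proof -
    have w12: "w \<in> E \<inter> ball w0 \<rho>1" "w \<in> E \<inter> ball w0 \<rho>2" using w sub[of w0] by blast+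
    obtain f where f: "holo_on (ball z0 \<rho>1) f" "\<And>x. x \<in> ball z0 \<rho>1 \<Longrightarrow> cmod (f x) \<le> M1"
      "\<And>z. z \<in> E \<inter> ball z0 \<rho>1 \<Longrightarrow> f z = P z w" using 1(2)[OF w12(1)] by blast
    obtain g where g: "holo_on (ball z0 \<rho>2) g" "\<And>x. x \<in> ball z0 \<rho>2 \<Longrightarrow> cmod (g x) \<le> M2"
      "\<And>z. z \<in> E \<inter> ball z0 \<rho>2 \<Longrightarrow> g z = Q z w" using 2(2)[OF w12(2)] by blast
    show ?thesis
    proof (intro exI[of _ "\<lambda>x. c * f x + g x"] conjI ballI)
      show "holo_on (ball z0 \<rho>) (\<lambda>x. c * f x + g x)"
        using holo_on_subset[OF f(1) sub(1)] holo_on_subset[OF g(1) sub(2)]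
        by (intro holo_on_add holo_on_cmult)
      fix x assume x: "x \<in> ball z0 \<rho>"
      have "cmod (c * f x + g x) \<le> cmod c * cmod (f x) + cmod (g x)" by (metis norm_mult norm_triangle_ineq)
      also have "\<dots> \<le> cmod c * M1 + M2"
        using f(2)[of x] g(2)[of x] x sub[of z0] by (intro add_mono mult_left_mono) auto
      finally show "cmod (c * f x + g x) \<le> cmod c * M1 + M2" .
    next
      fix z assume z: "z \<in> E \<inter> ball z0 \<rho>"
      then have "z \<in> E \<inter> ball z0 \<rho>1" "z \<in> E \<inter> ball z0 \<rho>2" using sub[of z0] by blast+
      then show "c * f z + g z = c * P z w + Q z w" using f(3) g(3) by simp
    qed
  qed
  moreover have "\<rho> > 0" using 1 2 by (simp add: \<rho>_def)
  ultimately show ?thesis unfolding zreg_def by blast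
qed

lemma zreg_zero: "zreg E (\<lambda>z w. 0) z0 w0"
  unfolding zreg_def by (intro exI[of _ 1] exI[of _ 0] conjI ballI exI[of _ "\<lambda>x. 0"]) (auto simp: holo_on_const)

lemma zreg_sum:
  assumes "finite I" "\<And>i. i \<in> I \<Longrightarrow> zreg E (L i) z0 w0"
  shows "zreg E (\<lambda>z w. \<Sum>i\<in>I. c i * L i z w) z0 w0"
  using assms
proof (induction I rule: finite_induct)
  case empty
  then show ?case by (simp add: zreg_zero)
next
  case (insert i I)
  have "zreg E (\<lambda>z w. c i * L i z w + (\<Sum>i\<in>I. c i * L i z w)) z0 w0"
    by (rule zreg_add_cmult) (use insert in auto)
  then show ?case using insert.hyps by simp
qed

lemma zreg_compose:
  assumes h: "unitary h" "(*v) h ` E = E" and L: "zreg E L z0 (h *v w0)"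
  shows "zreg E (\<lambda>z w. L z (h *v w)) z0 w0"
proof -
  obtain \<rho> M where 1: "\<rho> > 0" "\<And>w. w \<in> E \<inter> ball (h *v w0) \<rho> \<Longrightarrow> \<exists>f. holo_on (ball z0 \<rho>) f \<and>
     (\<forall>x\<in>ball z0 \<rho>. cmod (f x) \<le> M) \<and> (\<forall>z\<in>E \<inter> ball z0 \<rho>. f z = L z w)"
    using L unfolding zreg_def by blast
  have "h *v w \<in> E \<inter> ball (h *v w0) \<rho>" if "w \<in> E \<inter> ball w0 \<rho>" for w
    using that h(2) unitary_dist[OF h(1), of w0 w] by (auto simp del: matrix_vector_2)
  then show ?thesis unfolding zreg_def using 1 by (intro exI[of _ \<rho>] conjI exI[of _ M] ballI) auto
qed

section \<open>From the conjugated product domain to the first variable\<close>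

lemma vcnj_vcnj [simp]: "vcnj (vcnj w) = w"
  by (simp add: vcnj_def vec_eq_iff)

lemma dist_vcnj: "dist (vcnj v) (vcnj w) = dist v w"
  by (simp add: dist_norm norm_vec_def L2_set_def sum_2 vcnj_def flip: complex_cnj_diff)

lemma linear_vcnj: "linear vcnj"
  by (auto simp: linear_iff vcnj_def vec_eq_iff)

lemma inj_vcnj: "inj vcnj"
  by (metis injI vcnj_vcnj)

lemma tilde_eq: "tilde E = E \<times> vcnj ` E"
  by (auto simp: tilde_def)

lemma open_tilde: "open E \<Longrightarrow> open (tilde E)"
proof -
  assume E: "open E"
  have "open (vcnj ` E)"
    using open_surjective_linear_image[OF E linear_vcnj] by (metis surjI vcnj_vcnj)
  then show ?thesis using E by (simp add: tilde_eq open_Times)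
qed

lemma closure_tilde: "(z, vcnj w) \<in> closure (tilde E) \<longleftrightarrow> z \<in> closure E \<and> w \<in> closure E"
  using inj_vcnj by (auto simp: tilde_eq closure_Times closure_injective_linear_image[OF linear_vcnj inj_vcnj, symmetric] inj_image_mem_iff)

text \<open>Freezing w leaves a holomorphic function of z, and continuity of F at the single point
  (z0, conj w0) bounds it by |F| + 1 there, uniformly in w.\<close>

lemma holo2_imp_zreg:
  assumes F: "holo2_on S F" "open S" "(z0, vcnj w0) \<in> S"
    and eq: "\<And>z w. z \<in> E \<Longrightarrow> w \<in> E \<Longrightarrow> F (z, vcnj w) = L z w"
  shows "zreg E L z0 w0"
proof -
  let ?q = "(z0, vcnj w0)"
  obtain F' where "(F has_derivative F') (at ?q)" using F unfolding holo2_on_def by blast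
  then have "isCont F ?q" by (rule has_derivative_continuous)
  from this[unfolded continuous_at_eps_delta, rule_format, OF zero_less_one]
  obtain \<rho>1 where \<rho>1: "\<rho>1 > 0" "\<And>p. dist p ?q < \<rho>1 \<Longrightarrow> dist (F p) (F ?q) < 1"
    by blast
  obtain \<rho>2 where \<rho>2: "\<rho>2 > 0" "ball ?q \<rho>2 \<subseteq> S" using F open_contains_ball by blast
  \<comment> \<open>Halved because the distance in the product is at most the sum of the two
    distances.\<close>
  define \<rho> where "\<rho> = min \<rho>1 \<rho>2 / 2"
  have \<rho>: "\<rho> > 0" using \<rho>1 \<rho>2 by (simp add: \<rho>_def)
  have close: "dist (z, vcnj w) ?q < \<rho>1" "(z, vcnj w) \<in> S" if "z \<in> ball z0 \<rho>" "w \<in> ball w0 \<rho>" for z w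
  proof -
    have "dist (z, vcnj w) ?q \<le> dist z z0 + dist (vcnj w) (vcnj w0)"
      by (simp add: dist_Pair_Pair sqrt_sum_squares_le_sum)
    also have "\<dots> < 2 * \<rho>" using that by (simp add: dist_vcnj dist_commute)
    finally have "dist (z, vcnj w) ?q < min \<rho>1 \<rho>2" by (simp add: \<rho>_def)
    then show "dist (z, vcnj w) ?q < \<rho>1" "(z, vcnj w) \<in> S" using \<rho>2 by (auto simp: dist_commute)
  qed
  have "\<exists>f. holo_on (ball z0 \<rho>) f \<and> (\<forall>x\<in>ball z0 \<rho>. cmod (f x) \<le> cmod (F ?q) + 1) \<and>
      (\<forall>z\<in>E \<inter> ball z0 \<rho>. f z = L z w)" if w: "w \<in> E \<inter> ball w0 \<rho>" for w
  proof (intro exI[of _ "\<lambda>z. F (z, vcnj w)"] conjI ballI)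
    show "holo_on (ball z0 \<rho>) (\<lambda>z. F (z, vcnj w))" unfolding holo_on_def
    proof
      fix z assume "z \<in> ball z0 \<rho>"
      then have "(z, vcnj w) \<in> S" using close(2) w by blast
      then obtain a b where ab: "(F has_derivative (\<lambda>(h,k). (\<Sum>i\<in>UNIV. a $ i * h $ i) + (\<Sum>i\<in>UNIV. b $ i * k $ i))) (at (z, vcnj w))"
        using F(1) unfolding holo2_on_def by blast
      have "((\<lambda>z. (z, vcnj w)) has_derivative (\<lambda>h. (h, 0))) (at z)"
        by (intro has_derivative_Pair has_derivative_ident has_derivative_const)
      from has_derivative_compose[OF this ab]
      show "\<exists>c. ((\<lambda>z. F (z, vcnj w)) has_derivative (\<lambda>h. \<Sum>i\<in>UNIV. c $ i * h $ i)) (at z)"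
        by (intro exI[of _ a]) simp
    qed
    fix z assume "z \<in> ball z0 \<rho>"
    then have "dist (F (z, vcnj w)) (F ?q) < 1" using close(1) \<rho>1(2) w by blast
    then show "cmod (F (z, vcnj w)) \<le> cmod (F ?q) + 1"
      using norm_triangle_ineq2[of "F (z, vcnj w)" "F ?q"] by (simp add: dist_norm)
  qed (use eq w in auto)
  then show ?thesis unfolding zreg_def using \<rho> by blast
qed

text \<open>If z0 or w0 lies outside E, the pair is a boundary point off the diagonal and the
  hypothesis applies there. Interior pairs, diagonal ones included, borrow the continuation from
  some other boundary point.\<close>

lemma kernel_zreg:
  assumes E: "open E" "bounded E" "0 \<in> E" and K: "continues_off_diag E K"
    and z0: "z0 \<in> closure E" and w0: "w0 \<in> closure E" and ne: "z0 \<noteq> w0 \<or> z0 \<in> E"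
  shows "zreg E K z0 w0"
proof (cases "z0 \<in> E \<and> w0 \<in> E")
  case False
  have "(z0, vcnj w0) \<notin> tilde E" using False inj_vcnj by (auto simp: tilde_eq inj_image_mem_iff)
  moreover have "(z0, vcnj w0) \<in> closure (tilde E)" using z0 w0 by (simp add: closure_tilde)
  ultimately have "(z0, vcnj w0) \<in> frontier (tilde E)"
    by (simp add: frontier_def interior_open open_tilde E)
  moreover have "z0 \<noteq> w0" using ne False by auto
  ultimately obtain r F where r: "r > 0" and F: "holo2_on (tilde E \<union> ball (z0, vcnj w0) r) F"
    "\<forall>p\<in>tilde E. F p = K (fst p) (vcnj (snd p))"
    using K unfolding continues_off_diag_def by force
  show ?thesis
  proof (rule holo2_imp_zreg[OF F(1)])
    show "open (tilde E \<union> ball (z0, vcnj w0) r)" using open_tilde[OF E(1)] by blast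
  qed (use r F(2) in \<open>auto simp: tilde_eq\<close>)
next
  case True
  \<comment> \<open>Any single continuation is holomorphic on all of \<open>tilde E\<close>, so one
    admissible boundary point suffices: (0, conj w1), with w1 distinct from 0 since 0 lies in
    E.\<close>
  have "frontier E \<noteq> {}" using E by (auto simp: frontier_eq_empty)
  then obtain w1 where w1: "w1 \<in> frontier E" by blast
  have w1E: "w1 \<in> closure E" "w1 \<notin> E" using w1 E by (auto simp: frontier_def interior_open)
  have "(0, vcnj w1) \<in> closure (tilde E)" using w1E E closure_subset[of E] by (auto simp: closure_tilde)
  moreover have "(0, vcnj w1) \<notin> tilde E" using w1E inj_vcnj by (auto simp: tilde_eq inj_image_mem_iff)
  ultimately have "(0, vcnj w1) \<in> frontier (tilde E)"
    by (simp add: frontier_def interior_open open_tilde E)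
  moreover have "0 \<noteq> w1" using w1E E by auto
  ultimately obtain r F where r: "r > 0" and F: "holo2_on (tilde E \<union> ball (0, vcnj w1) r) F"
    "\<forall>p\<in>tilde E. F p = K (fst p) (vcnj (snd p))"
    using K unfolding continues_off_diag_def by force
  show ?thesis
  proof (rule holo2_imp_zreg[OF F(1)])
    show "open (tilde E \<union> ball (0, vcnj w1) r)" using open_tilde[OF E(1)] by blast
  qed (use True F(2) in \<open>auto simp: tilde_eq\<close>)
qed

text \<open>A local extension need not be anti-invariant, but its average over the stabiliser of
  \<open>z0\<close> is, and it still extends \<open>L\<close>.\<close>

lemma zreg_division:
  assumes H: "unitary_group H" and E: "\<And>h. h \<in> H \<Longrightarrow> (*v) h ` E = E" and L: "zreg E L z0 w0"
    and inv: "\<And>r z w. r \<in> H \<Longrightarrow> z \<in> E \<Longrightarrow> w \<in> E \<Longrightarrow> det r * L (r *v z) w = L z w"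
  shows "\<exists>\<delta>>0. \<exists>C>0. \<forall>z\<in>E \<inter> ball z0 \<delta>. \<forall>w\<in>E \<inter> ball w0 \<delta>. cmod (L z w) \<le> C * cmod (jac H z)"
proof -
  obtain \<rho> M where \<rho>: "\<rho> > 0" and loc: "\<And>w. w \<in> E \<inter> ball w0 \<rho> \<Longrightarrow> \<exists>f. holo_on (ball z0 \<rho>) f \<and>
     (\<forall>x\<in>ball z0 \<rho>. cmod (f x) \<le> M) \<and> (\<forall>z\<in>E \<inter> ball z0 \<rho>. f z = L z w)"
    using L unfolding zreg_def by blast
  obtain \<delta> C where \<delta>: "\<delta> > 0" "C > 0" and bound: "\<And>f M z. holo_on (ball z0 \<rho>) f \<Longrightarrow> \<forall>x\<in>ball z0 \<rho>. cmod (f x) \<le> M \<Longrightarrow>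
     \<forall>r\<in>H. r *v z0 = z0 \<longrightarrow> (\<forall>x\<in>ball z0 \<rho>. det r * f (r *v x) = f x) \<Longrightarrow>
     z \<in> ball z0 \<delta> \<Longrightarrow> cmod (f z) \<le> C * M * cmod (jac H z)"
    using anti_invariant_division_bound[OF H \<rho>, of z0] by blast
  define St where "St = {r \<in> H. r *v z0 = z0}"
  have fin: "finite St" using H by (simp add: St_def unitary_group_def del: matrix_vector_2)
  have uni: "unitary r" if "r \<in> St" for r using that H by (simp add: St_def unitary_group_def)
  have one: "mat 1 \<in> St" using H by (simp add: St_def unitary_group_def del: matrix_vector_2)
  have card: "card St > 0" using fin one by (auto simp: card_gt_0_iff)
  have mult: "a ** b \<in> St" if "a \<in> St" "b \<in> St" for a b
    using that H by (simp add: St_def unitary_group_def matrix_vector_mul_assoc[symmetric] del: matrix_vector_2)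
  have inverse: "matrix_inv a \<in> St" if "a \<in> St" for a
  proof -
    have "matrix_inv a *v z0 = z0" using that unitary_inv_vec(1)[OF uni[OF that], of z0]
      by (simp add: St_def del: matrix_vector_2 unitary_inv_vec)
    then show ?thesis using that H by (simp add: St_def unitary_group_def del: matrix_vector_2)
  qed
  have rball: "r *v x \<in> ball z0 \<rho>" if "r \<in> St" "x \<in> ball z0 \<rho>" for r x
    using that unitary_dist[OF uni[OF that(1)], of z0 x] by (simp add: St_def del: matrix_vector_2)
  \<comment> \<open>Right translation by s, because the average will be evaluated at s x.\<close>
  have bij: "bij_betw (\<lambda>r. r ** s) St St" if "s \<in> St" for s
    by (rule bij_betwI[where g = "\<lambda>r. r ** matrix_inv s"])
      (use that mult inverse matrix_inv_mult_cancel[OF uni[OF that]] in \<open>auto simp: matrix_mul_assoc[symmetric]\<close>)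
  \<comment> \<open>The sign of M is unknown if no point of E is near w0;
    \<open>\<bar>M\<bar>\<close> and + 1 make the constant positive in any case.\<close>
  have main: "cmod (L z w) \<le> (C * \<bar>M\<bar> + 1) * cmod (jac H z)"
    if z: "z \<in> E \<inter> ball z0 (min \<delta> \<rho>)" and w: "w \<in> E \<inter> ball w0 \<rho>" for z w
  proof -
    obtain f where f: "holo_on (ball z0 \<rho>) f" "\<And>x. x \<in> ball z0 \<rho> \<Longrightarrow> cmod (f x) \<le> M"
      "\<And>z. z \<in> E \<inter> ball z0 \<rho> \<Longrightarrow> f z = L z w" using loc[OF w] by blast
    define F where "F x = (1 / of_nat (card St)) * (\<Sum>r\<in>St. det r * f (r *v x))" for x
    have "holo_on (ball z0 \<rho>) F" unfolding F_def
      by (intro holo_on_cmult holo_on_sum fin holo_on_compose_cmat[OF f(1)] rball)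
    moreover have "\<forall>x\<in>ball z0 \<rho>. cmod (F x) \<le> M"
    proof
      fix x assume x: "x \<in> ball z0 \<rho>"
      have "cmod (\<Sum>r\<in>St. det r * f (r *v x)) \<le> of_nat (card St) * M"
      proof (rule sum_norm_bound)
        fix r assume r: "r \<in> St"
        show "cmod (det r * f (r *v x)) \<le> M"
          using f(2)[OF rball[OF r x]] unitary_det(2)[OF uni[OF r]] by (simp add: norm_mult del: matrix_vector_2)
      qed
      then show "cmod (F x) \<le> M" using card by (simp add: F_def norm_mult norm_divide field_simps del: matrix_vector_2)
    qed
    moreover have "\<forall>s\<in>H. s *v z0 = z0 \<longrightarrow> (\<forall>x\<in>ball z0 \<rho>. det s * F (s *v x) = F x)"
    proof (intro ballI impI)
      fix s x assume "s \<in> H" "s *v z0 = z0"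
      then have s: "s \<in> St" by (simp add: St_def)
      have "(\<Sum>r\<in>St. det r * f (r *v x)) = (\<Sum>r\<in>St. det (r ** s) * f ((r ** s) *v x))"
        by (rule sum.reindex_bij_betw[OF bij[OF s], symmetric])
      also have "\<dots> = det s * (\<Sum>r\<in>St. det r * f (r *v (s *v x)))"
        by (simp add: det_mul matrix_vector_mul_assoc[symmetric] sum_distrib_left mult_ac del: matrix_vector_2)
      finally show "det s * F (s *v x) = F x" by (simp add: F_def mult_ac del: matrix_vector_2)
    qed
    ultimately have "cmod (F z) \<le> C * M * cmod (jac H z)" by (rule bound) (use z in auto)
    moreover have "F z = L z w"
    proof -
      have zb: "z \<in> ball z0 \<rho>" "z \<in> E" using z by auto
      have "det r * f (r *v z) = L z w" if r: "r \<in> St" for r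
      proof -
        have rH: "r \<in> H" using r by (simp add: St_def)
        have "r *v z \<in> E" using E[OF rH] zb(2) by blast
        then have "f (r *v z) = L (r *v z) w" using f(3) rball[OF r zb(1)] by blast
        then show ?thesis using inv[OF rH zb(2)] w by simp
      qed
      then show ?thesis using card by (simp add: F_def del: matrix_vector_2)
    qed
    moreover have "C * M * cmod (jac H z) \<le> (C * \<bar>M\<bar> + 1) * cmod (jac H z)"
    proof (rule mult_right_mono)
      have "C * M \<le> C * \<bar>M\<bar>" using \<delta> by (intro mult_left_mono) auto
      then show "C * M \<le> C * \<bar>M\<bar> + 1" by simp
    qed simp
    ultimately show ?thesis by simp
  qed
  have "C * \<bar>M\<bar> + 1 > 0" using \<delta> by (simp add: add_nonneg_pos)
  moreover have "min \<delta> \<rho> > 0" using \<delta> \<rho> by simp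
  ultimately show ?thesis using main by (intro exI[of _ "min \<delta> \<rho>"] conjI exI[of _ "C * \<bar>M\<bar> + 1"]) auto
qed

section \<open>The weighted kernel estimate\<close>

lemma matrix_inv_eqI:
  assumes "unitary A" "A ** B = mat 1" shows "matrix_inv A = B"
  by (metis assms matrix_inv_mult_cancel(1) matrix_mul_assoc matrix_mul_lid matrix_mul_rid)

lemma unitary_group_normalizes: "unitary_group G \<Longrightarrow> g \<in> G \<Longrightarrow> normalizes g G"
  by (auto simp: normalizes_def unitary_group_def)

text \<open>A conjugate of a generator is a reflection in the transformed line, which stays in S by
  invariance; the induction carries this to products and inverses.\<close>

lemma sub_gen_normal:
  assumes G: "unitary_group G" and S: "G_inv_hyps G S" and g: "g \<in> G"
  shows "normalizes g (sub_gen G S)"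
proof -
  have uni: "unitary a" if "a \<in> G" for a using G that by (simp add: unitary_group_def)
  have conj: "g ** h ** matrix_inv g \<in> sub_gen G S" if "h \<in> sub_gen G S" "g \<in> G" for h g
    using that(1) unfolding sub_gen_def
  proof induction
    case gen_one
    then show ?case using matrix_inv_mult_cancel(2)[OF uni[OF that(2)]] by (simp add: gen_grp.gen_one)
  next
    case (gen_base r)
    then have r: "r \<in> G" "reflection r" "fixset r \<in> S" by auto
    have "g ** r ** matrix_inv g \<in> G" using G that(2) r by (simp add: unitary_group_def)
    then show ?case
      using conj_reflection[OF G uni[OF that(2)] unitary_group_normalizes[OF G that(2)] r(1,2)] r(3) S that(2)
      by (intro gen_grp.gen_base) (auto simp: G_inv_hyps_def)
  next
    case (gen_mult a b)
    have "g ** (a ** b) ** matrix_inv g = (g ** a ** matrix_inv g) ** (g ** b ** matrix_inv g)"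
      by (metis matrix_inv_mult_cancel(1)[OF uni[OF that(2)]] matrix_mul_assoc matrix_mul_lid)
    then show ?case using gen_mult by (simp add: gen_grp.gen_mult)
  next
    case (gen_inv a)
    have a: "a \<in> G" using gen_inv sub_gen_subset[OF G, of S] by (auto simp: sub_gen_def)
    have u: "unitary (g ** a ** matrix_inv g)" using uni[OF a] uni[OF that(2)] by (intro unitary_mult unitary_inv)
    have "(g ** a ** matrix_inv g) ** (g ** matrix_inv a ** matrix_inv g)
        = g ** (a ** (matrix_inv g ** g) ** matrix_inv a) ** matrix_inv g"
      by (simp only: matrix_mul_assoc)
    also have "\<dots> = mat 1"
      using matrix_inv_mult_cancel[OF uni[OF a]] matrix_inv_mult_cancel[OF uni[OF that(2)]] by simp
    finally have "matrix_inv (g ** a ** matrix_inv g) = g ** matrix_inv a ** matrix_inv g"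
      by (rule matrix_inv_eqI[OF u])
    then show ?case using gen_grp.gen_inv[OF gen_inv.IH] by simp
  qed
  have ginv: "matrix_inv g \<in> G" using G g by (simp add: unitary_group_def)
  show ?thesis unfolding normalizes_def
    using conj[OF _ g] conj[OF _ ginv] matrix_inv_inv[OF uni[OF g]] by auto
qed

text \<open>A nontrivial element fixing w is a reflection whose line passes through w, so that line
  belongs to S1 and the element is a generator.\<close>

lemma stab_in_sub_gen:
  assumes G: "unitary_group G" and R: "refl_hyps G = S1 \<union> S2" and w: "w \<noteq> 0" "\<forall>Y\<in>S2. w \<notin> Y"
    and h: "h \<in> G" "h *v w = w"
  shows "h \<in> sub_gen G S1"
proof (cases "h = mat 1")
  case True
  then show ?thesis by (simp add: sub_gen_def gen_grp.gen_one)
next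
  case False
  note r = unitary_group_reflectionI[OF G h(1) False w(1) h(2)]
  then have "fixset h \<in> S1 \<union> S2" using R h(1) unfolding refl_hyps_def by blast
  moreover have "w \<in> fixset h" using r cline_self by simp
  ultimately have "fixset h \<in> S1" using w by blast
  then show ?thesis unfolding sub_gen_def using h(1) r by (intro gen_grp.gen_base) auto
qed

text \<open>Every nontrivial element fixing Y pointwise is a reflection in Y, hence one of the
  generators.\<close>

lemma mult_sub_gen:
  assumes G: "unitary_group G" and Y: "Y \<in> refl_hyps G" "Y \<in> S"
  shows "mult (sub_gen G S) Y = mult G Y"
proof -
  obtain w where w: "w \<noteq> 0" "Y = cline w" using refl_hyps_cline[OF Y(1)] by blast
  have "g \<in> sub_gen G S" if g: "g \<in> G" "\<forall>v\<in>Y. g *v v = v" for g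
  proof (cases "g = mat 1")
    case True
    then show ?thesis by (simp add: sub_gen_def gen_grp.gen_one)
  next
    case False
    have "g *v w = w" using g w cline_self by blast
    note r = unitary_group_reflectionI[OF G g(1) False w(1) this]
    then show ?thesis unfolding sub_gen_def using g(1) w Y by (intro gen_grp.gen_base) auto
  qed
  then have "stab (sub_gen G S) Y = stab G Y" using sub_gen_subset[OF G, of S] unfolding stab_def by blast
  then show ?thesis by (simp add: mult_def)
qed

text \<open>Condition (c) enters here: each subgroup has no reflecting lines beyond its own class,
  so the two products share out the lines of G.\<close>

lemma jac_factor:
  assumes G: "unitary_group G" and R: "refl_hyps G = S1 \<union> S2" "S1 \<inter> S2 = {}"
    and S: "refl_hyps (sub_gen G S1) = S1" "refl_hyps (sub_gen G S2) = S2"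
  shows "jac G z = jac (sub_gen G S1) z * jac (sub_gen G S2) z"
proof -
  have "finite (refl_hyps G)" using G finite_refl_hyps by (simp add: unitary_group_def)
  then have fin: "finite S1" "finite S2" using R by auto
  have "jac G z = (\<Prod>Y\<in>S1. herm z (root Y) ^ (mult G Y - 1)) * (\<Prod>Y\<in>S2. herm z (root Y) ^ (mult G Y - 1))"
    unfolding jac_def R(1) using fin R(2) by (intro prod.union_disjoint) auto
  also have "\<dots> = jac (sub_gen G S1) z * jac (sub_gen G S2) z"
    unfolding jac_def S using R(1) mult_sub_gen[OF G] by (intro arg_cong2[of _ _ _ _ "(*)"] prod.cong) auto
  finally show ?thesis .
qed

lemma jac_nonzero:
  assumes "finite H" "\<forall>Y\<in>refl_hyps H. w \<notin> Y" shows "jac H w \<noteq> 0"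
proof -
  have "herm w (root Y) \<noteq> 0" if "Y \<in> refl_hyps H" for Y
  proof -
    obtain v where "v \<noteq> 0" "Y = cline v" using refl_hyps_cline \<open>Y \<in> refl_hyps H\<close> by blast
    then show ?thesis using herm_root_eq_0_iff assms(2) that by blast
  qed
  then show ?thesis unfolding jac_def using finite_refl_hyps[OF assms(1)] by simp
qed

section \<open>Weights and compactness\<close>

lemma continuous_on_jac: "continuous_on S (jac H)"
  unfolding jac_def herm_2 by (intro continuous_intros)

lemma jac_bounded:
  assumes "bounded E" obtains B where "1 \<le> B" "\<And>z. z \<in> E \<Longrightarrow> cmod (jac H z) \<le> B"
proof -
  have "compact (jac H ` closure E)"
    using assms by (intro compact_continuous_image continuous_on_jac) (simp add: compact_closure)
  then obtain b where b: "\<And>y. y \<in> jac H ` closure E \<Longrightarrow> cmod y \<le> b"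
    using compact_imp_bounded bounded_iff by metis
  show thesis
    by (rule that[of "max 1 b"]) (use b closure_subset[of E] in \<open>auto simp: le_max_iff_disj\<close>)
qed

text \<open>\<open>x\<close> and \<open>y\<close> are moduli of Jacobians: the bound on l leaves the
  power 1 - s of x, and exponents between 0 and 1 are replaced by 1 because B >= 1.\<close>

lemma weight_bound:
  fixes x y l B C s :: real
  assumes "0 \<le> x" "x \<le> B" "0 \<le> y" "y \<le> B" "1 \<le> B" "0 \<le> s" "s \<le> 1" "l \<le> C * x" "0 \<le> C"
  shows "x powr (- s) * l * y powr s \<le> C * B * B"
proof (cases "x = 0")
  \<comment> \<open>\<open>0 powr a\<close> is 0 for every a, so the product vanishes where the true
    weight would be singular.\<close>
  case True
  then show ?thesis using assms by simp
next
  case False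
  then have x: "x > 0" using assms by simp
  have "x powr (- s) * l \<le> x powr (- s) * (C * x)" using assms by (intro mult_left_mono) auto
  also have "\<dots> = C * x powr (1 - s)"
    using x by (simp add: powr_diff powr_minus field_simps)
  also have "\<dots> \<le> C * B powr 1"
    using assms x by (intro mult_left_mono order_trans[OF powr_mono2 powr_mono]) auto
  finally have 1: "x powr (- s) * l \<le> C * B" using assms by simp
  have "y powr s \<le> B powr 1" using assms by (intro order_trans[OF powr_mono2 powr_mono]) auto
  then have 2: "y powr s \<le> B" using assms by simp
  have "x powr (- s) * l * y powr s \<le> C * B * y powr s" using 1 by (intro mult_right_mono) auto
  also have "\<dots> \<le> C * B * B" using 2 assms by (intro mult_left_mono) auto
  finally show ?thesis .
qed

text \<open>The local constants of a finite subcover are added up; absolute values because they may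
  be negative, and 1 for strict positivity. The cover is of S, since the delicate points lie outside
  P.\<close>

lemma compact_local_bound:
  fixes f t :: "'a::metric_space \<Rightarrow> real"
  assumes S: "compact S" "P \<subseteq> S" and t: "\<And>p. p \<in> P \<Longrightarrow> 0 \<le> t p"
    and loc: "\<And>q. q \<in> S \<Longrightarrow> \<exists>\<delta>>0. \<exists>C. \<forall>p\<in>P. dist q p < \<delta> \<longrightarrow> f p \<le> C * t p"
  shows "\<exists>C>0. \<forall>p\<in>P. f p \<le> C * t p"
proof -
  obtain \<delta> C where \<delta>: "\<And>q. q \<in> S \<Longrightarrow> \<delta> q > 0" and C: "\<And>q p. q \<in> S \<Longrightarrow> p \<in> P \<Longrightarrow> dist q p < \<delta> q \<Longrightarrow> f p \<le> C q * t p"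
    using loc by metis
  have "S \<subseteq> (\<Union>q\<in>S. ball q (\<delta> q))" using \<delta> by auto
  then obtain D where D: "D \<subseteq> S" "finite D" "S \<subseteq> (\<Union>q\<in>D. ball q (\<delta> q))"
    using compactE_image[OF S(1), of S "\<lambda>q. ball q (\<delta> q)"] by auto
  have pos: "0 \<le> (\<Sum>q\<in>D. \<bar>C q\<bar>)" by (intro sum_nonneg) auto
  have "f p \<le> (1 + (\<Sum>q\<in>D. \<bar>C q\<bar>)) * t p" if p: "p \<in> P" for p
  proof -
    obtain q where q: "q \<in> D" "dist q p < \<delta> q" using D(3) S(2) p by auto
    have "\<bar>C q\<bar> \<le> (\<Sum>q\<in>D. \<bar>C q\<bar>)" using q(1) D(2) by (intro member_le_sum) auto
    then have "C q \<le> 1 + (\<Sum>q\<in>D. \<bar>C q\<bar>)" by linarith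
    then have "C q * t p \<le> (1 + (\<Sum>q\<in>D. \<bar>C q\<bar>)) * t p" using t[OF p] by (intro mult_right_mono)
    moreover have "f p \<le> C q * t p" using C q D(1) p by blast
    ultimately show ?thesis by linarith
  qed
  moreover have "0 < 1 + (\<Sum>q\<in>D. \<bar>C q\<bar>)" using pos by linarith
  ultimately show ?thesis by blast
qed

text \<open>Without the factor 1 / \<open>card H\<close>, so that a sum over G splits exactly into
  its parts over a subgroup and the complement.\<close>

definition Ksum :: "(cvec \<Rightarrow> cvec \<Rightarrow> complex) \<Rightarrow> cmat set \<Rightarrow> cvec \<Rightarrow> cvec \<Rightarrow> complex" where
  "Ksum K H z w = (\<Sum>h\<in>H. K z (h *v w) * cnj (det h))"

text \<open>The parameter s stands for 1 - 2 / p; passing to the conjugate exponent is a change of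
  sign.\<close>

definition wker :: "(cvec \<Rightarrow> cvec \<Rightarrow> complex) \<Rightarrow> cmat set \<Rightarrow> real \<Rightarrow> cvec \<Rightarrow> cvec \<Rightarrow> real" where
  "wker K H s z w = cmod (jac H z) powr (- s) * (cmod (Ksum K H z w) / real (card H)) * cmod (jac H w) powr s"

lemma norm_KHp: "cmod (KHp K H p z w) = wker K H (1 - 2 / p) z w"
  by (simp add: KHp_def wker_def KH_def Ksum_def norm_mult norm_divide)

lemma wker_nonneg: "0 \<le> wker K H s z w"
  by (simp add: wker_def)

section \<open>Symmetries of the averaged kernels\<close>

locale bergman_group =
  fixes G :: "cmat set" and E :: "cvec set" and K :: "cvec \<Rightarrow> cvec \<Rightarrow> complex"
  assumes G: "unitary_group G" and E: "open E" "bounded E" "0 \<in> E"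
    and GE: "\<And>g. g \<in> G \<Longrightarrow> (*v) g ` E = E"
    and K: "bergman_kernel E K" "continues_off_diag E K"
begin

lemma uni: "g \<in> G \<Longrightarrow> unitary g" using G by (simp add: unitary_group_def)

lemma inE: "g \<in> G \<Longrightarrow> z \<in> E \<Longrightarrow> g *v z \<in> E" using GE by blast

lemma K_invariant: "g \<in> G \<Longrightarrow> z \<in> E \<Longrightarrow> w \<in> E \<Longrightarrow> K (g *v z) (g *v w) = K z w"
  using bergman_unitary_invariant[OF E(1) K(1) uni GE] .

lemma K_hermitian: "z \<in> E \<Longrightarrow> w \<in> E \<Longrightarrow> K w z = cnj (K z w)"
  using bergman_hermitian[OF E(1) K(1)] .

text \<open>Replacing h by r h in the sum and using K(rz, rhw) = K(z, hw) pulls out the conjugate of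
  det r, which is its inverse.\<close>

lemma Ksum_anti_invariant:
  assumes H: "unitary_group H" "H \<subseteq> G" and r: "r \<in> H" and zw: "z \<in> E" "w \<in> E"
  shows "det r * Ksum K H (r *v z) w = Ksum K H z w"
proof -
  have rG: "r \<in> G" using r H by blast
  note c = matrix_inv_mult_cancel[OF uni[OF rG]]
  have bij: "bij_betw (\<lambda>h. r ** h) H H"
    by (rule bij_betwI[where g = "\<lambda>h. matrix_inv r ** h"])
      (use H(1) r c in \<open>auto simp: matrix_mul_assoc unitary_group_def\<close>)
  have "Ksum K H (r *v z) w = (\<Sum>h\<in>H. K (r *v z) ((r ** h) *v w) * cnj (det (r ** h)))"
    unfolding Ksum_def by (rule sum.reindex_bij_betw[OF bij, symmetric])
  also have "\<dots> = (\<Sum>h\<in>H. cnj (det r) * (K z (h *v w) * cnj (det h)))"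
  proof (rule sum.cong)
    fix h assume "h \<in> H"
    then have "h *v w \<in> E" using H inE zw by blast
    then have "K (r *v z) ((r ** h) *v w) = K z (h *v w)"
      using K_invariant[OF rG zw(1)] by (simp add: matrix_vector_mul_assoc[symmetric] del: matrix_vector_2)
    then show "K (r *v z) ((r ** h) *v w) * cnj (det (r ** h)) = cnj (det r) * (K z (h *v w) * cnj (det h))"
      by (simp add: det_mul mult_ac del: matrix_vector_2)
  qed simp
  also have "\<dots> = cnj (det r) * Ksum K H z w" by (simp add: Ksum_def sum_distrib_left)
  finally show ?thesis using unitary_det(1)[OF uni[OF rG]] by (simp add: mult.assoc[symmetric])
qed

text \<open>Conjugation by g permutes H and preserves determinants. Both variables must move, since
  g need not lie in H.\<close>

lemma Ksum_normalizer:
  assumes H: "H \<subseteq> G" and g: "g \<in> G" "normalizes g H" and zw: "z \<in> E" "w \<in> E"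
  shows "Ksum K H (g *v z) (g *v w) = Ksum K H z w"
proof -
  note c = matrix_inv_mult_cancel[OF uni[OF g(1)]]
  have eq: "matrix_inv g ** (g ** h ** matrix_inv g) ** g = h" "g ** (matrix_inv g ** h ** g) ** matrix_inv g = h" for h
    by (metis c matrix_mul_assoc matrix_mul_lid matrix_mul_rid)+
  have bij: "bij_betw (\<lambda>h. g ** h ** matrix_inv g) H H"
    by (rule bij_betwI[where g = "\<lambda>h. matrix_inv g ** h ** g"])
      (use g(2) eq in \<open>auto simp: normalizes_def\<close>)
  have "Ksum K H (g *v z) (g *v w)
      = (\<Sum>h\<in>H. K (g *v z) ((g ** h ** matrix_inv g) *v (g *v w)) * cnj (det (g ** h ** matrix_inv g)))"
    unfolding Ksum_def by (rule sum.reindex_bij_betw[OF bij, symmetric])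
  also have "\<dots> = Ksum K H z w" unfolding Ksum_def
  proof (rule sum.cong)
    fix h assume "h \<in> H"
    then have "h *v w \<in> E" using H inE zw by blast
    then have "K (g *v z) ((g ** h ** matrix_inv g) *v (g *v w)) = K z (h *v w)"
      using K_invariant[OF g(1) zw(1)] by (simp add: conj_vec[OF uni[OF g(1)]] del: matrix_vector_2)
    moreover have "det (g ** h ** matrix_inv g) = det h"
      using unitary_det(1)[OF uni[OF g(1)]] by (simp add: det_mul det_matrix_inv[OF uni[OF g(1)]] mult_ac)
    ultimately show "K (g *v z) ((g ** h ** matrix_inv g) *v (g *v w)) * cnj (det (g ** h ** matrix_inv g))
        = K z (h *v w) * cnj (det h)" by simp
  qed simp
  finally show ?thesis .
qed

lemma Ksum_hermitian:
  assumes H: "unitary_group H" "H \<subseteq> G" and zw: "z \<in> E" "w \<in> E"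
  shows "Ksum K H w z = cnj (Ksum K H z w)"
proof -
  have bij: "bij_betw matrix_inv H H"
    by (rule bij_betwI[where g = matrix_inv]) (use H uni in \<open>auto simp: unitary_group_def matrix_inv_inv\<close>)
  have "Ksum K H w z = (\<Sum>h\<in>H. K w (matrix_inv h *v z) * cnj (det (matrix_inv h)))"
    unfolding Ksum_def by (rule sum.reindex_bij_betw[OF bij, symmetric])
  also have "\<dots> = (\<Sum>h\<in>H. cnj (K z (h *v w) * cnj (det h)))"
  proof (rule sum.cong)
    fix h assume h: "h \<in> H"
    then have hG: "h \<in> G" "matrix_inv h \<in> G" using H by (auto simp: unitary_group_def)
    have "K w (matrix_inv h *v z) = K (h *v w) z"
      using K_invariant[OF hG(1) zw(2) inE[OF hG(2) zw(1)]] unitary_inv_vec(2)[OF uni[OF hG(1)]] by simp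
    also have "\<dots> = cnj (K z (h *v w))" using K_hermitian[OF zw(1) inE[OF hG(1) zw(2)]] .
    finally show "K w (matrix_inv h *v z) * cnj (det (matrix_inv h)) = cnj (K z (h *v w) * cnj (det h))"
      by (simp add: det_matrix_inv[OF uni[OF hG(1)]])
  qed simp
  finally show ?thesis by (simp add: Ksum_def)
qed

lemma wker_normalizer:
  assumes H: "unitary_group H" "H \<subseteq> G" and g: "g \<in> G" "normalizes g H" and zw: "z \<in> E" "w \<in> E"
  shows "wker K H s (g *v z) (g *v w) = wker K H s z w"
  unfolding wker_def Ksum_normalizer[OF H(2) g zw] jac_unitary[OF H(1) uni[OF g(1)] g(2)] ..

lemma wker_swap:
  assumes H: "unitary_group H" "H \<subseteq> G" and zw: "z \<in> E" "w \<in> E"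
  shows "wker K H s z w = wker K H (- s) w z"
  unfolding wker_def Ksum_hermitian[OF H zw] by (simp add: mult_ac)

text \<open>For the full group z may move alone: anti-invariance changes the kernel only by a
  unimodular factor.\<close>

lemma wker_left_invariant:
  assumes g: "g \<in> G" and zw: "z \<in> E" "w \<in> E"
  shows "wker K G s (g *v z) w = wker K G s z w"
proof -
  have "cmod (Ksum K G z w) = cmod (Ksum K G (g *v z) w)"
    using Ksum_anti_invariant[OF G order_refl g zw] unitary_det(2)[OF uni[OF g]]
    by (metis mult_1 norm_mult)
  then show ?thesis unfolding wker_def jac_unitary[OF G uni[OF g] unitary_group_normalizes[OF G g]] by simp
qed

lemma closure_invariant: "g \<in> G \<Longrightarrow> z \<in> closure E \<Longrightarrow> g *v z \<in> closure E"
proof -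
  assume g: "g \<in> G" and z: "z \<in> closure E"
  have "(*v) g ` closure E \<subseteq> closure E"
    using inE[OF g] closure_subset[of E]
    by (intro image_closure_subset linear_continuous_on[OF bounded_linear_cmat]) auto
  then show ?thesis using z by blast
qed

lemma zreg_Ksum:
  assumes T: "T \<subseteq> G" and reg: "\<And>h. h \<in> T \<Longrightarrow> zreg E K z0 (h *v w0)"
  shows "zreg E (Ksum K T) z0 w0"
proof -
  have "finite T" using T G finite_subset by (auto simp: unitary_group_def)
  then have "zreg E (\<lambda>z w. \<Sum>h\<in>T. cnj (det h) * K z (h *v w)) z0 w0"
    using T by (intro zreg_sum zreg_compose[OF uni GE reg]) auto
  moreover have "(\<lambda>z w. \<Sum>h\<in>T. cnj (det h) * K z (h *v w)) = Ksum K T"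
    by (simp add: fun_eq_iff Ksum_def mult.commute del: matrix_vector_2)
  ultimately show ?thesis by simp
qed

section \<open>Local estimates\<close>

lemma local_bound_off_orbit:
  assumes cl: "z0 \<in> closure E" "w0 \<in> closure E" and ne: "\<And>h. h \<in> G \<Longrightarrow> z0 \<noteq> h *v w0 \<or> z0 \<in> E"
    and s: "0 \<le> s" "s < 1"
  shows "\<exists>\<delta>>0. \<exists>C>0. \<forall>z\<in>E \<inter> ball z0 \<delta>. \<forall>w\<in>E \<inter> ball w0 \<delta>. wker K G s z w \<le> C"
proof -
  have "zreg E (Ksum K G) z0 w0"
    using kernel_zreg[OF E K(2) cl(1) closure_invariant[OF _ cl(2)] ne] by (intro zreg_Ksum) auto
  from zreg_division[OF G GE this Ksum_anti_invariant[OF G order_refl]]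
  obtain \<delta> C where \<delta>: "\<delta> > 0" "C > 0"
    "\<And>z w. z \<in> E \<inter> ball z0 \<delta> \<Longrightarrow> w \<in> E \<inter> ball w0 \<delta> \<Longrightarrow> cmod (Ksum K G z w) \<le> C * cmod (jac G z)" by blast
  obtain B where B: "1 \<le> B" "\<And>z. z \<in> E \<Longrightarrow> cmod (jac G z) \<le> B" using jac_bounded[OF E(2), of G] by blast
  have "wker K G s z w \<le> C * B * B" if z: "z \<in> E \<inter> ball z0 \<delta>" and w: "w \<in> E \<inter> ball w0 \<delta>" for z w
    unfolding wker_def
  proof (rule weight_bound)
    have "cmod (Ksum K G z w) / real (card G) \<le> cmod (Ksum K G z w)"
      by (cases "card G") (auto simp: divide_le_eq mult_le_cancel_left1)
    then show "cmod (Ksum K G z w) / real (card G) \<le> C * cmod (jac G z)" using \<delta>(3)[OF z w] by linarith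
  qed (use B z w s \<delta> in auto)
  moreover have "C * B * B > 0" using \<delta> B by simp
  ultimately show ?thesis using \<delta>(1) by blast
qed

text \<open>In applications H and H' are the two subgroups in either order. The Jacobian of H' is
  bounded above and below near w0, so its weight costs only a constant and the weight of H
  remains.\<close>

lemma local_bound_diagonal:
  assumes H: "unitary_group H" "H \<subseteq> G" and fac: "\<And>z. jac G z = jac H z * jac H' z"
    and w0: "w0 \<in> closure E" "jac H' w0 \<noteq> 0" and st: "\<And>h. h \<in> G \<Longrightarrow> h *v w0 = w0 \<Longrightarrow> h \<in> H"
    and s: "0 \<le> s" "s < 1"
  shows "\<exists>\<delta>>0. \<exists>C>0. \<forall>z\<in>E \<inter> ball w0 \<delta>. \<forall>w\<in>E \<inter> ball w0 \<delta>. wker K G s z w \<le> C * (wker K H s z w + 1)"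
proof -
  have finG: "finite G" using G by (simp add: unitary_group_def)
  define L where "L = Ksum K (G - H)"
  have split: "Ksum K G z w = Ksum K H z w + L z w" for z w
    unfolding L_def Ksum_def using sum.subset_diff[OF H(2) finG] by (simp add: add.commute)
  have regL: "zreg E L w0 w0" unfolding L_def
  proof (rule zreg_Ksum)
    fix h assume "h \<in> G - H"
    then have h: "h \<in> G" and "h *v w0 \<noteq> w0" using st by blast+
    then have "w0 \<noteq> h *v w0" by metis
    with h show "zreg E K w0 (h *v w0)"
      by (intro kernel_zreg[OF E K(2) w0(1) closure_invariant[OF _ w0(1)]] disjI1)
  qed blast
  \<comment> \<open>The complement of H is not a group; the rule for L is the difference of the
    rules for the sums over G and over H.\<close>
  have antiL: "det r * L (r *v z) w = L z w" if "r \<in> H" "z \<in> E" "w \<in> E" for r z w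
  proof -
    have "det r * Ksum K G (r *v z) w = Ksum K G z w" "det r * Ksum K H (r *v z) w = Ksum K H z w"
      using that H Ksum_anti_invariant[OF G order_refl] Ksum_anti_invariant[OF H] by auto
    then show ?thesis by (simp add: split distrib_left)
  qed
  have "\<exists>\<delta>>0. \<exists>C>0. \<forall>z\<in>E \<inter> ball w0 \<delta>. \<forall>w\<in>E \<inter> ball w0 \<delta>. cmod (L z w) \<le> C * cmod (jac H z)"
    by (rule zreg_division[OF H(1) _ regL antiL]) (use GE H(2) in blast)
  then obtain \<delta>1 C where \<delta>1: "\<delta>1 > 0" "C > 0"
    "\<And>z w. z \<in> E \<inter> ball w0 \<delta>1 \<Longrightarrow> w \<in> E \<inter> ball w0 \<delta>1 \<Longrightarrow> cmod (L z w) \<le> C * cmod (jac H z)" by blast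
  obtain B where B: "1 \<le> B" "\<And>z. z \<in> E \<Longrightarrow> cmod (jac H z) \<le> B" using jac_bounded[OF E(2), of H] by blast
  obtain B' where B': "1 \<le> B'" "\<And>z. z \<in> E \<Longrightarrow> cmod (jac H' z) \<le> B'" using jac_bounded[OF E(2), of H'] by blast
  define c where "c = cmod (jac H' w0) / 2"
  have c: "c > 0" using w0 by (simp add: c_def)
  have "isCont (jac H') w0" using continuous_on_jac[of UNIV H'] by (simp add: continuous_on_eq_continuous_at)
  from this[unfolded continuous_at_eps_delta, rule_format, OF c]
  obtain \<delta>2 where \<delta>2: "\<delta>2 > 0" "\<And>z. dist z w0 < \<delta>2 \<Longrightarrow> dist (jac H' z) (jac H' w0) < c" by blast
  have low: "c \<le> cmod (jac H' z)" if "z \<in> ball w0 \<delta>2" for z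
    using \<delta>2(2)[of z] that norm_triangle_ineq2[of "jac H' w0" "jac H' z"]
    by (simp add: dist_commute dist_norm norm_minus_commute c_def)
  \<comment> \<open>\<open>c\<close> is half the modulus of the Jacobian of H' at w0: with the upper
    bound B' it controls both powers, since s >= 0.\<close>
  define D where "D = c powr (- s) * B' powr s"
  have D: "D > 0" using c B' by (simp add: D_def)
  have cards: "1 \<le> real (card H)" "real (card H) \<le> real (card G)"
  proof -
    have "finite H" "H \<noteq> {}" using H by (auto simp: unitary_group_def)
    then have "card H > 0" by (simp add: card_gt_0_iff)
    then show "1 \<le> real (card H)" by simp
    show "real (card H) \<le> real (card G)" using card_mono[OF finG H(2)] by simp
  qed
  have "wker K G s z w \<le> D * (C * B * B + 1) * (wker K H s z w + 1)"
    if z: "z \<in> E \<inter> ball w0 (min \<delta>1 \<delta>2)" and w: "w \<in> E \<inter> ball w0 (min \<delta>1 \<delta>2)" for z w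
  proof -
    define x y where "x = cmod (jac H z)" and "y = cmod (jac H w)"
    define x' y' where "x' = cmod (jac H' z)" and "y' = cmod (jac H' w)"
    have pos: "0 \<le> x" "0 \<le> y" "0 \<le> x'" "0 \<le> y'" by (auto simp: x_def y_def x'_def y'_def)
    have "x' powr (- s) * y' powr s \<le> D" unfolding D_def
    proof (intro mult_mono)
      have "c \<le> x'" using low[of z] z by (simp add: x'_def)
      then show "x' powr (- s) \<le> c powr (- s)" using c s by (intro powr_mono2') auto
      show "y' powr s \<le> B' powr s" using B'(2)[of w] w s pos by (intro powr_mono2) (auto simp: y'_def)
    qed auto
    moreover have wG: "wker K G s z w = x' powr (- s) * y' powr s * (x powr (- s) * (cmod (Ksum K G z w) / card G) * y powr s)"
      unfolding wker_def fac norm_mult x_def[symmetric] y_def[symmetric] x'_def[symmetric] y'_def[symmetric]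
      using pos by (simp add: powr_mult)
    moreover have "x powr (- s) * (cmod (Ksum K G z w) / card G) * y powr s \<le> wker K H s z w + C * B * B"
    proof -
      have "cmod (Ksum K G z w) / card G \<le> (cmod (Ksum K H z w) + cmod (L z w)) / card G"
        unfolding split by (intro divide_right_mono norm_triangle_ineq) auto
      also have "\<dots> \<le> cmod (Ksum K H z w) / card H + cmod (L z w)"
      proof -
        have "cmod (Ksum K H z w) / card G \<le> cmod (Ksum K H z w) / card H"
          using cards by (intro divide_left_mono) auto
        moreover have "cmod (L z w) / card G \<le> cmod (L z w)"
          using cards mult_left_mono[of 1 "real (card G)" "cmod (L z w)"] by (simp add: divide_le_eq)
        ultimately show ?thesis by (simp add: add_divide_distrib)
      qed
      finally have "x powr (- s) * (cmod (Ksum K G z w) / card G) * y powr s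
          \<le> x powr (- s) * (cmod (Ksum K H z w) / card H + cmod (L z w)) * y powr s"
        by (intro mult_right_mono mult_left_mono) auto
      also have "\<dots> = wker K H s z w + x powr (- s) * cmod (L z w) * y powr s"
        by (simp add: wker_def x_def y_def distrib_left distrib_right)
      also have "x powr (- s) * cmod (L z w) * y powr s \<le> C * B * B"
        using B \<delta>1(2,3) z w s pos by (intro weight_bound) (auto simp: x_def y_def)
      finally show ?thesis by simp
    qed
    ultimately have "wker K G s z w \<le> D * (wker K H s z w + C * B * B)"
      unfolding wG using D by (intro mult_mono) auto
    also have "\<dots> \<le> D * ((C * B * B + 1) * (wker K H s z w + 1))"
    proof (intro mult_left_mono)
      have "0 \<le> C * B * B * wker K H s z w" using \<delta>1(2) B wker_nonneg by simp
      then show "wker K H s z w + C * B * B \<le> (C * B * B + 1) * (wker K H s z w + 1)"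
        by (simp add: distrib_left distrib_right)
    qed (use D in auto)
    finally show ?thesis by (simp add: mult.assoc)
  qed
  moreover have "D * (C * B * B + 1) > 0" using D \<delta>1 B by (simp add: add_pos_pos)
  moreover have "min \<delta>1 \<delta>2 > 0" using \<delta>1 \<delta>2 by simp
  ultimately show ?thesis by blast
qed

section \<open>From local to global\<close>

lemma weighted_kernel_bound:
  assumes R: "refl_hyps G = S1 \<union> S2" "S1 \<inter> S2 = {}"
    and S: "refl_hyps (sub_gen G S1) = S1" "refl_hyps (sub_gen G S2) = S2" and s: "0 \<le> s" "s < 1"
  shows "\<exists>C>0. \<forall>z\<in>E. \<forall>w\<in>E. wker K G s z w
    \<le> C * (\<Sum>g\<in>G. wker K (sub_gen G S1) s (g *v z) w + wker K (sub_gen G S2) s (g *v z) w + 1)"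
proof -
  define T where "T = (\<lambda>(z, w). \<Sum>g\<in>G. wker K (sub_gen G S1) s (g *v z) w + wker K (sub_gen G S2) s (g *v z) w + 1)"
  have finG: "finite G" using G by (simp add: unitary_group_def)
  have T_ge: "wker K (sub_gen G S1) s (g *v z) w + wker K (sub_gen G S2) s (g *v z) w + 1 \<le> T (z, w)" if "g \<in> G" for g z w
  proof -
    have "0 \<le> wker K (sub_gen G S1) s (h *v z) w + wker K (sub_gen G S2) s (h *v z) w + 1" for h
      by (intro add_nonneg_nonneg wker_nonneg) simp
    then show ?thesis unfolding T_def prod.case
      by (intro member_le_sum[OF that _ finG,
            where f = "\<lambda>g. wker K (sub_gen G S1) s (g *v z) w + wker K (sub_gen G S2) s (g *v z) w + 1"])
  qed
  have one: "mat 1 \<in> G" using G by (simp add: unitary_group_def)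
  have T1: "1 \<le> T p" for p
    using T_ge[OF one, of "fst p" "snd p"] wker_nonneg[of K "sub_gen G S1" s "mat 1 *v fst p" "snd p"]
      wker_nonneg[of K "sub_gen G S2" s "mat 1 *v fst p" "snd p"] by (simp del: matrix_vector_2)
  have "\<exists>C>0. \<forall>p\<in>E \<times> E. (\<lambda>(z, w). wker K G s z w) p \<le> C * T p"
  proof (rule compact_local_bound)
    show "compact (closure E \<times> closure E)" using E by (intro compact_Times) (simp_all add: compact_closure)
    show "E \<times> E \<subseteq> closure E \<times> closure E" using closure_subset by blast
    show "0 \<le> T p" for p using T1[of p] by simp
    fix q assume "q \<in> closure E \<times> closure E"
    then obtain z0 w0 where q: "q = (z0, w0)" and cl: "z0 \<in> closure E" "w0 \<in> closure E" by blast
    have loc: "\<exists>\<delta>>0. \<exists>C>0. \<forall>z\<in>E \<inter> ball z0 \<delta>. \<forall>w\<in>E \<inter> ball w0 \<delta>. wker K G s z w \<le> C * T (z, w)"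
    proof (cases "\<forall>h\<in>G. z0 \<noteq> h *v w0 \<or> z0 \<in> E")
      case True
      obtain \<delta> C where \<delta>: "\<delta> > 0" "C > 0"
        "\<And>z w. z \<in> E \<inter> ball z0 \<delta> \<Longrightarrow> w \<in> E \<inter> ball w0 \<delta> \<Longrightarrow> wker K G s z w \<le> C"
        using local_bound_off_orbit[OF cl _ s] True by blast
      have "wker K G s z w \<le> C * T (z, w)" if "z \<in> E \<inter> ball z0 \<delta>" "w \<in> E \<inter> ball w0 \<delta>" for z w
      proof -
        have "C * 1 \<le> C * T (z, w)" using T1[of "(z, w)"] \<delta>(2) by (intro mult_left_mono) auto
        then show ?thesis using \<delta>(3)[OF that] by linarith
      qed
      then show ?thesis using \<delta> by blast
    next
      case False
      then obtain h where h: "h \<in> G" "z0 = h *v w0" "z0 \<notin> E" by blast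
      have w0: "w0 \<noteq> 0" using h inE[OF h(1), of w0] E(3) by metis
      \<comment> \<open>Which subgroup is used depends on w0. As w0 is nonzero, at most one
        reflecting line contains it, so one of the disjoint classes has no line through it.\<close>
      have "\<exists>S'\<in>{S1, S2}. \<exists>\<delta>>0. \<exists>C>0. \<forall>z\<in>E \<inter> ball w0 \<delta>. \<forall>w\<in>E \<inter> ball w0 \<delta>.
          wker K G s z w \<le> C * (wker K (sub_gen G S') s z w + 1)"
      proof (cases "\<forall>Y\<in>S2. w0 \<notin> Y")
        case True
        have "jac (sub_gen G S2) w0 \<noteq> 0"
          using sub_gen_unitary_group[OF G, of S2] S True by (intro jac_nonzero) (auto simp: unitary_group_def)
        from local_bound_diagonal[OF sub_gen_unitary_group[OF G] sub_gen_subset[OF G]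
            jac_factor[OF G R S] cl(2) this stab_in_sub_gen[OF G R(1) w0 True] s]
        show ?thesis by blast
      next
        case False
        have S1: "\<forall>Y\<in>S1. w0 \<notin> Y"
        proof (intro ballI notI)
          fix Y assume Y: "Y \<in> S1" "w0 \<in> Y"
          obtain Y' where Y': "Y' \<in> S2" "w0 \<in> Y'" using False by blast
          obtain v where "v \<noteq> 0" "Y = cline v" using refl_hyps_cline[of Y G] R(1) Y(1) by blast
          then have "Y = cline w0" using cline_eq[of v w0] w0 Y(2) by simp
          moreover obtain v' where "v' \<noteq> 0" "Y' = cline v'" using refl_hyps_cline[of Y' G] R(1) Y'(1) by blast
          then have "Y' = cline w0" using cline_eq[of v' w0] w0 Y'(2) by simp
          ultimately show False using Y(1) Y'(1) R(2) by blast
        qed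
        have R': "refl_hyps G = S2 \<union> S1" using R(1) by blast
        have "jac (sub_gen G S1) w0 \<noteq> 0"
          using sub_gen_unitary_group[OF G, of S1] S S1 by (intro jac_nonzero) (auto simp: unitary_group_def)
        moreover have "jac G z = jac (sub_gen G S2) z * jac (sub_gen G S1) z" for z
          using jac_factor[OF G R S] by (simp add: mult.commute)
        ultimately show ?thesis
          using local_bound_diagonal[OF sub_gen_unitary_group[OF G] sub_gen_subset[OF G]
            _ cl(2) _ stab_in_sub_gen[OF G R' w0 S1] s] by blast
      qed
      then obtain S' where S': "S' \<in> {S1, S2}" and "\<exists>\<delta>>0. \<exists>C>0. \<forall>z\<in>E \<inter> ball w0 \<delta>. \<forall>w\<in>E \<inter> ball w0 \<delta>.
          wker K G s z w \<le> C * (wker K (sub_gen G S') s z w + 1)" by (elim bexE)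
      then obtain \<delta> C where \<delta>: "\<delta> > 0" "C > 0"
        "\<And>z w. z \<in> E \<inter> ball w0 \<delta> \<Longrightarrow> w \<in> E \<inter> ball w0 \<delta> \<Longrightarrow>
           wker K G s z w \<le> C * (wker K (sub_gen G S') s z w + 1)" by blast
      let ?k = "matrix_inv h"
      have k: "?k \<in> G" using G h by (simp add: unitary_group_def)
      \<comment> \<open>Moving z by the inverse of h brings it close to w0, leaves the left side
        unchanged, and turns the right side into one summand of \<open>T\<close>.\<close>
      have "wker K G s z w \<le> C * T (z, w)" if z: "z \<in> E \<inter> ball z0 \<delta>" and w: "w \<in> E \<inter> ball w0 \<delta>" for z w
      proof -
        have "?k *v z \<in> ball w0 \<delta>"
          using z unitary_dist[OF uni[OF k], of z0 z] unitary_inv_vec(1)[OF uni[OF h(1)], of w0] h(2)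
          by (simp del: matrix_vector_2 unitary_inv_vec)
        then have kz: "?k *v z \<in> E \<inter> ball w0 \<delta>" using inE[OF k] z by blast
        have "wker K G s z w = wker K G s (?k *v z) w" using wker_left_invariant[OF k] z w by simp
        also have "\<dots> \<le> C * (wker K (sub_gen G S') s (?k *v z) w + 1)" using \<delta>(3)[OF kz w] .
        also have "\<dots> \<le> C * T (z, w)"
        proof (rule mult_left_mono)
          show "wker K (sub_gen G S') s (?k *v z) w + 1 \<le> T (z, w)"
            using T_ge[OF k, of z w] S' wker_nonneg[of K "sub_gen G S1" s "?k *v z" w]
              wker_nonneg[of K "sub_gen G S2" s "?k *v z" w] by auto
        qed (use \<delta> in simp)
        finally show ?thesis .
      qed
      then show ?thesis using \<delta> by blast
    qed
    then obtain \<delta> C where \<delta>: "\<delta> > 0"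
      "\<And>z w. z \<in> E \<inter> ball z0 \<delta> \<Longrightarrow> w \<in> E \<inter> ball w0 \<delta> \<Longrightarrow> wker K G s z w \<le> C * T (z, w)" by blast
    have "wker K G s z w \<le> C * T (z, w)" if "z \<in> E" "w \<in> E" "dist q (z, w) < \<delta>" for z w
      using that \<delta>(2)[of z w] dist_fst_le[of q "(z, w)"] dist_snd_le[of q "(z, w)"] q by simp
    then show "\<exists>\<delta>>0. \<exists>C. \<forall>p\<in>E \<times> E. dist q p < \<delta> \<longrightarrow> (\<lambda>(z, w). wker K G s z w) p \<le> C * T p"
      using \<delta>(1) by (intro exI[of _ \<delta>] conjI exI[of _ C]) auto
  qed
  then show ?thesis unfolding T_def by auto
qed

text \<open>For s < 0 the two variables are exchanged, which replaces s by - s. It remains to see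
  that the sum on the right is symmetric under this exchange.\<close>

lemma weighted_kernel_bound_dual:
  assumes inv: "G_inv_hyps G S1" "G_inv_hyps G S2" and R: "refl_hyps G = S1 \<union> S2" "S1 \<inter> S2 = {}"
    and S: "refl_hyps (sub_gen G S1) = S1" "refl_hyps (sub_gen G S2) = S2" and s: "-1 < s" "s < 1"
  shows "\<exists>C>0. \<forall>z\<in>E. \<forall>w\<in>E. wker K G s z w
    \<le> C * (\<Sum>g\<in>G. wker K (sub_gen G S1) s (g *v z) w + wker K (sub_gen G S2) s (g *v z) w + 1)"
proof (cases "0 \<le> s")
  case True
  then show ?thesis using weighted_kernel_bound[OF R S] s by blast
next
  case False
  obtain C where C: "C > 0" "\<And>z w. z \<in> E \<Longrightarrow> w \<in> E \<Longrightarrow> wker K G (- s) z w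
    \<le> C * (\<Sum>g\<in>G. wker K (sub_gen G S1) (- s) (g *v z) w + wker K (sub_gen G S2) (- s) (g *v z) w + 1)"
    using weighted_kernel_bound[OF R S, of "- s"] s False by auto
  have bij: "bij_betw matrix_inv G G"
    by (rule bij_betwI[where g = matrix_inv]) (use G uni in \<open>auto simp: unitary_group_def matrix_inv_inv\<close>)
  \<comment> \<open>The exchange puts the group element on w; normality of the subgroup allows g to
    be applied to both variables, which brings it back to z. Summation over inverses then restores
    the sum.\<close>
  have flip: "wker K (sub_gen G S') (- s) (matrix_inv g *v w) z = wker K (sub_gen G S') s (g *v z) w"
    if S': "G_inv_hyps G S'" and g: "g \<in> G" and zw: "z \<in> E" "w \<in> E" for S' g z w
  proof -
    note H = sub_gen_unitary_group[OF G, of S'] sub_gen_subset[OF G, of S']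
    have ginv: "matrix_inv g \<in> G" using G g by (simp add: unitary_group_def)
    have "wker K (sub_gen G S') s (g *v z) w = wker K (sub_gen G S') s (g *v z) (g *v (matrix_inv g *v w))"
      by (simp only: unitary_inv_vec(2)[OF uni[OF g]])
    also have "\<dots> = wker K (sub_gen G S') s z (matrix_inv g *v w)"
      by (rule wker_normalizer[OF H g sub_gen_normal[OF G S' g] zw(1) inE[OF ginv zw(2)]])
    also have "\<dots> = wker K (sub_gen G S') (- s) (matrix_inv g *v w) z"
      by (rule wker_swap[OF H zw(1) inE[OF ginv zw(2)]])
    finally show ?thesis ..
  qed
  have "wker K G s z w \<le> C * (\<Sum>g\<in>G. wker K (sub_gen G S1) s (g *v z) w + wker K (sub_gen G S2) s (g *v z) w + 1)"
    if zw: "z \<in> E" "w \<in> E" for z w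
  proof -
    have "wker K G s z w = wker K G (- s) w z" by (rule wker_swap[OF G order_refl zw])
    also have "\<dots> \<le> C * (\<Sum>g\<in>G. wker K (sub_gen G S1) (- s) (g *v w) z + wker K (sub_gen G S2) (- s) (g *v w) z + 1)"
      by (rule C(2)[OF zw(2,1)])
    also have "(\<Sum>g\<in>G. wker K (sub_gen G S1) (- s) (g *v w) z + wker K (sub_gen G S2) (- s) (g *v w) z + 1)
       = (\<Sum>g\<in>G. wker K (sub_gen G S1) (- s) (matrix_inv g *v w) z + wker K (sub_gen G S2) (- s) (matrix_inv g *v w) z + 1)"
      by (rule sum.reindex_bij_betw[OF bij, symmetric])
    also have "\<dots> = (\<Sum>g\<in>G. wker K (sub_gen G S1) s (g *v z) w + wker K (sub_gen G S2) s (g *v z) w + 1)"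
      by (intro sum.cong refl) (simp only: flip[OF inv(1) _ zw] flip[OF inv(2) _ zw])
    finally show ?thesis .
  qed
  then show ?thesis using C(1) by blast
qed

end

theorem theorem1p13:
  fixes G :: "cmat set" and E :: "cvec set" and K :: "cvec \<Rightarrow> cvec \<Rightarrow> complex"
    and S1 S2 :: "cvec set set"
  assumes "furg G"
    and "open E" and "connected E" and "bounded E" and "0 \<in> E"
    and "G_inv_set G E" and "good G E"
    and "bergman_kernel E K"
    and "continues_off_diag E K"
    and "G_inv_hyps G S1" and "G_inv_hyps G S2"
    and "S1 \<subseteq> refl_hyps G" and "S2 \<subseteq> refl_hyps G"
    and "refl_hyps G = S1 \<union> S2" and "S1 \<inter> S2 = {}"
    and "S1 = refl_hyps (sub_gen G S1)" and "S2 = refl_hyps (sub_gen G S2)"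
  shows "\<forall>p>1. \<exists>C>0. \<forall>z\<in>E. \<forall>w\<in>E.
           cmod (KHp K G p z w) \<le> C * (1 / real (card G)) *
             (\<Sum>g\<in>G. cmod (KHp K (sub_gen G S1) p (g *v z) w)
                     + cmod (KHp K (sub_gen G S2) p (g *v z) w) + 1)"
proof (intro allI impI)
  fix p :: real assume p: "1 < p"
  interpret bergman_group G E K
    by unfold_locales (use assms(2,4,5,6,8,9) furg_unitary_group[OF assms(1)] in \<open>auto simp: G_inv_set_def\<close>)
  \<comment> \<open>The whole range p > 1 is used: the lower bound corresponds to p near 1, the
    upper one to large p.\<close>
  have "-1 < 1 - 2 / p" "1 - 2 / p < 1" using p by (auto simp: field_simps)
  then obtain C where C: "C > 0" "\<And>z w. z \<in> E \<Longrightarrow> w \<in> E \<Longrightarrow> wker K G (1 - 2 / p) z w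
    \<le> C * (\<Sum>g\<in>G. wker K (sub_gen G S1) (1 - 2 / p) (g *v z) w + wker K (sub_gen G S2) (1 - 2 / p) (g *v z) w + 1)"
    using weighted_kernel_bound_dual[OF assms(10,11,14,15) assms(16,17)[symmetric], of "1 - 2 / p"] by blast
  have card: "real (card G) > 0" using G by (auto simp: unitary_group_def card_gt_0_iff)
  show "\<exists>C>0. \<forall>z\<in>E. \<forall>w\<in>E. cmod (KHp K G p z w) \<le> C * (1 / real (card G)) *
             (\<Sum>g\<in>G. cmod (KHp K (sub_gen G S1) p (g *v z) w) + cmod (KHp K (sub_gen G S2) p (g *v z) w) + 1)"
    \<comment> \<open>The factor \<open>card G\<close> compensates the averaging on the right
      side.\<close>
    unfolding norm_KHp using C card by (intro exI[of _ "C * real (card G)"]) auto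
qed

end
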